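(* Let $Y(t)$, $t\ge 0$, be a critical Markov branching process with non-homogeneous Poisson immigration, with offspring p.g.f. $f(s)=s+(1-s)^{\gamma+1}L(1/(1-s))$, $s\in[0,1)$, $\gamma\in(0,1]$, immigrant p.g.f. $g(s)=1-(1-s)^{\alpha}l(1/(1-s))$, $\alpha\in(0,1]$, and Poisson intensity $r(t)=t^{-\theta}L_R(t)$, where $L,l,L_R$ are slowly varying at infinity. Assume that $\theta\ge 1$ and $\alpha/\gamma\ge 1$. Then $$\mathbf{P}\{Y(t)>0\}\sim R(t)q(t)+Q(t)r(t),\qquad t\to\infty .$$
   Context: Model. In a Markov branching process each particle, independently of all others, lives an exponentially distributed time with parameter $\mu>0$ and at its death produces a random number $\xi\ge 0$ of new particles of the same type; $f(s)=\mathbf{E}[s^{\xi}]$ is the offspring p.g.f. Let $Z(t)$ be the number of particles at time $t$ and $F(t;s)=\mathbf{E}[s^{Z(t)}\mid Z(0)=1]$, so $\partial F(t;s)/\partial t=\mu[f(F(t;s))-F(t;s)]$, $F(0;s)=s$. Let $\nu(t)$ be a non-homogeneous Poisson process with intensity $r(t)$, mean measure $R(t)=\int_0^t r(u)\,du$ (finite for each $t$), and jump points $0=S_0<S_1<S_2<\cdots$. At each $S_k$, $k\ge1$, $I_k$ new particles immigrate, where $I_1,I_2,\dots$ are i.i.d. non-negative integer-valued with p.g.f. $g(s)=\mathbf{E}[s^{I_k}]$. The Markov branching process with non-homogeneous Poisson immigration is $$Y(t)=\sum_{k=1}^{\nu(t)}\sum_{j=1}^{I_k}Z^{(k,j)}(t-S_k),\qquad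 t\ge 0,$$ where $Z^{(k,j)}$ are i.i.d. copies of $Z$ started from one particle; the processes $Z^{(k,j)}$, the variables $I_k$ and the Poisson process $\nu$ are independent. Notation. $q(t;s)=1-g(F(t;s))$, $q(t)=q(t;0)$, $Q(t)=\int_0^t q(u)\,du$. The symbol $a(t)\sim b(t)$ means $a(t)/b(t)\to1$. *)

theory Defs
  imports "HOL-Probability.Probability"
begin

text \<open>Regular variation at infinity. As usual, a slowly varying function only has to be positive
  and measurable on some half-line.\<close>

definition slowly_varying :: "(real \<Rightarrow> real) \<Rightarrow> bool" where
  "slowly_varying L \<longleftrightarrow>
     (\<exists>X>0. (\<forall>x\<ge>X. L x > 0) \<and> set_borel_measurable borel {X..} L) \<and>
     (\<forall>c>0. ((\<lambda>x. L (c * x) / L x) \<longlongrightarrow> 1) at_top)"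

definition pgf :: "nat pmf \<Rightarrow> real \<Rightarrow> real" where
  "pgf p s = measure_pmf.expectation p (\<lambda>k. s ^ k)"

text \<open>The branching process is built from its family tree. Particles carry Ulam-Harris labels:
  the ancestor is \<open>[]\<close>, and the children of \<open>u\<close> are \<open>u @ [0], u @ [1], \<dots>\<close>.
  A tree \<open>w\<close> assigns to every label (whether or not a particle with that label is ever born)
  a pair of a life length and a number of children.\<close>

type_synonym tree = "nat list \<Rightarrow> real \<times> nat"

definition particle_law :: "real \<Rightarrow> nat pmf \<Rightarrow> (real \<times> nat) measure" where
  "particle_law \<mu> p = density lborel (exponential_density \<mu>) \<Otimes>\<^sub>M measure_pmf p"

definition tree_law :: "real \<Rightarrow> nat pmf \<Rightarrow> tree measure" where
  "tree_law \<mu> p = Pi\<^sub>M UNIV (\<lambda>_. particle_law \<mu> p)"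

definition born :: "tree \<Rightarrow> nat list \<Rightarrow> bool" where
  "born w u \<longleftrightarrow> (\<forall>n<length u. u ! n < snd (w (take n u)))"

definition birth_time :: "tree \<Rightarrow> nat list \<Rightarrow> real" where
  "birth_time w u = (\<Sum>n<length u. fst (w (take n u)))"

definition alive :: "tree \<Rightarrow> real \<Rightarrow> nat list set" where
  "alive w t = {u. born w u \<and> birth_time w u \<le> t \<and> t < birth_time w u + fst (w u)}"

text \<open>\<open>Z(t)\<close>, the number of particles at time \<open>t\<close> of the process started from one particle;
  the value \<open>\<infinity>\<close> (explosion) is allowed, but has probability 0 in the critical case.\<close>

definition population :: "tree \<Rightarrow> real \<Rightarrow> enat" where
  "population w t = (if finite (alive w t) then enat (card (alive w t)) else \<infinity>)"

definition enat_power :: "real \<Rightarrow> enat \<Rightarrow> real" where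
  "enat_power s n = (case n of enat m \<Rightarrow> s ^ m | \<infinity> \<Rightarrow> 0)"

text \<open>\<open>F(t;s)\<close> for \<open>0 \<le> s < 1\<close>.\<close>

definition population_pgf :: "real \<Rightarrow> nat pmf \<Rightarrow> real \<Rightarrow> real \<Rightarrow> real" where
  "population_pgf \<mu> p t s = (\<integral>w. enat_power s (population w t) \<partial>tree_law \<mu> p)"

text \<open>\<open>q(t;s)\<close>, where \<open>p\<close> is the law of the offspring number and \<open>h\<close> the law of the size of a
  group of immigrants.\<close>

definition q_fun :: "real \<Rightarrow> nat pmf \<Rightarrow> nat pmf \<Rightarrow> real \<Rightarrow> real \<Rightarrow> real" where
  "q_fun \<mu> p h t s = 1 - pgf h (population_pgf \<mu> p t s)"

definition Q_fun :: "real \<Rightarrow> nat pmf \<Rightarrow> nat pmf \<Rightarrow> real \<Rightarrow> real" where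
  "Q_fun \<mu> p h t = (LINT u:{0..t}|lborel. q_fun \<mu> p h u 0)"

definition mean_measure :: "(real \<Rightarrow> real) \<Rightarrow> real \<Rightarrow> real" where
  "mean_measure r t = (LINT u:{0..t}|lborel. r u)"

text \<open>The jump points \<open>S k\<close> are extended reals: when the mean measure is bounded, there are only
  finitely many jumps, and \<open>S k = \<infinity>\<close> if there are fewer than \<open>k\<close> of them.\<close>

definition arrivals :: "(nat \<Rightarrow> 'a \<Rightarrow> ereal) \<Rightarrow> real \<Rightarrow> 'a \<Rightarrow> nat" where
  "arrivals S t \<omega> = card {k. 1 \<le> k \<and> S k \<omega> \<le> ereal t}"

locale poisson_process = prob_space M
  for M :: "'a measure" and r :: "real \<Rightarrow> real" and S :: "nat \<Rightarrow> 'a \<Rightarrow> ereal" +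
  assumes intensity_nonneg: "0 \<le> t \<Longrightarrow> 0 \<le> r t"
    and intensity_integrable: "0 \<le> t \<Longrightarrow> set_integrable lborel {0..t} r"
    and jump_0: "\<omega> \<in> space M \<Longrightarrow> S 0 \<omega> = 0"
    and jump_less: "\<omega> \<in> space M \<Longrightarrow> S k \<omega> < \<infinity> \<Longrightarrow> S k \<omega> < S (Suc k) \<omega>"
    and jump_infinity: "\<omega> \<in> space M \<Longrightarrow> S k \<omega> = \<infinity> \<Longrightarrow> S (Suc k) \<omega> = \<infinity>"
    and finite_jumps: "\<omega> \<in> space M \<Longrightarrow> finite {k. 1 \<le> k \<and> S k \<omega> \<le> ereal t}"
    and arrivals_measurable: "0 \<le> t \<Longrightarrow> random_variable (count_space UNIV) (arrivals S t)"
    and increments_poisson: "0 \<le> s \<Longrightarrow> s \<le> t \<Longrightarrow>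
      prob {\<omega> \<in> space M. arrivals S t \<omega> - arrivals S s \<omega> = n} =
        (mean_measure r t - mean_measure r s) ^ n / fact n
          * exp (- (mean_measure r t - mean_measure r s))"
    and increments_indep: "0 \<le> \<tau> 0 \<Longrightarrow> mono \<tau> \<Longrightarrow>
      indep_vars (\<lambda>_. count_space UNIV)
        (\<lambda>i \<omega>. arrivals S (\<tau> (Suc i)) \<omega> - arrivals S (\<tau> i) \<omega>) {..<n :: nat}"

text \<open>The independent sources of randomness: the family tree of the \<open>j\<close>-th immigrant of the
  \<open>k\<close>-th group, the size of the \<open>k\<close>-th group, and the whole arrival process.\<close>

datatype source = Tree nat nat | Group nat | Arrivals

primrec source_events ::
  "'a measure \<Rightarrow> (nat \<Rightarrow> 'a \<Rightarrow> ereal) \<Rightarrow> (nat \<Rightarrow> 'a \<Rightarrow> nat) \<Rightarrow> (nat \<Rightarrow> nat \<Rightarrow> 'a \<Rightarrow> tree) \<Rightarrow>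
    real \<Rightarrow> nat pmf \<Rightarrow> source \<Rightarrow> 'a set set" where
  "source_events M S I T \<mu> p (Tree k j) = {T k j -` A \<inter> space M | A. A \<in> sets (tree_law \<mu> p)}"
| "source_events M S I T \<mu> p (Group k) = {I k -` A \<inter> space M | A. True}"
| "source_events M S I T \<mu> p Arrivals =
    sigma_sets (space M) {arrivals S t -` A \<inter> space M | t A. 0 \<le> t}"

locale branching_poisson_immigration = poisson_process M r S
  for M :: "'a measure" and r :: "real \<Rightarrow> real" and S :: "nat \<Rightarrow> 'a \<Rightarrow> ereal" +
  fixes \<mu> :: real and p h :: "nat pmf"
    and I :: "nat \<Rightarrow> 'a \<Rightarrow> nat" and T :: "nat \<Rightarrow> nat \<Rightarrow> 'a \<Rightarrow> tree"
  assumes rate_pos: "0 < \<mu>"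
    and group_measurable: "1 \<le> k \<Longrightarrow> random_variable (count_space UNIV) (I k)"
    and group_law: "1 \<le> k \<Longrightarrow> distr M (count_space UNIV) (I k) = measure_pmf h"
    and tree_measurable: "1 \<le> k \<Longrightarrow> 1 \<le> j \<Longrightarrow> random_variable (tree_law \<mu> p) (T k j)"
    and tree_distr: "1 \<le> k \<Longrightarrow> 1 \<le> j \<Longrightarrow> distr M (tree_law \<mu> p) (T k j) = tree_law \<mu> p"
    and sources_indep: "indep_sets (source_events M S I T \<mu> p)
      ({Tree k j | k j. 1 \<le> k \<and> 1 \<le> j} \<union> {Group k | k. 1 \<le> k} \<union> {Arrivals})"

text \<open>\<open>Y(t)\<close>; note that \<open>S k\<close> is finite for \<open>1 \<le> k \<le> \<nu>(t)\<close>.\<close>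

definition immigration_process ::
  "(nat \<Rightarrow> 'a \<Rightarrow> ereal) \<Rightarrow> (nat \<Rightarrow> 'a \<Rightarrow> nat) \<Rightarrow> (nat \<Rightarrow> nat \<Rightarrow> 'a \<Rightarrow> tree) \<Rightarrow>
    real \<Rightarrow> 'a \<Rightarrow> enat" where
  "immigration_process S I T t \<omega> =
     (\<Sum>k = 1..arrivals S t \<omega>. \<Sum>j = 1..I k \<omega>.
        population (T k j \<omega>) (t - real_of_ereal (S k \<omega>)))"

end

theory Submission
  imports Defs "HOL-Real_Asymp.Real_Asymp"
begin

text \<open>Let \<open>q(t) = 1 - g(F(t;0))\<close>. A group that immigrates at time \<open>u\<close> has descendants alive at time
  \<open>t\<close> with probability \<open>q(t - u)\<close>, independently of all other groups, so the groups with
  descendants at time \<open>t\<close> form a thinned Poisson process and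
  \<open>P{Y(t) > 0} = 1 - exp(-J(t))\<close>, where \<open>J(t)\<close> is the integral of \<open>r(u) q(t - u)\<close> over
  \<open>0 \<le> u \<le> t\<close> (\<open>prob_no_individuals\<close>). As \<open>1 - exp(-x)\<close> is asymptotic to \<open>x\<close> at 0, it is
  enough to know that \<open>J\<close> vanishes at infinity and is asymptotic to \<open>R q + Q r\<close>.

  This is a property of the convolution of two functions that are regularly varying with
  indices at most \<open>-1\<close> (\<open>convolution_asymptotics\<close>). For such a function the mass near 0
  dominates: \<open>t r(t)\<close> is negligible against \<open>R(t)\<close>, and \<open>R\<close> is slowly varying. In \<open>J(t)\<close> the
  values of \<open>u\<close> near 0, where \<open>q(t - u)\<close> is close to \<open>q(t)\<close>, contribute \<open>R(t) q(t)\<close>; the values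
  near \<open>t\<close> contribute \<open>Q(t) r(t)\<close>; the middle range only has the order of \<open>t r(t) q(t)\<close>, which
  is negligible. The intensity is merely measurable, so the comparison of \<open>r(u)\<close> with
  \<open>r(t)\<close> rests on the uniform convergence theorem for slowly varying functions
  (\<open>slowly_varying_uniform\<close>).

  It remains to see that \<open>q\<close> varies regularly with index \<open>-\<alpha>/\<gamma>\<close>. Conditioning on the
  life length and the offspring of the ancestor gives an integral equation for the extinction
  probability (\<open>extinction_equation\<close>), hence a differential equation: the survival
  probability \<open>u\<close> satisfies \<open>u' = -\<mu> K(u)\<close> with \<open>K(x) = f(1 - x) - (1 - x)\<close>. This \<open>K\<close> is convex
  and varies regularly at 0 with index \<open>\<gamma> + 1\<close>. Convexity allows to differentiate the
  asymptotics, \<open>x K'(x)/K(x) \<longlongrightarrow> \<gamma> + 1\<close> (\<open>elasticity\<close>), so that the derivative of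
  \<open>u/K(u)\<close> tends to \<open>\<mu>\<gamma>\<close> and \<open>u(t)/K(u(t))\<close> grows like \<open>\<mu>\<gamma>t\<close>. Inverting this relation shows that
  \<open>u\<close> varies regularly with index \<open>-1/\<gamma>\<close> (\<open>u_ratio\<close>), and then \<open>q = u^\<alpha> l(1/u)\<close> with index
  \<open>-\<alpha>/\<gamma>\<close>.

  The formula for \<open>P{Y(t) = 0}\<close> is obtained without conditioning on the arrival times. The
  interval from 0 to \<open>t\<close> is cut into small cells. Extinction is permanent, so replacing the arrival
  times in a cell by its left or its right end point encloses the event \<open>Y(t) = 0\<close>
  between two events whose probabilities only involve the independent Poisson numbers of arrivals
  in the cells (\<open>prob_extinct_on_grid\<close>); both tend to the claimed value because \<open>q\<close> is continuous.\<close>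

section \<open>Slowly and regularly varying functions\<close>

text \<open>The uniform convergence theorem in additive form. If it failed, there would be points \<open>x n\<close>
  tending to infinity and bounded shifts \<open>u n\<close> such that \<open>h\<close> differs by \<open>\<epsilon>\<close> at \<open>x n\<close> and
  \<open>x n + u n\<close>. By pointwise convergence, for large \<open>n\<close> most points near \<open>x n\<close> have a value of \<open>h\<close>
  close to \<open>h (x n)\<close>, and most have one close to \<open>h (x n + u n)\<close>; a point with both properties
  is a contradiction.\<close>

lemma additive_uniform_convergence:
  fixes h :: "real \<Rightarrow> real"
  assumes [measurable]: "h \<in> borel_measurable borel"
    and lim: "\<And>u. ((\<lambda>x. h (x + u) - h x) \<longlongrightarrow> 0) at_top"
    and "0 < K" "0 < \<epsilon>"
  shows "\<forall>\<^sub>F x in at_top. \<forall>u\<in>{-K..K}. \<bar>h (x + u) - h x\<bar> < \<epsilon>"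
proof (rule ccontr)
  assume "\<not> ?thesis"
  then have "\<forall>n::nat. \<exists>x\<ge>real n. \<exists>u\<in>{-K..K}. \<epsilon> \<le> \<bar>h (x + u) - h x\<bar>"
    unfolding eventually_at_top_linorder by (meson linorder_not_le)
  then obtain x u where x: "\<And>n. real n \<le> x n" and u: "\<And>n. u n \<in> {-K..K}"
    and far: "\<And>n. \<epsilon> \<le> \<bar>h (x n + u n) - h (x n)\<bar>" by metis
  have x_top: "filterlim x at_top sequentially"
    by (rule filterlim_at_top_mono[OF filterlim_real_sequentially]) (simp add: x)
  have y_top: "filterlim (\<lambda>n. x n + u n) at_top sequentially"
  proof (rule filterlim_at_top_mono)
    show "filterlim (\<lambda>n. -K + real n) at_top sequentially"
      by (intro filterlim_tendsto_add_at_top[OF tendsto_const] filterlim_real_sequentially)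
    have "-K + real n \<le> x n + u n" for n using x[of n] u[of n] by auto
    then show "\<forall>\<^sub>F n in sequentially. -K + real n \<le> x n + u n" by simp
  qed
  \<comment> \<open>\<open>good (x) n\<close> and the translate of \<open>good (x + u) n\<close> both lie in an interval of length \<open>6 K\<close>, and
    each has a measure above \<open>3 K\<close> for large \<open>n\<close>, so they intersect.\<close>
  define good where "good z n = {v\<in>{0..4*K}. \<forall>m\<ge>n. \<bar>h (z m + v) - h (z m)\<bar> < \<epsilon> / 2}"
    for z :: "nat \<Rightarrow> real" and n :: nat
  have good_meas[measurable]: "good z n \<in> sets borel" for z n
    unfolding good_def by measurable
  have good_lim: "\<forall>\<^sub>F n in sequentially. 3 * K < measure lborel (good z n)"
    if z: "filterlim z at_top sequentially" for z
  proof -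
    have un: "(\<Union>n. good z n) = {0..4*K}"
    proof safe
      fix v assume v: "v \<in> {0..4*K}"
      have "((\<lambda>n. h (z n + v) - h (z n)) \<longlongrightarrow> 0) sequentially"
        using filterlim_compose[OF lim z] .
      from tendstoD[OF this half_gt_zero[OF \<open>0 < \<epsilon>\<close>]]
      have "\<forall>\<^sub>F n in sequentially. \<bar>h (z n + v) - h (z n)\<bar> < \<epsilon> / 2"
        by (simp add: dist_real_def)
      then show "v \<in> (\<Union>n. good z n)"
        using v by (auto simp: good_def eventually_sequentially)
    qed (auto simp: good_def)
    have "(\<lambda>n. measure lborel (good z n)) \<longlonglongrightarrow> measure lborel (\<Union>n. good z n)"
    proof (rule Lim_measure_incseq)
      show "incseq (good z)" by (auto simp: incseq_def good_def)
      show "emeasure lborel (\<Union>n. good z n) \<noteq> \<infinity>" using \<open>0 < K\<close> by (simp add: un)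
    qed auto
    then show ?thesis
      using \<open>0 < K\<close> by (intro order_tendstoD(1)[where y="4*K"]) (auto simp: un)
  qed
  obtain n where n: "3 * K < measure lborel (good x n)"
      "3 * K < measure lborel (good (\<lambda>n. x n + u n) n)"
    using eventually_happens[OF eventually_conj[OF good_lim[OF x_top] good_lim[OF y_top]]]
    by auto
  let ?V = "good x n" and ?W = "(\<lambda>v. - u n + v) -` good (\<lambda>n. x n + u n) n"
  have W_meas[measurable]: "?W \<in> sets borel"
    by (rule measurable_sets_borel[OF _ good_meas]) simp
  have fin: "S \<in> sets lborel \<Longrightarrow> S \<subseteq> {-K..5*K} \<Longrightarrow> S \<in> fmeasurable lborel" for S
    by (rule fmeasurableI2[of "{-K..5*K}"]) (auto intro!: fmeasurableI simp: emeasure_lborel_Icc_eq)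
  have V_sub: "?V \<subseteq> {-K..5*K}" using \<open>0 < K\<close> by (auto simp: good_def)
  have W_sub: "?W \<subseteq> {-K..5*K}" using u[of n] by (auto simp: good_def)
  have "measure lborel ?W = measure lborel (good (\<lambda>n. x n + u n) n)"
    by (subst (2) lborel_distr_plus[of "- u n", symmetric]) (simp add: measure_distr)
  have "?V \<inter> ?W \<noteq> {}"
  proof
    assume "?V \<inter> ?W = {}"
    then have "measure lborel ?V + measure lborel ?W = measure lborel (?V \<union> ?W)"
      using W_meas fmeasurableD2[OF fin[OF _ V_sub]] fmeasurableD2[OF fin[OF _ W_sub]]
      by (intro measure_Union[symmetric]) auto
    also have "\<dots> \<le> measure lborel {-K..5*K}"
      using V_sub W_sub W_meas fin[of "{-K..5*K}"] by (intro measure_mono_fmeasurable) auto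
    finally show False using n \<open>measure lborel ?W = _\<close> \<open>0 < K\<close> by simp
  qed
  then obtain v where v: "v \<in> ?V" "v - u n \<in> good (\<lambda>n. x n + u n) n" by auto
  have "\<bar>h (x n + v) - h (x n)\<bar> < \<epsilon> / 2" "\<bar>h (x n + v) - h (x n + u n)\<bar> < \<epsilon> / 2"
    using v by (auto simp: good_def)
  then show False using far[of n] by linarith
qed

lemma slowly_varying_eventually_pos:
  assumes "slowly_varying L"
  shows "\<forall>\<^sub>F x in at_top. 0 < L x"
  using assms unfolding slowly_varying_def eventually_at_top_linorder by blast

lemma slowly_varying_scale:
  assumes "slowly_varying L" "0 < c"
  shows "((\<lambda>x. L (c * x) / L x) \<longlongrightarrow> 1) at_top"
  using assms unfolding slowly_varying_def by blast

lemma slowly_varying_cong: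
  assumes "slowly_varying L" and eq: "\<And>x. 0 < x \<Longrightarrow> L' x = L x"
  shows "slowly_varying L'"
proof -
  from assms(1) obtain X where X: "0 < X" "\<forall>x\<ge>X. 0 < L x" "set_borel_measurable borel {X..} L"
    unfolding slowly_varying_def by blast
  have "(\<lambda>x. indicat_real {X..} x *\<^sub>R L' x) = (\<lambda>x. indicat_real {X..} x *\<^sub>R L x)"
    using X(1) by (auto simp: indicator_def eq)
  then have "set_borel_measurable borel {X..} L'"
    using X(3) by (simp add: set_borel_measurable_def)
  moreover have "((\<lambda>x. L' (c * x) / L' x) \<longlongrightarrow> 1) at_top" if "0 < c" for c
    using slowly_varying_scale[OF assms(1) that]
    by (rule Lim_transform_eventually)
       (auto intro!: eventually_mono[OF eventually_gt_at_top[of 0]] simp: eq that)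
  ultimately show ?thesis
    using X unfolding slowly_varying_def by (intro conjI exI[of _ X]) (auto simp: eq)
qed

text \<open>Passing to \<open>h x = ln (L (exp x))\<close> turns ratios of arguments into shifts.\<close>

lemma slowly_varying_uniform:
  assumes L: "slowly_varying L" and c: "0 < c" and \<epsilon>: "0 < \<epsilon>"
  shows "\<forall>\<^sub>F x in at_top. \<forall>y\<in>{c..1 / c}. \<bar>L (y * x) / L x - 1\<bar> < \<epsilon>"
proof -
  from L obtain X where X: "0 < X" "\<And>x. x \<ge> X \<Longrightarrow> 0 < L x"
    and [measurable]: "set_borel_measurable borel {X..} L"
    unfolding slowly_varying_def by blast
  \<comment> \<open>\<open>L\<close> is only controlled on \<open>{X..}\<close>; the value 0 elsewhere makes \<open>h\<close> Borel on the whole line.\<close>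
  define h where "h x = (if X \<le> exp x then ln (L (exp x)) else 0)" for x
  have L_meas: "(\<lambda>x. indicat_real {X..} x * L x) \<in> borel_measurable borel"
    using \<open>set_borel_measurable borel {X..} L\<close> by (simp add: set_borel_measurable_def)
  have [measurable]: "(\<lambda>x. indicat_real {X..} (exp x) * L (exp x)) \<in> borel_measurable borel"
    by (rule measurable_compose[OF _ L_meas]) simp
  have "h = (\<lambda>x. if X \<le> exp x then ln (indicat_real {X..} (exp x) * L (exp x)) else 0)"
    by (auto simp: h_def)
  then have h_meas: "h \<in> borel_measurable borel" by simp
  have exp_ge: "\<forall>\<^sub>F x in at_top. X \<le> exp (x + u)" for u :: real
  proof -
    have "filterlim (\<lambda>x. exp (x + u)) at_top at_top" by real_asymp
    then show ?thesis by (simp add: filterlim_at_top)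
  qed
  have h_diff: "h (x + u) - h x = ln (L (exp u * exp x) / L (exp x))"
    if "X \<le> exp x" "X \<le> exp (x + u)" for x u
    using that X(2)[of "exp x"] X(2)[of "exp u * exp x"]
    by (auto simp: h_def ln_div exp_add mult.commute)
  have lim: "((\<lambda>x. h (x + u) - h x) \<longlongrightarrow> 0) at_top" for u
  proof -
    have "((\<lambda>x. ln (L (exp u * exp x) / L (exp x))) \<longlongrightarrow> ln 1) at_top"
      by (intro tendsto_ln filterlim_compose[OF slowly_varying_scale[OF L] exp_at_top]) auto
    moreover have "\<forall>\<^sub>F x in at_top. ln (L (exp u * exp x) / L (exp x)) = h (x + u) - h x"
      using exp_ge[of u] exp_ge[of 0] by eventually_elim (simp add: h_diff)
    ultimately show ?thesis using Lim_transform_eventually by force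
  qed
  define K where "K = \<bar>ln c\<bar> + 1"
  have "\<forall>\<^sub>F x in at_top. \<forall>u\<in>{-K..K}. \<bar>h (x + u) - h x\<bar> < ln (1 + \<epsilon>)"
    using \<epsilon> by (intro additive_uniform_convergence[OF h_meas lim]) (auto simp: K_def)
  then have "\<forall>\<^sub>F x in at_top. \<forall>u\<in>{-K..K}. \<bar>h (ln x + u) - h (ln x)\<bar> < ln (1 + \<epsilon>)"
    using ln_at_top by (rule eventually_compose_filterlim)
  moreover have "\<forall>\<^sub>F x in at_top. X \<le> x" "\<forall>\<^sub>F x in at_top. X / c \<le> x"
    by (rule eventually_ge_at_top)+
  ultimately show ?thesis
  proof eventually_elim
    case (elim x)
    show ?case
    proof
      fix y assume y: "y \<in> {c..1 / c}"
      have pos: "0 < x" "0 < y" using elim X y c by auto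
      have "X \<le> c * x" using elim(3) c by (simp add: field_simps)
      also have "\<dots> \<le> y * x" using y pos by simp
      finally have yx: "X \<le> y * x" .
      have "ln c \<le> ln y" "ln y \<le> ln (1 / c)" using y c pos by (simp_all del: ln_div)
      then have "ln y \<in> {-K..K}" using c by (auto simp: K_def ln_div)
      then have "\<bar>h (ln x + ln y) - h (ln x)\<bar> < ln (1 + \<epsilon>)" using elim(1) by blast
      moreover have "h (ln x + ln y) - h (ln x) = ln (L (y * x) / L x)"
        using h_diff[of "ln x" "ln y"] pos elim(2) yx by (simp add: exp_add mult.commute)
      ultimately have b: "\<bar>ln (L (y * x) / L x)\<bar> < ln (1 + \<epsilon>)" by simp
      define \<rho> where "\<rho> = L (y * x) / L x"
      have \<rho>: "0 < \<rho>" unfolding \<rho>_def using X(2) yx elim(2) by simp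
      have "ln \<rho> < ln (1 + \<epsilon>)" using b by (simp add: \<rho>_def)
      then have up: "\<rho> < 1 + \<epsilon>" using \<rho> \<epsilon> by (simp add: ln_less_cancel_iff)
      have "ln (1 / \<rho>) < ln (1 + \<epsilon>)" using b \<rho> by (simp add: \<rho>_def[symmetric] ln_div)
      then have "1 / \<rho> < 1 + \<epsilon>" using \<rho> \<epsilon> by (subst (asm) ln_less_cancel_iff) auto
      then have "1 < \<rho> + \<epsilon> * \<rho>" using \<rho> by (simp add: field_simps)
      moreover have "\<epsilon> * \<rho> \<le> \<epsilon>" if "\<rho> \<le> 1" using that \<epsilon> by simp
      ultimately have "1 - \<epsilon> < \<rho>" using \<epsilon> by (cases "\<rho> \<le> 1") linarith+
      then show "\<bar>L (y * x) / L x - 1\<bar> < \<epsilon>" using up by (simp add: \<rho>_def abs_less_iff)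
    qed
  qed
qed

text \<open>Uniformity on a neighbourhood of \<open>c0\<close> is what permits a factor \<open>c t\<close> that varies with \<open>t\<close>.\<close>

lemma slowly_varying_compose:
  assumes L: "slowly_varying L" and X: "filterlim X at_top F" and c: "(c \<longlongrightarrow> c0) F" and "0 < c0"
  shows "((\<lambda>t. L (c t * X t) / L (X t)) \<longlongrightarrow> 1) F"
proof (rule tendstoI)
  fix \<epsilon> :: real assume \<epsilon>: "0 < \<epsilon>"
  define d where "d = min (c0 / 2) (1 / (2 * c0))"
  have d: "0 < d" "d < c0" using \<open>0 < c0\<close> by (auto simp: d_def min_less_iff_disj)
  have "d * c0 \<le> 1 / 2"
    using mult_right_mono[of d "1 / (2 * c0)" c0] \<open>0 < c0\<close> by (auto simp: d_def)
  then have d2: "c0 < 1 / d" using d by (simp add: field_simps)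
  have "\<forall>\<^sub>F t in F. d < c t" "\<forall>\<^sub>F t in F. c t < 1 / d"
    using order_tendstoD[OF c] d d2 by auto
  moreover have "\<forall>\<^sub>F t in F. \<forall>y\<in>{d..1 / d}. \<bar>L (y * X t) / L (X t) - 1\<bar> < \<epsilon>"
    using slowly_varying_uniform[OF L d(1) \<epsilon>] X by (rule eventually_compose_filterlim)
  ultimately show "\<forall>\<^sub>F t in F. dist (L (c t * X t) / L (X t)) 1 < \<epsilon>"
    by eventually_elim (auto simp: dist_real_def)
qed

definition regularly_varying :: "real \<Rightarrow> (real \<Rightarrow> real) \<Rightarrow> bool" where
  "regularly_varying \<rho> a \<longleftrightarrow> slowly_varying (\<lambda>t. t powr (- \<rho>) * a t)"

lemma regularly_varying_eventually_pos:
  assumes "regularly_varying \<rho> a"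
  shows "\<forall>\<^sub>F t in at_top. 0 < a t"
  using slowly_varying_eventually_pos[OF assms[unfolded regularly_varying_def]]
    eventually_gt_at_top[of 0]
  by eventually_elim (simp add: zero_less_mult_iff)

lemma regularly_varying_scale:
  assumes "regularly_varying \<rho> a" "0 < c"
  shows "((\<lambda>t. a (c * t) / a t) \<longlongrightarrow> c powr \<rho>) at_top"
proof -
  have "((\<lambda>t. c powr \<rho> * (((c * t) powr (- \<rho>) * a (c * t)) / (t powr (- \<rho>) * a t)))
      \<longlongrightarrow> c powr \<rho> * 1) at_top"
    using slowly_varying_scale[OF assms(1)[unfolded regularly_varying_def] assms(2)]
    by (intro tendsto_mult tendsto_const)
  moreover have "\<forall>\<^sub>F t in at_top.
      c powr \<rho> * (((c * t) powr (- \<rho>) * a (c * t)) / (t powr (- \<rho>) * a t)) = a (c * t) / a t"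
    using eventually_gt_at_top[of 0]
    by eventually_elim (use \<open>0 < c\<close> in \<open>simp add: powr_mult powr_minus field_simps\<close>)
  ultimately show ?thesis using Lim_transform_eventually by force
qed

lemma regularly_varying_bounds:
  assumes a: "regularly_varying \<rho> a" and c: "0 < c" and \<epsilon>: "0 < \<epsilon>"
  shows "\<forall>\<^sub>F t in at_top. \<forall>x\<in>{c..1}.
    (1 - \<epsilon>) * x powr \<rho> * a t \<le> a (x * t) \<and> a (x * t) \<le> (1 + \<epsilon>) * x powr \<rho> * a t"
proof -
  have "\<forall>\<^sub>F t in at_top. \<forall>x\<in>{c..1 / c}.
      \<bar>((x * t) powr (- \<rho>) * a (x * t)) / (t powr (- \<rho>) * a t) - 1\<bar> < \<epsilon>"
    by (rule slowly_varying_uniform[OF a[unfolded regularly_varying_def] c \<epsilon>])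
  then show ?thesis
    using regularly_varying_eventually_pos[OF a] eventually_gt_at_top[of 0]
  proof eventually_elim
    case (elim t)
    show ?case
    proof
      fix x assume x: "x \<in> {c..1}"
      then have "0 < x" "x \<in> {c..1 / c}" using c by (auto simp: field_simps mult_le_one intro: order_trans)
      then have "\<bar>((x * t) powr (- \<rho>) * a (x * t)) / (t powr (- \<rho>) * a t) - 1\<bar> < \<epsilon>"
        using elim by blast
      moreover have "((x * t) powr (- \<rho>) * a (x * t)) / (t powr (- \<rho>) * a t)
          = a (x * t) / (x powr \<rho> * a t)"
        using elim \<open>0 < x\<close> by (simp add: powr_mult powr_minus field_simps)
      ultimately have *: "\<bar>a (x * t) / (x powr \<rho> * a t) - 1\<bar> < \<epsilon>" by simp
      define d where "d = x powr \<rho> * a t"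
      have "0 < d" using \<open>0 < x\<close> elim by (simp add: d_def)
      have "1 - \<epsilon> < a (x * t) / d" "a (x * t) / d < 1 + \<epsilon>" using * by (auto simp: d_def)
      then have "(1 - \<epsilon>) * d \<le> a (x * t)" "a (x * t) \<le> (1 + \<epsilon>) * d"
        using \<open>0 < d\<close> by (simp_all add: less_divide_eq divide_less_eq)
      then show "(1 - \<epsilon>) * x powr \<rho> * a t \<le> a (x * t) \<and> a (x * t) \<le> (1 + \<epsilon>) * x powr \<rho> * a t"
        by (simp add: d_def mult.assoc)
    qed
  qed
qed

section \<open>Convolutions of regularly varying functions\<close>

lemma set_integral_ivl_split:
  fixes f :: "real \<Rightarrow> real"
  assumes "set_integrable lborel {a..c} f" "a \<le> b" "b \<le> c"
  shows "(LINT u:{a..c}|lborel. f u) = (LINT u:{a..b}|lborel. f u) + (LINT u:{b<..c}|lborel. f u)"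
proof -
  have "{a..c} = {a..b} \<union> {b<..c}" using assms by auto
  moreover have "set_integrable lborel {a..b} f" "set_integrable lborel {b<..c} f"
    using assms by (auto intro!: set_integrable_subset[OF assms(1)])
  moreover have "{a..b} \<inter> {b<..c} = {}" by auto
  ultimately show ?thesis by (simp add: set_integral_Un)
qed

lemma set_integral_point:
  fixes f :: "real \<Rightarrow> real"
  shows "(LINT u:{x}|lborel. f u) = 0"
  unfolding set_lebesgue_integral_def
  by (rule integral_eq_zero_AE, rule eventually_mono[OF AE_lborel_singleton[of x]])
     (simp add: indicator_def)

lemma set_integral_nonneg_real:
  fixes f :: "real \<Rightarrow> real"
  assumes "\<And>x. x \<in> A \<Longrightarrow> 0 \<le> f x"
  shows "0 \<le> (LINT u:A|lborel. f u)"
  unfolding set_lebesgue_integral_def using assms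
  by (intro integral_nonneg_AE) (auto simp: indicator_def)

lemma set_integral_const_ivl:
  fixes c :: real
  assumes "a \<le> b"
  shows "set_integrable lborel {a<..b} (\<lambda>_. c)" "(LINT u:{a<..b}|lborel. c) = c * (b - a)"
  using assms by (auto simp: set_integrable_def set_lebesgue_integral_def)

lemma convolution_integrable:
  fixes a b :: "real \<Rightarrow> real"
  assumes a: "set_integrable lborel {0..s} a" and b: "set_borel_measurable borel {0..t} b"
    and "s \<le> t" and bd: "\<And>u. 0 \<le> u \<Longrightarrow> u \<le> s \<Longrightarrow> \<bar>b (t - u)\<bar> \<le> C"
  shows "set_integrable lborel {0..s} (\<lambda>u. a u * b (t - u))"
proof (rule set_integrable_bound)
  show "set_integrable lborel {0..s} (\<lambda>u. C * a u)" using a by simp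
  have A: "(\<lambda>u. indicat_real {0..s} u * a u) \<in> borel_measurable borel"
    using borel_measurable_integrable[OF a[unfolded set_integrable_def]] by simp
  have "(\<lambda>v. indicat_real {0..t} v * b v) \<in> borel_measurable borel"
    using b by (simp add: set_borel_measurable_def)
  then have B: "(\<lambda>u. indicat_real {0..t} (t - u) * b (t - u)) \<in> borel_measurable borel"
    by (rule measurable_compose[rotated]) simp
  have "(\<lambda>u. indicat_real {0..s} u *\<^sub>R (a u * b (t - u))) =
      (\<lambda>u. (indicat_real {0..s} u * a u) * (indicat_real {0..t} (t - u) * b (t - u)))"
    using \<open>s \<le> t\<close> by (auto simp: indicator_def)
  then show "set_borel_measurable lborel {0..s} (\<lambda>u. a u * b (t - u))"
    unfolding set_borel_measurable_def using A B by simp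
  show "AE u in lborel. u \<in> {0..s} \<longrightarrow> norm (a u * b (t - u)) \<le> norm (C * a u)"
  proof (intro AE_I2 impI)
    fix u assume "u \<in> {0..s}"
    then have "\<bar>b (t - u)\<bar> \<le> \<bar>C\<bar>" using bd[of u] by auto
    then show "norm (a u * b (t - u)) \<le> norm (C * a u)"
      using mult_left_mono[of "\<bar>b (t - u)\<bar>" "\<bar>C\<bar>" "\<bar>a u\<bar>"] by (simp add: abs_mult mult.commute)
  qed
qed

lemma set_integral_reflect:
  fixes f :: "real \<Rightarrow> real"
  shows "(LINT u:{a..b}|lborel. f u) = (LINT u:{t-b..t-a}|lborel. f (t - u))"
    "set_integrable lborel {a..b} f \<longleftrightarrow> set_integrable lborel {t-b..t-a} (\<lambda>u. f (t - u))"
proof -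
  have ind: "indicat_real {a..b} (t + - 1 * u) = indicat_real {t-b..t-a} u" for u
    by (auto simp: indicator_def)
  show "(LINT u:{a..b}|lborel. f u) = (LINT u:{t-b..t-a}|lborel. f (t - u))"
    unfolding set_lebesgue_integral_def
    by (subst lborel_integral_real_affine[of "- 1" _ t]) (simp_all only: ind, simp_all)
  show "set_integrable lborel {a..b} f \<longleftrightarrow> set_integrable lborel {t-b..t-a} (\<lambda>u. f (t - u))"
    unfolding set_integrable_def
    by (subst lborel_integrable_real_affine_iff[of "- 1" _ t, symmetric]) (simp_all only: ind, simp_all)
qed

text \<open>Both the intensity \<open>r\<close> and the function \<open>q\<close> are instances. The bound \<open>1 \<le> \<rho>\<close> is the reason why the
  integral over \<open>{0..t}\<close> is dominated by times that are small compared with \<open>t\<close>.\<close>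

locale regular_kernel =
  fixes a :: "real \<Rightarrow> real" and \<rho> :: real
  assumes nonneg: "0 \<le> t \<Longrightarrow> 0 \<le> a t"
    and integrable: "0 \<le> t \<Longrightarrow> set_integrable lborel {0..t} a"
    and regular: "regularly_varying (- \<rho>) a"
    and index: "1 \<le> \<rho>"
begin

definition cumulated :: "real \<Rightarrow> real" where
  "cumulated t = (LINT u:{0..t}|lborel. a u)"

lemma cumulated_split:
  assumes "0 \<le> s" "s \<le> t"
  shows "cumulated t = cumulated s + (LINT u:{s<..t}|lborel. a u)"
  unfolding cumulated_def using assms by (intro set_integral_ivl_split integrable) auto

lemma cumulated_mono:
  assumes "0 \<le> s" "s \<le> t"
  shows "cumulated s \<le> cumulated t"
  using cumulated_split[OF assms] set_integral_nonneg_real[of "{s<..t}" a] nonneg assms by auto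

lemma cumulated_nonneg: "0 \<le> cumulated t"
  unfolding cumulated_def by (intro set_integral_nonneg_real nonneg) auto

text \<open>On \<open>{c * t..t}\<close> the function is at least half of \<open>a t * t / u\<close>, because \<open>x powr - \<rho>\<close> is at least
  \<open>1 / x\<close> for \<open>x \<le> 1\<close>; the integral of \<open>1 / u\<close> over this interval is \<open>- ln c\<close>, which is arbitrarily
  large.\<close>

lemma term_bound:
  assumes "0 < N"
  shows "\<forall>\<^sub>F t in at_top. t * a t * N \<le> 2 * cumulated t"
proof -
  define c where "c = exp (- N)"
  have c: "0 < c" "c < 1" using assms by (auto simp: c_def)
  have "\<forall>\<^sub>F t in at_top. \<forall>x\<in>{c..1}. (1 - 1/2) * x powr (- \<rho>) * a t \<le> a (x * t) \<and>
      a (x * t) \<le> (1 + 1/2) * x powr (- \<rho>) * a t"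
    using c by (intro regularly_varying_bounds[OF regular]) auto
  then show ?thesis using regularly_varying_eventually_pos[OF regular] eventually_gt_at_top[of 0]
  proof eventually_elim
    case (elim t)
    have ct: "0 < c * t" "c * t < t" using c elim by auto
    have bc: "has_bochner_integral lborel (\<lambda>u. (t * a t / 2) * inverse u * indicator {c * t..t} u)
        (t * a t / 2 * ln t - t * a t / 2 * ln (c * t))"
    proof (rule has_bochner_integral_FTC_Icc_real)
      show "c * t \<le> t" using ct by linarith
      fix u assume "c * t \<le> u" "u \<le> t"
      then have "0 < u" using ct by linarith
      show "((\<lambda>u. t * a t / 2 * ln u) has_real_derivative t * a t / 2 * inverse u) (at u)"
        by (rule DERIV_cmult[OF DERIV_ln[OF \<open>0 < u\<close>]])
      show "isCont (\<lambda>u. t * a t / 2 * inverse u) u"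
        using \<open>0 < u\<close> by (intro continuous_intros) auto
    qed
    then have int: "set_integrable lborel {c * t..t} (\<lambda>u. (t * a t / 2) * inverse u)"
      unfolding set_integrable_def has_bochner_integral_iff by (simp add: mult.commute)
    have "t * a t / 2 * N = t * a t / 2 * ln t - t * a t / 2 * ln (c * t)"
    proof -
      have "ln (c * t) = ln t - N" using c elim by (simp add: ln_mult) (simp add: c_def)
      then show ?thesis by (simp add: right_diff_distrib)
    qed
    also have "\<dots> = (LINT u:{c * t..t}|lborel. (t * a t / 2) * inverse u)"
      using bc unfolding set_lebesgue_integral_def has_bochner_integral_iff by (simp add: mult.commute)
    also have "\<dots> \<le> (LINT u:{c * t..t}|lborel. a u)"
    proof (rule set_integral_mono[OF int])
      show "set_integrable lborel {c * t..t} a"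
        using ct by (intro set_integrable_subset[OF integrable[of t]]) auto
      fix u assume u: "u \<in> {c * t..t}"
      define x where "x = u / t"
      have "0 < u" using u ct by auto
      then have x: "x \<in> {c..1}" "0 < x" using u elim c by (auto simp: x_def field_simps)
      have "t * a t / 2 * inverse u = 1/2 * x powr (- 1) * a t"
        using elim x by (simp add: x_def powr_minus field_simps)
      also have "\<dots> \<le> 1/2 * x powr (- \<rho>) * a t"
        using x index elim by (intro mult_right_mono mult_left_mono powr_mono') auto
      also have "\<dots> \<le> a (x * t)" using elim x by force
      finally show "t * a t / 2 * inverse u \<le> a u" using elim by (simp add: x_def)
    qed
    also have "\<dots> \<le> (LINT u:{0..c * t}|lborel. a u) + (LINT u:{c * t<..t}|lborel. a u)"
    proof -
      have "(LINT u:{c * t..t}|lborel. a u) = (LINT u:{c*t..c * t}|lborel. a u) + (LINT u:{c * t<..t}|lborel. a u)"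
        using ct c(2) by (intro set_integral_ivl_split set_integrable_subset[OF integrable[of t]]) auto
      moreover have "(LINT u:{c*t..c * t}|lborel. a u) = 0"
        by (simp add: set_integral_point)
      ultimately show ?thesis
        using set_integral_nonneg_real[of "{0..c * t}" a] nonneg by simp
    qed
    also have "\<dots> = cumulated t" using cumulated_split[of "c * t" t] ct c(2) by (simp add: cumulated_def)
    finally show ?case by simp
  qed
qed

lemma cumulated_pos: "\<forall>\<^sub>F t in at_top. 0 < cumulated t"
proof -
  have "\<forall>\<^sub>F t in at_top. t * a t * 1 \<le> 2 * cumulated t" by (rule term_bound) simp
  then show ?thesis
    using regularly_varying_eventually_pos[OF regular] eventually_gt_at_top[of 0]
  proof eventually_elim
    case (elim t)
    then have "0 < t * a t" by simp
    then show ?case using elim(1) by linarith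
  qed
qed

lemma term_negligible: "((\<lambda>t. t * a t / cumulated t) \<longlongrightarrow> 0) at_top"
proof (rule tendstoI)
  fix \<epsilon> :: real assume \<epsilon>: "0 < \<epsilon>"
  have "\<forall>\<^sub>F t in at_top. t * a t * (3 / \<epsilon>) \<le> 2 * cumulated t" using \<epsilon> by (intro term_bound) simp
  then show "\<forall>\<^sub>F t in at_top. dist (t * a t / cumulated t) 0 < \<epsilon>"
    using cumulated_pos eventually_gt_at_top[of 0]
  proof eventually_elim
    case (elim t)
    have "t * a t * 3 \<le> 2 * (\<epsilon> * cumulated t)" using elim \<epsilon> by (simp add: field_simps)
    also have "\<dots> < 3 * (\<epsilon> * cumulated t)" using elim \<epsilon> by simp
    finally have "t * a t < \<epsilon> * cumulated t" by simp
    then show ?case using elim nonneg[of t] by (simp add: field_simps)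
  qed
qed

text \<open>The increment over \<open>{x * t<..t}\<close> is of the order of \<open>t * a t\<close>, hence negligible.\<close>

lemma cumulated_slowly_varying:
  assumes x: "0 < x" "x < 1"
  shows "((\<lambda>t. cumulated (x * t) / cumulated t) \<longlongrightarrow> 1) at_top"
proof -
  define C where "C = 2 * x powr (- \<rho>) * (1 - x)"
  have "\<forall>\<^sub>F t in at_top. \<forall>y\<in>{x..1}. (1 - 1) * y powr (- \<rho>) * a t \<le> a (y * t) \<and>
      a (y * t) \<le> (1 + 1) * y powr (- \<rho>) * a t"
    using x by (intro regularly_varying_bounds[OF regular]) auto
  then have low: "\<forall>\<^sub>F t in at_top. 1 - C * (t * a t / cumulated t) \<le> cumulated (x * t) / cumulated t"
    using cumulated_pos eventually_gt_at_top[of 0]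
  proof eventually_elim
    case (elim t)
    have xt: "0 < x * t" "x * t \<le> t" using x elim by auto
    have "(LINT u:{x * t<..t}|lborel. a u) \<le> (LINT u:{x * t<..t}|lborel. 2 * x powr (- \<rho>) * a t)"
    proof (rule set_integral_mono)
      show "set_integrable lborel {x * t<..t} a"
        using xt by (intro set_integrable_subset[OF integrable[of t]]) auto
      show "set_integrable lborel {x * t<..t} (\<lambda>u. 2 * x powr (- \<rho>) * a t)"
        using xt by (intro set_integral_const_ivl)
      fix u assume u: "u \<in> {x * t<..t}"
      define y where "y = u / t"
      have y: "y \<in> {x..1}" using u elim by (auto simp: y_def field_simps)
      have "a (y * t) \<le> 2 * y powr (- \<rho>) * a t" using elim y by force
      also have "\<dots> \<le> 2 * x powr (- \<rho>) * a t"
        using y x index nonneg[of t] elim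
        by (intro mult_right_mono mult_left_mono powr_mono2') auto
      finally show "a u \<le> 2 * x powr (- \<rho>) * a t" using elim by (simp add: y_def)
    qed
    also have "\<dots> = C * (t * a t)"
      using xt by (simp add: set_integral_const_ivl C_def algebra_simps)
    finally have "cumulated t - C * (t * a t) \<le> cumulated (x * t)"
      using cumulated_split[of "x * t" t] xt by simp
    then have "(cumulated t - C * (t * a t)) / cumulated t \<le> cumulated (x * t) / cumulated t"
      using elim by (intro divide_right_mono) auto
    then show ?case using elim by (simp add: diff_divide_distrib)
  qed
  have up: "\<forall>\<^sub>F t in at_top. cumulated (x * t) / cumulated t \<le> 1"
    using cumulated_pos eventually_gt_at_top[of 0]
    by eventually_elim (use x in \<open>auto intro!: cumulated_mono\<close>)
  have "((\<lambda>t. 1 - C * (t * a t / cumulated t)) \<longlongrightarrow> 1 - C * 0) at_top"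
    by (intro tendsto_intros term_negligible)
  then show ?thesis using tendsto_sandwich[OF low up] by simp
qed

end

text \<open>For \<open>u \<le> t / 2\<close> the factor \<open>b (t - u)\<close> is at least about \<open>b t\<close> and at most a constant multiple of
  it. For \<open>u \<le> \<epsilon> * t\<close> that constant is close to 1, and the rest of the range only has a
  negligible share of the mass of \<open>a\<close>, since the integral of \<open>a\<close> varies slowly.\<close>

lemma half_convolution:
  assumes "regular_kernel a \<rho>" "regular_kernel b \<sigma>"
  shows "((\<lambda>t. (LINT u:{0..t/2}|lborel. a u * b (t - u)) / (regular_kernel.cumulated a t * b t))
    \<longlongrightarrow> 1) at_top"
    and "\<forall>\<^sub>F t in at_top. set_integrable lborel {0..t/2} (\<lambda>u. a u * b (t - u))"
proof -
  interpret a: regular_kernel a \<rho> by fact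
  interpret b: regular_kernel b \<sigma> by fact
  let ?A = a.cumulated and ?I = "\<lambda>t. LINT u:{0..t/2}|lborel. a u * b (t - u)"
  have b_meas: "set_borel_measurable borel {0..t} b" if "0 \<le> t" for t
    using borel_measurable_integrable[OF b.integrable[OF that, unfolded set_integrable_def]]
    by (simp add: set_borel_measurable_def)
  \<comment> \<open>One form of the bounds on \<open>b\<close> serves both ranges: \<open>c = 1 - \<epsilon>\<close> for small \<open>u\<close> and \<open>c = 1 / 2\<close>
    for the others.\<close>
  have near: "\<forall>\<^sub>F t in at_top. 0 < b t \<and> 0 < t \<and> (\<forall>x\<in>{c..1}.
      (1 - \<epsilon>) * b t \<le> b (x * t) \<and> b (x * t) \<le> (1 + \<epsilon>) * c powr (- \<sigma>) * b t)"
    if "0 < c" "0 < \<epsilon>" "\<epsilon> < 1" for c \<epsilon> :: real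
    using regularly_varying_bounds[OF b.regular that(1,2)]
      regularly_varying_eventually_pos[OF b.regular] eventually_gt_at_top[of 0]
  proof eventually_elim
    case (elim t)
    have "(1 - \<epsilon>) * b t \<le> b (x * t) \<and> b (x * t) \<le> (1 + \<epsilon>) * c powr (- \<sigma>) * b t"
      if x: "x \<in> {c..1}" for x
    proof
      have "0 < x" using x \<open>0 < c\<close> by auto
      have "(1 - \<epsilon>) * 1 * b t \<le> (1 - \<epsilon>) * x powr (- \<sigma>) * b t"
      proof -
        have "x powr 0 \<le> x powr (- \<sigma>)" using x \<open>0 < x\<close> b.index by (intro powr_mono') auto
        then show ?thesis using elim \<open>\<epsilon> < 1\<close> \<open>0 < x\<close> by (intro mult_right_mono mult_left_mono) auto
      qed
      then show "(1 - \<epsilon>) * b t \<le> b (x * t)" using elim x by force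
      have "b (x * t) \<le> (1 + \<epsilon>) * x powr (- \<sigma>) * b t" using elim x by force
      also have "\<dots> \<le> (1 + \<epsilon>) * c powr (- \<sigma>) * b t"
        using x \<open>0 < c\<close> b.index elim \<open>0 < \<epsilon>\<close>
        by (intro mult_right_mono mult_left_mono powr_mono2') auto
      finally show "b (x * t) \<le> (1 + \<epsilon>) * c powr (- \<sigma>) * b t" .
    qed
    then show ?case using elim by blast
  qed
  have half_less: "1 / 2 < (1::real)" by simp
  have int: "\<forall>\<^sub>F t in at_top. set_integrable lborel {0..t/2} (\<lambda>u. a u * b (t - u))"
    using near[of "1/2" "1/2", OF half_gt_zero[OF zero_less_one] half_gt_zero[OF zero_less_one] half_less]
  proof eventually_elim
    case (elim t)
    show ?case
    proof (rule convolution_integrable)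
      show "set_integrable lborel {0..t/2} a" "set_borel_measurable borel {0..t} b" "t / 2 \<le> t"
        using elim by (auto intro!: a.integrable b_meas)
      fix u assume u: "0 \<le> u" "u \<le> t / 2"
      have "(t - u) / t \<in> {1/2..1}" using u elim by (auto simp: field_simps)
      then have "b ((t - u) / t * t) \<le> (1 + 1 / 2) * (1 / 2) powr (- \<sigma>) * b t" using elim by blast
      then show "\<bar>b (t - u)\<bar> \<le> (1 + 1 / 2) * (1 / 2) powr (- \<sigma>) * b t"
        using elim b.nonneg[of "t - u"] u by simp
    qed
  qed
  then show "\<forall>\<^sub>F t in at_top. set_integrable lborel {0..t/2} (\<lambda>u. a u * b (t - u))" .
  have lower: "\<forall>\<^sub>F t in at_top. y < ?I t / (?A t * b t)" if "y < 1" for y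
  proof -
    have e1: "\<forall>\<^sub>F \<epsilon> in at_right 0. y < (1 - \<epsilon>) * (1 - \<epsilon>)"
      by (rule order_tendstoD[OF _ that]) (auto intro!: tendsto_eq_intros)
    have e2: "\<forall>\<^sub>F \<epsilon> in at_right 0. 0 < \<epsilon> \<and> \<epsilon> < (1::real)"
      by (simp add: eventually_at_right_less eventually_at_right_field eventually_conj_iff, auto intro: exI[of _ 1])
    obtain \<epsilon> where \<epsilon>: "y < (1 - \<epsilon>) * (1 - \<epsilon>)" "0 < \<epsilon>" "\<epsilon> < 1"
      using eventually_happens[OF eventually_conj[OF e1 e2]] by auto
    have "\<forall>\<^sub>F t in at_top. 1 - \<epsilon> < ?A (1/2 * t) / ?A t"
      using a.cumulated_slowly_varying[of "1/2"] \<epsilon> by (intro order_tendstoD) auto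
    then show ?thesis using int near[of "1/2" \<epsilon>, simplified, OF \<epsilon>(2,3)] a.cumulated_pos
    proof eventually_elim
      case (elim t)
      have "(1 - \<epsilon>) * b t * ?A (t/2) = (LINT u:{0..t/2}|lborel. a u * ((1 - \<epsilon>) * b t))"
        by (simp add: a.cumulated_def)
      also have "\<dots> \<le> ?I t"
      proof (rule set_integral_mono)
        show "set_integrable lborel {0..t / 2} (\<lambda>u. a u * ((1 - \<epsilon>) * b t))"
          using elim by (intro set_integrable_mult_left a.integrable) auto
        show "set_integrable lborel {0..t / 2} (\<lambda>u. a u * b (t - u))" using elim by auto
        fix u assume u: "u \<in> {0..t / 2}"
        then have "(t - u) / t \<in> {1/2..1}" using elim by (auto simp: field_simps)
        then have "(1 - \<epsilon>) * b t \<le> b ((t - u) / t * t)" using elim by blast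
        then show "a u * ((1 - \<epsilon>) * b t) \<le> a u * b (t - u)"
          using elim u by (intro mult_left_mono a.nonneg) auto
      qed
      finally have "(1 - \<epsilon>) * b t * ?A (t/2) \<le> ?I t" .
      moreover have "(1 - \<epsilon>) * b t * ((1 - \<epsilon>) * ?A t) \<le> (1 - \<epsilon>) * b t * ?A (t/2)"
        using elim \<epsilon> by (intro mult_left_mono) (auto simp: field_simps)
      ultimately have "(1 - \<epsilon>) * (1 - \<epsilon>) * (?A t * b t) \<le> ?I t" by (simp add: algebra_simps)
      then have "(1 - \<epsilon>) * (1 - \<epsilon>) \<le> ?I t / (?A t * b t)" using elim by (simp add: field_simps)
      then show ?case using \<epsilon> by simp
    qed
  qed
  have upper: "\<forall>\<^sub>F t in at_top. ?I t / (?A t * b t) < y" if "1 < y" for y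
  proof -
    have e1: "\<forall>\<^sub>F \<epsilon> in at_right 0. (1 + \<epsilon>) * (1 - \<epsilon>) powr (- \<sigma>) + (1 + \<epsilon>) * (1/2) powr (- \<sigma>) * \<epsilon> < y"
      by (rule order_tendstoD[OF _ that]) (auto intro!: tendsto_eq_intros)
    have e2: "\<forall>\<^sub>F \<epsilon> in at_right 0. 0 < \<epsilon> \<and> \<epsilon> < (1/2::real)"
      by (simp add: eventually_at_right_less eventually_at_right_field eventually_conj_iff, auto intro: exI[of _ "1/2"])
    obtain \<epsilon> where \<epsilon>: "0 < \<epsilon>" "\<epsilon> < 1/2"
      and \<epsilon>y: "(1 + \<epsilon>) * (1 - \<epsilon>) powr (- \<sigma>) + (1 + \<epsilon>) * (1/2) powr (- \<sigma>) * \<epsilon> < y"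
      using eventually_happens[OF eventually_conj[OF e1 e2]] by auto
    define C where "C = (1 + \<epsilon>) * (1 - \<epsilon>) powr (- \<sigma>)"
    define D where "D = (1 + \<epsilon>) * (1/2) powr (- \<sigma>)"
    have pos: "0 < (1 / 2 :: real)" "0 < 1 - \<epsilon>" "\<epsilon> < 1" using \<epsilon> by auto
    have "0 \<le> C" "0 \<le> D" using \<epsilon> by (auto simp: C_def D_def)
    have "\<forall>\<^sub>F t in at_top. 1 - \<epsilon> < ?A (\<epsilon> * t) / ?A t"
      using a.cumulated_slowly_varying[of \<epsilon>] \<epsilon> by (intro order_tendstoD) auto
    then show ?thesis
      using int near[OF pos(1) \<epsilon>(1) pos(3)] near[OF pos(2) \<epsilon>(1) pos(3)] a.cumulated_pos
    proof eventually_elim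
      case (elim t)
      have t: "0 < t" "0 < b t" using elim by auto
      have et: "0 < \<epsilon> * t" "\<epsilon> * t \<le> t / 2" using \<epsilon> t by (auto simp: field_simps)
      have "?I t = (LINT u:{0..\<epsilon> * t}|lborel. a u * b (t - u)) + (LINT u:{\<epsilon> * t<..t/2}|lborel. a u * b (t - u))"
        using et elim by (intro set_integral_ivl_split) auto
      moreover have "(LINT u:{0..\<epsilon> * t}|lborel. a u * b (t - u)) \<le> (LINT u:{0..\<epsilon> * t}|lborel. a u * (C * b t))"
      proof (rule set_integral_mono)
        show "set_integrable lborel {0..\<epsilon> * t} (\<lambda>u. a u * (C * b t))"
          using et by (intro set_integrable_mult_left a.integrable) auto
        have "set_integrable lborel {0..t/2} (\<lambda>u. a u * b (t - u))" using elim by auto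
        then show "set_integrable lborel {0..\<epsilon> * t} (\<lambda>u. a u * b (t - u))"
          using et by (rule_tac set_integrable_subset) auto
        fix u assume u: "u \<in> {0..\<epsilon> * t}"
        then have "(t - u) / t \<in> {1-\<epsilon>..1}" using t by (auto simp: field_simps)
        then have "b ((t - u) / t * t) \<le> C * b t" using elim unfolding C_def by blast
        then show "a u * b (t - u) \<le> a u * (C * b t)"
          using t u by (intro mult_left_mono a.nonneg) auto
      qed
      moreover have "(LINT u:{\<epsilon> * t<..t/2}|lborel. a u * b (t - u)) \<le> (LINT u:{\<epsilon> * t<..t/2}|lborel. a u * (D * b t))"
      proof (rule set_integral_mono)
        have *: "set_integrable lborel {\<epsilon> * t<..t/2} a"
          using et by (intro set_integrable_subset[OF a.integrable[of "t/2"]]) auto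
        show "set_integrable lborel {\<epsilon> * t<..t/2} (\<lambda>u. a u * (D * b t))"
          using * by (intro set_integrable_mult_left)
        have "set_integrable lborel {0..t/2} (\<lambda>u. a u * b (t - u))" using elim by auto
        then show "set_integrable lborel {\<epsilon> * t<..t/2} (\<lambda>u. a u * b (t - u))"
          using et by (rule_tac set_integrable_subset) auto
        fix u assume u: "u \<in> {\<epsilon> * t<..t/2}"
        then have "(t - u) / t \<in> {1/2..1}" using t et by (auto simp: field_simps)
        then have "b ((t - u) / t * t) \<le> D * b t" using elim unfolding D_def by blast
        moreover have "0 \<le> u" using u et by auto
        ultimately show "a u * b (t - u) \<le> a u * (D * b t)"
          using t by (intro mult_left_mono a.nonneg) auto
      qed
      ultimately have "?I t \<le> ?A (\<epsilon> * t) * (C * b t) + (LINT u:{\<epsilon> * t<..t/2}|lborel. a u) * (D * b t)"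
        by (simp add: a.cumulated_def)
      also have "(LINT u:{\<epsilon> * t<..t/2}|lborel. a u) = ?A (t/2) - ?A (\<epsilon> * t)"
        using a.cumulated_split[OF less_imp_le[OF et(1)] et(2)] by linarith
      also have "?A (\<epsilon> * t) * (C * b t) + (?A (t/2) - ?A (\<epsilon> * t)) * (D * b t)
          \<le> ?A t * (C * b t) + (\<epsilon> * ?A t) * (D * b t)"
      proof (intro add_mono mult_right_mono)
        show "?A (\<epsilon> * t) \<le> ?A t" using et t(1) by (intro a.cumulated_mono) linarith+
        have "?A (t/2) \<le> ?A t" using t by (intro a.cumulated_mono) auto
        moreover have "(1 - \<epsilon>) * ?A t \<le> ?A (\<epsilon> * t)" using elim by (auto simp: field_simps)
        ultimately show "?A (t/2) - ?A (\<epsilon> * t) \<le> \<epsilon> * ?A t" by (simp add: algebra_simps)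
      qed (use t \<open>0 \<le> C\<close> \<open>0 \<le> D\<close> in auto)
      also have "\<dots> = (C + D * \<epsilon>) * (?A t * b t)" by (simp add: algebra_simps)
      also have "\<dots> < y * (?A t * b t)"
        using \<epsilon>y t elim by (intro mult_strict_right_mono) (auto simp: C_def D_def)
      finally show ?case using t elim by (simp add: field_simps)
    qed
  qed
  show "((\<lambda>t. ?I t / (?A t * b t)) \<longlongrightarrow> 1) at_top"
    using lower upper by (rule order_tendstoI)
qed

lemma tendsto_ratio_add:
  fixes x y x' y' :: "'a \<Rightarrow> real"
  assumes "((\<lambda>t. x t / x' t) \<longlongrightarrow> 1) F" "((\<lambda>t. y t / y' t) \<longlongrightarrow> 1) F"
    and pos: "\<forall>\<^sub>F t in F. 0 < x' t" "\<forall>\<^sub>F t in F. 0 < y' t"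
  shows "((\<lambda>t. (x t + y t) / (x' t + y' t)) \<longlongrightarrow> 1) F"
proof -
  have "((\<lambda>t. \<bar>x t / x' t - 1\<bar> + \<bar>y t / y' t - 1\<bar>) \<longlongrightarrow> \<bar>1 - 1\<bar> + \<bar>1 - 1\<bar>) F"
    by (intro tendsto_intros assms)
  then have lim: "((\<lambda>t. \<bar>x t / x' t - 1\<bar> + \<bar>y t / y' t - 1\<bar>) \<longlongrightarrow> 0) F" by simp
  have "\<forall>\<^sub>F t in F. norm ((x t + y t) / (x' t + y' t) - 1) \<le> \<bar>x t / x' t - 1\<bar> + \<bar>y t / y' t - 1\<bar>"
    using pos
  proof eventually_elim
    case (elim t)
    define p where "p = x t / x' t - 1"
    define q where "q = y t / y' t - 1"
    have xy: "x t = x' t * (1 + p)" "y t = y' t * (1 + q)" using elim by (auto simp: p_def q_def)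
    have "(x t + y t) / (x' t + y' t) - 1 = (x' t * p + y' t * q) / (x' t + y' t)"
      using elim unfolding xy by (simp add: field_simps)
    also have "\<bar>\<dots>\<bar> \<le> (x' t * \<bar>p\<bar> + y' t * \<bar>q\<bar>) / (x' t + y' t)"
      using elim abs_triangle_ineq[of "x' t * p" "y' t * q"]
      by (simp add: abs_mult divide_right_mono)
    also have "\<dots> \<le> ((x' t + y' t) * (\<bar>p\<bar> + \<bar>q\<bar>)) / (x' t + y' t)"
      using elim by (intro divide_right_mono) (auto simp: algebra_simps)
    also have "\<dots> = \<bar>p\<bar> + \<bar>q\<bar>" using elim by simp
    finally show ?case by (simp add: p_def q_def)
  qed
  then have "((\<lambda>t. (x t + y t) / (x' t + y' t) - 1) \<longlongrightarrow> 0) F"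
    using lim by (rule Lim_null_comparison)
  then show ?thesis by (simp add: LIM_zero_iff)
qed

text \<open>A function that shrinks by a fixed factor whenever its argument doubles, and is controlled in
  between, vanishes at infinity. This stands in for the fact that a function of negative index of
  regular variation tends to 0.\<close>

lemma tendsto_zero_of_doubling:
  fixes c :: "real \<Rightarrow> real"
  assumes half: "\<forall>\<^sub>F t in at_top. c (2 * t) \<le> 3 / 4 * c t"
    and loc: "\<forall>\<^sub>F t in at_top. \<forall>s\<in>{t..2 * t}. 0 \<le> c s \<and> c s \<le> C * c t" and "0 \<le> C"
  shows "(c \<longlongrightarrow> 0) at_top"
proof (rule tendstoI)
  fix \<epsilon> :: real assume "0 < \<epsilon>"
  obtain t0 where t0: "0 < t0" "\<And>t. t0 \<le> t \<Longrightarrow> c (2 * t) \<le> 3 / 4 * c t"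
    "\<And>t s. t0 \<le> t \<Longrightarrow> s \<in> {t..2 * t} \<Longrightarrow> 0 \<le> c s \<and> c s \<le> C * c t"
    using eventually_conj[OF half eventually_conj[OF loc eventually_gt_at_top[of 0]]]
    unfolding eventually_at_top_linorder by blast
  have ge: "t0 \<le> 2 ^ n * t0" for n :: nat using t0(1) by simp
  have pow: "c (2 ^ n * t0) \<le> (3 / 4) ^ n * c t0" for n
  proof (induction n)
    case (Suc n)
    have "c (2 ^ Suc n * t0) = c (2 * (2 ^ n * t0))" by (simp add: mult.assoc)
    also have "\<dots> \<le> 3 / 4 * c (2 ^ n * t0)" using t0(2)[OF ge] .
    also have "\<dots> \<le> 3 / 4 * ((3 / 4) ^ n * c t0)" using Suc by (intro mult_left_mono) auto
    finally show ?case by simp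
  qed simp
  have "0 \<le> c t0" using t0(3)[of t0 t0] t0(1) by auto
  have "((\<lambda>n. C * ((3 / 4) ^ n * c t0)) \<longlonglongrightarrow> C * (0 * c t0))"
    by (intro tendsto_intros LIMSEQ_realpow_zero) auto
  then have "\<forall>\<^sub>F n in sequentially. C * ((3 / 4) ^ n * c t0) < \<epsilon>"
    using \<open>0 < \<epsilon>\<close> by (intro order_tendstoD) auto
  then obtain N where N: "\<And>n. N \<le> n \<Longrightarrow> C * ((3 / 4) ^ n * c t0) < \<epsilon>"
    by (auto simp: eventually_sequentially)
  show "\<forall>\<^sub>F t in at_top. dist (c t) 0 < \<epsilon>"
    using eventually_ge_at_top[of "2 ^ N * t0"]
  proof eventually_elim
    case (elim t)
    define n where "n = nat \<lfloor>log 2 (t / t0)\<rfloor>"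
    have "2 ^ N \<le> t / t0" using elim t0(1) by (simp add: field_simps)
    then have "real N \<le> log 2 (t / t0)" using t0(1) by (simp add: le_log_iff powr_realpow less_le_trans[of 0 "2 ^ N"])
    then have n: "N \<le> n" "real n \<le> log 2 (t / t0)" "log 2 (t / t0) < real n + 1"
      unfolding n_def by linarith+
    have pos: "0 < t / t0" using elim t0(1) by (intro less_le_trans[OF _ \<open>2 ^ N \<le> t / t0\<close>]) simp
    have "2 powr real n \<le> t / t0" "t / t0 < 2 powr (real n + 1)"
      using n(2,3) pos by (simp_all add: le_log_iff log_less_iff)
    then have "t \<in> {2 ^ n * t0..2 * (2 ^ n * t0)}"
      using t0(1) by (auto simp: powr_realpow powr_add field_simps)
    then have "0 \<le> c t" "c t \<le> C * c (2 ^ n * t0)" using t0(3)[OF ge] by auto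
    moreover have "C * c (2 ^ n * t0) \<le> C * ((3 / 4) ^ n * c t0)"
      using pow \<open>0 \<le> C\<close> by (intro mult_left_mono) auto
    ultimately show ?case using N[OF n(1)] by (simp add: dist_real_def)
  qed
qed

text \<open>The product varies regularly with index \<open>- \<sigma>\<close>: doubling the argument changes the first factor
  by a factor near 1 and the second by about \<open>2 powr - \<sigma>\<close>, which is at most \<open>1 / 2\<close>.\<close>

lemma cumulated_times_kernel_vanishes:
  assumes "regular_kernel a \<rho>" "regular_kernel b \<sigma>"
  shows "((\<lambda>t. regular_kernel.cumulated a t * b t) \<longlongrightarrow> 0) at_top"
proof -
  interpret a: regular_kernel a \<rho> by fact
  interpret b: regular_kernel b \<sigma> by fact
  have twice: "filterlim (\<lambda>t. 2 * t) at_top (at_top :: real filter)" by real_asymp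
  have A_lim: "((\<lambda>t. a.cumulated t / a.cumulated (2 * t)) \<longlongrightarrow> 1) at_top"
    using filterlim_compose[OF a.cumulated_slowly_varying[of "1/2"] twice] by simp
  have A_pos: "\<forall>\<^sub>F t in at_top. 0 < a.cumulated (2 * t)"
    using a.cumulated_pos twice by (rule eventually_compose_filterlim)
  have A_lim': "((\<lambda>t. a.cumulated (2 * t) / a.cumulated t) \<longlongrightarrow> 1) at_top"
    using tendsto_inverse[OF A_lim] by simp
  have "((\<lambda>t. (a.cumulated (2 * t) / a.cumulated t) * (b (2 * t) / b t)) \<longlongrightarrow> 1 * 2 powr (- \<sigma>)) at_top"
    by (intro tendsto_mult A_lim' regularly_varying_scale[OF b.regular]) auto
  moreover have "2 powr (- \<sigma>) \<le> 2 powr (- 1)" using b.index by (intro powr_mono) auto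
  ultimately have "\<forall>\<^sub>F t in at_top. (a.cumulated (2 * t) / a.cumulated t) * (b (2 * t) / b t) < 3 / 4"
    by (intro order_tendstoD) (auto simp: powr_minus)
  then have half: "\<forall>\<^sub>F t in at_top. a.cumulated (2 * t) * b (2 * t) \<le> 3 / 4 * (a.cumulated t * b t)"
    using a.cumulated_pos regularly_varying_eventually_pos[OF b.regular]
    by eventually_elim (simp add: field_simps)
  have "\<forall>\<^sub>F t in at_top. \<forall>x\<in>{1/2..1}. (1 - 1) * x powr (- \<sigma>) * b t \<le> b (x * t) \<and>
      b (x * t) \<le> (1 + 1) * x powr (- \<sigma>) * b t"
    by (intro regularly_varying_bounds[OF b.regular]) auto
  then have bd: "\<forall>\<^sub>F t in at_top. \<forall>x\<in>{1/2..1}. (1 - 1) * x powr (- \<sigma>) * b (2 * t) \<le> b (x * (2 * t)) \<and>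
      b (x * (2 * t)) \<le> (1 + 1) * x powr (- \<sigma>) * b (2 * t)"
    using twice by (rule eventually_compose_filterlim)
  have "\<forall>\<^sub>F t in at_top. b (2 * t) / b t < 1"
    using regularly_varying_scale[OF b.regular, of 2] b.index by (intro order_tendstoD) (auto simp: powr_less_one)
  moreover have "\<forall>\<^sub>F t in at_top. a.cumulated (2 * t) / a.cumulated t < 2"
    using A_lim' by (intro order_tendstoD) auto
  ultimately have loc: "\<forall>\<^sub>F t in at_top. \<forall>s\<in>{t..2 * t}. 0 \<le> a.cumulated s * b s \<and>
      a.cumulated s * b s \<le> (4 * (1/2) powr (- \<sigma>)) * (a.cumulated t * b t)"
    using bd a.cumulated_pos regularly_varying_eventually_pos[OF b.regular] eventually_gt_at_top[of 0]
  proof eventually_elim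
    case (elim t)
    show ?case
    proof
      fix s assume s: "s \<in> {t..2 * t}"
      define x where "x = s / (2 * t)"
      have x: "x \<in> {1/2..1}" using s elim by (auto simp: x_def field_simps)
      have "b (x * (2 * t)) \<le> 2 * x powr (- \<sigma>) * b (2 * t)" using elim x by force
      also have "\<dots> \<le> 2 * (1/2) powr (- \<sigma>) * b t"
        using x b.index elim b.nonneg[of "2 * t"]
        by (intro mult_mono mult_left_mono powr_mono2') (auto simp: field_simps)
      finally have "b s \<le> 2 * (1/2) powr (- \<sigma>) * b t" using elim by (simp add: x_def)
      moreover have "a.cumulated s \<le> 2 * a.cumulated t"
        using a.cumulated_mono[of s "2 * t"] s elim by (auto simp: field_simps)
      ultimately have "a.cumulated s * b s \<le> (2 * a.cumulated t) * (2 * (1/2) powr (- \<sigma>) * b t)"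
        using s elim by (intro mult_mono b.nonneg) auto
      then show "0 \<le> a.cumulated s * b s \<and> a.cumulated s * b s \<le> (4 * (1/2) powr (- \<sigma>)) * (a.cumulated t * b t)"
        using s elim a.cumulated_nonneg b.nonneg[of s] by (simp add: mult_ac)
    qed
  qed
  show ?thesis using half loc by (rule tendsto_zero_of_doubling) simp
qed

text \<open>Cutting at \<open>t / 2\<close> and reflecting the second half gives two instances of \<open>half_convolution\<close> with
  the roles of \<open>a\<close> and \<open>b\<close> exchanged.\<close>

theorem convolution_asymptotics:
  assumes "regular_kernel a \<rho>" "regular_kernel b \<sigma>"
  defines "A \<equiv> \<lambda>t. LINT u:{0..t}|lborel. a u" and "B \<equiv> \<lambda>t. LINT u:{0..t}|lborel. b u"
    and "J \<equiv> \<lambda>t. LINT u:{0..t}|lborel. a u * b (t - u)"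
  shows "((\<lambda>t. J t / (A t * b t + B t * a t)) \<longlongrightarrow> 1) at_top" "(J \<longlongrightarrow> 0) at_top"
proof -
  interpret a: regular_kernel a \<rho> by fact
  interpret b: regular_kernel b \<sigma> by fact
  have A: "A = a.cumulated" and B: "B = b.cumulated"
    by (auto simp: A_def B_def a.cumulated_def b.cumulated_def)
  have split: "\<forall>\<^sub>F t in at_top. (LINT u:{0..t/2}|lborel. a u * b (t - u)) +
      (LINT u:{0..t/2}|lborel. b u * a (t - u)) = J t"
    using half_convolution(2)[OF assms(1,2)] half_convolution(2)[OF assms(2,1)] eventually_gt_at_top[of 0]
  proof eventually_elim
    case (elim t)
    have int2: "set_integrable lborel {t/2..t} (\<lambda>u. a u * b (t - u))"
      using elim set_integral_reflect(2)[of 0 "t/2" "\<lambda>u. b u * a (t - u)" t] by (simp add: mult.commute)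
    have un: "{0..t} = {0..t/2} \<union> {t/2..t}" using elim by auto
    have int: "set_integrable lborel {0..t} (\<lambda>u. a u * b (t - u))"
      using elim int2 unfolding un by (intro set_integrable_Un) auto
    have "(LINT u:{0..t/2}|lborel. b u * a (t - u)) = (LINT u:{t/2..t}|lborel. a u * b (t - u))"
      using set_integral_reflect(1)[of 0 "t/2" "\<lambda>u. b u * a (t - u)" t] by (simp add: mult.commute)
    also have "\<dots> = (LINT u:{t/2<..t}|lborel. a u * b (t - u))"
    proof -
      have "(LINT u:{t/2..t}|lborel. a u * b (t - u)) = (LINT u:{t/2..t/2}|lborel. a u * b (t - u)) +
          (LINT u:{t/2<..t}|lborel. a u * b (t - u))"
        using elim by (intro set_integral_ivl_split int2) auto
      moreover have "(LINT u:{t/2..t/2}|lborel. a u * b (t - u)) = 0"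
        by (simp add: set_integral_point)
      ultimately show ?thesis by simp
    qed
    finally show ?case unfolding J_def
      using set_integral_ivl_split[OF int, of "t/2"] elim by simp
  qed
  have pos: "\<forall>\<^sub>F t in at_top. 0 < A t * b t" "\<forall>\<^sub>F t in at_top. 0 < B t * a t"
    unfolding A B
    by (rule eventually_mono[OF eventually_conj], rule a.cumulated_pos,
        rule regularly_varying_eventually_pos[OF b.regular], simp)
       (rule eventually_mono[OF eventually_conj], rule b.cumulated_pos,
        rule regularly_varying_eventually_pos[OF a.regular], simp)
  have "((\<lambda>t. ((LINT u:{0..t/2}|lborel. a u * b (t - u)) + (LINT u:{0..t/2}|lborel. b u * a (t - u))) /
      (A t * b t + B t * a t)) \<longlongrightarrow> 1) at_top"
    using half_convolution(1)[OF assms(1,2)] half_convolution(1)[OF assms(2,1)] pos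
    unfolding A B by (intro tendsto_ratio_add)
  then show lim: "((\<lambda>t. J t / (A t * b t + B t * a t)) \<longlongrightarrow> 1) at_top"
    by (rule Lim_transform_eventually) (use split in eventually_elim, simp)
  have "((\<lambda>t. J t / (A t * b t + B t * a t) * (A t * b t + B t * a t)) \<longlongrightarrow> 1 * (0 + 0)) at_top"
    unfolding A B
    by (intro tendsto_mult tendsto_add lim[unfolded A B] cumulated_times_kernel_vanishes assms(1,2))
       (use assms(1,2) in \<open>auto intro: cumulated_times_kernel_vanishes\<close>)
  then have *: "((\<lambda>t. J t / (A t * b t + B t * a t) * (A t * b t + B t * a t)) \<longlongrightarrow> 0) at_top" by simp
  show "(J \<longlongrightarrow> 0) at_top"
    by (rule Lim_transform_eventually[OF *]) (use pos in eventually_elim, simp)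
qed

section \<open>Probability generating functions\<close>

lemma pgf_eq_powser:
  assumes "\<bar>s\<bar> \<le> 1"
  shows "summable (\<lambda>k. pmf p k * s ^ k)" "pgf p s = (\<Sum>k. pmf p k * s ^ k)"
proof -
  have "integrable (measure_pmf p) (\<lambda>k. s ^ k)"
    using assms by (intro measure_pmf.integrable_const_bound[of _ 1]) (auto simp: power_abs power_le_one)
  then have int: "integrable (count_space UNIV) (\<lambda>k. pmf p k * s ^ k)"
    by (simp add: measure_pmf_eq_density integrable_density)
  have "pgf p s = (\<integral>k. pmf p k * s ^ k \<partial>count_space UNIV)"
    unfolding pgf_def by (subst measure_pmf_eq_density, subst integral_density) auto
  then show "summable (\<lambda>k. pmf p k * s ^ k)" "pgf p s = (\<Sum>k. pmf p k * s ^ k)"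
    using sums_integral_count_space_nat[OF int] by (auto simp: sums_iff)
qed

lemma pgf_integrable: "0 \<le> s \<Longrightarrow> s \<le> 1 \<Longrightarrow> integrable (measure_pmf p) (\<lambda>k. s ^ k)" for s :: real
  by (intro measure_pmf.integrable_const_bound[of _ 1]) (auto simp: power_abs power_le_one)

lemma pgf_1: "pgf p 1 = 1"
  by (simp add: pgf_def)

lemma pgf_mono: "0 \<le> s \<Longrightarrow> s \<le> t \<Longrightarrow> t \<le> 1 \<Longrightarrow> pgf p s \<le> pgf p t"
  unfolding pgf_def by (intro integral_mono pgf_integrable power_mono) auto

lemma pgf_range: "0 \<le> s \<Longrightarrow> s \<le> 1 \<Longrightarrow> 0 \<le> pgf p s \<and> pgf p s \<le> 1"
  using pgf_mono[of s 1 p] by (simp add: pgf_1) (simp add: pgf_def)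

definition pgf_deriv :: "nat pmf \<Rightarrow> real \<Rightarrow> real" where
  "pgf_deriv p s = (\<Sum>k. diffs (pmf p) k * s ^ k)"

lemma pgf_has_derivative:
  assumes "\<bar>s\<bar> < 1"
  shows "(pgf p has_real_derivative pgf_deriv p s) (at s)"
proof -
  have "((\<lambda>s. \<Sum>k. pmf p k * s ^ k) has_real_derivative pgf_deriv p s) (at s)"
    unfolding pgf_deriv_def using assms pgf_eq_powser(1)[of 1 p] by (intro termdiffs_strong[of _ 1]) auto
  moreover have "\<forall>\<^sub>F x in nhds s. (\<Sum>k. pmf p k * x ^ k) = pgf p x"
    using eventually_nhds_in_open[of "{-1<..<1}" s] assms
    by (auto elim!: eventually_mono simp: pgf_eq_powser(2) abs_less_iff)
  ultimately show ?thesis by (subst (asm) DERIV_cong_ev[OF refl _ refl])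
qed

lemma power_above_tangent:
  fixes s v :: real
  assumes "0 \<le> s" "0 \<le> v"
  shows "s ^ k + real k * s ^ (k - 1) * (v - s) \<le> v ^ k"
proof (cases k)
  case (Suc n)
  show ?thesis
  proof (cases "s = 0")
    case False
    then have "0 < s" using assms by simp
    have "1 + real k * (v / s - 1) \<le> (1 + (v / s - 1)) ^ k"
      using assms \<open>0 < s\<close> by (intro Bernoulli_inequality) simp
    then have "(1 + real k * (v / s - 1)) * s ^ k \<le> (v / s) ^ k * s ^ k"
      using \<open>0 < s\<close> by (intro mult_right_mono) auto
    also have "(v / s) ^ k * s ^ k = v ^ k" using \<open>0 < s\<close> by (simp add: power_divide)
    also have "(1 + real k * (v / s - 1)) * s ^ k = s ^ k + real k * s ^ (k - 1) * (v - s)"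
      using \<open>0 < s\<close> Suc by (simp add: field_simps)
    finally show ?thesis .
  qed (use assms Suc in \<open>auto simp: power_0_left\<close>)
qed simp

text \<open>Convexity in the form needed below, obtained termwise from Bernoulli's inequality; the point \<open>v\<close> may
  be the end point 1, where the derivative need not exist.\<close>

lemma pgf_above_tangent:
  assumes "0 \<le> s" "s < 1" "0 \<le> v" "v \<le> 1"
  shows "pgf p s + pgf_deriv p s * (v - s) \<le> pgf p v"
proof -
  have "summable (\<lambda>k. pmf p k * 1 ^ k)" using pgf_eq_powser(1)[of 1 p] by simp
  then have sd: "summable (\<lambda>k. diffs (pmf p) k * s ^ k)"
    using assms by (intro termdiff_converges[of _ 1]) (auto intro: pgf_eq_powser(1))
  have "(\<lambda>k. diffs (pmf p) k * s ^ k) sums pgf_deriv p s"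
    unfolding pgf_deriv_def using sd by (rule summable_sums)
  then have "(\<lambda>k. real k * pmf p k * s ^ (k - Suc 0)) sums pgf_deriv p s"
    using diffs_equiv[OF sd] sums_unique2[of "\<lambda>k. diffs (pmf p) k * s ^ k"] pgf_deriv_def by force
  moreover have "(\<lambda>k. pmf p k * s ^ k) sums pgf p s" "(\<lambda>k. pmf p k * v ^ k) sums pgf p v"
    using assms pgf_eq_powser[of s p] pgf_eq_powser[of v p] by (auto simp: sums_iff)
  ultimately have "(\<lambda>k. pmf p k * s ^ k + real k * pmf p k * s ^ (k - Suc 0) * (v - s)) sums
      (pgf p s + pgf_deriv p s * (v - s))" "(\<lambda>k. pmf p k * v ^ k) sums pgf p v"
    by (auto intro!: sums_add sums_mult2)
  then show ?thesis
  proof (rule sums_le[rotated])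
    fix k
    show "pmf p k * s ^ k + real k * pmf p k * s ^ (k - Suc 0) * (v - s) \<le> pmf p k * v ^ k"
      using mult_left_mono[OF power_above_tangent[of s v k] pmf_nonneg[of p k]] assms
      by (simp add: algebra_simps)
  qed
qed

section \<open>Decay of solutions of an autonomous equation\<close>

lemma tendsto_div_of_derivative:
  fixes w :: "real \<Rightarrow> real"
  assumes deriv: "\<And>t. 0 < t \<Longrightarrow> (w has_real_derivative w' t) (at t)"
    and lim: "(w' \<longlongrightarrow> c) at_top"
  shows "((\<lambda>t. w t / t) \<longlongrightarrow> c) at_top"
proof (rule tendstoI)
  fix \<epsilon> :: real assume "0 < \<epsilon>"
  have "\<forall>\<^sub>F t in at_top. dist (w' t) c < \<epsilon> / 2 \<and> 0 < t"
    using tendstoD[OF lim, of "\<epsilon> / 2"] \<open>0 < \<epsilon>\<close> by (intro eventually_conj eventually_gt_at_top) auto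
  then obtain t0 where t0: "0 < t0" "\<And>t. t0 \<le> t \<Longrightarrow> \<bar>w' t - c\<bar> < \<epsilon> / 2"
    unfolding eventually_at_top_linorder dist_real_def by blast
  define M where "M = \<bar>w t0\<bar> + \<bar>c\<bar> * t0"
  have "\<forall>\<^sub>F t in at_top. M / t < \<epsilon> / 2" using \<open>0 < \<epsilon>\<close> by (intro order_tendstoD(2)[of _ 0]) (real_asymp, simp)
  then show "\<forall>\<^sub>F t in at_top. dist (w t / t) c < \<epsilon>"
    using eventually_gt_at_top[of t0]
  proof eventually_elim
    case (elim t)
    obtain z where z: "t0 < z" "w t - w t0 = (t - t0) * w' z"
      using MVT2[of t0 t w w'] deriv t0(1) elim by (metis less_le_trans)
    have "w t - c * t = (t - t0) * (w' z - c) + (w t0 - c * t0)" using z(2) by (simp add: algebra_simps)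
    also have "\<bar>\<dots>\<bar> \<le> (t - t0) * \<bar>w' z - c\<bar> + (\<bar>w t0\<bar> + \<bar>c\<bar> * t0)"
      using abs_triangle_ineq[of "(t - t0) * (w' z - c)" "w t0 - c * t0"] abs_triangle_ineq4[of "w t0" "c * t0"]
        elim t0(1) by (simp add: abs_mult)
    also have "\<dots> \<le> t * (\<epsilon> / 2) + M"
      unfolding M_def using t0 z elim by (intro add_mono mult_mono) (auto intro: less_imp_le)
    finally have "\<bar>w t - c * t\<bar> / t \<le> (t * (\<epsilon> / 2) + M) / t"
      using elim t0 by (intro divide_right_mono) auto
    also have "\<bar>w t - c * t\<bar> / t = \<bar>w t / t - c\<bar>"
    proof -
      have "w t / t - c = (w t - c * t) / t" using elim t0 by (simp add: field_simps)
      then show ?thesis using elim t0 by (simp add: abs_divide)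
    qed
    also have "(t * (\<epsilon> / 2) + M) / t = \<epsilon> / 2 + M / t" using elim t0 by (simp add: add_divide_distrib)
    finally show ?case using elim(1) unfolding dist_real_def by linarith
  qed
qed

lemma eventually_at_right_0_interval: "0 < b \<Longrightarrow> \<forall>\<^sub>F x in at_right 0. 0 < x \<and> x < (b::real)"
  unfolding eventually_at_right_field by auto

text \<open>In the application \<open>u t\<close> is the probability that the branching process survives up to time \<open>t\<close> and
  \<open>K x = f (1 - x) - (1 - x)\<close>, where \<open>f\<close> is the offspring generating function. Convexity of \<open>K\<close>
  enters through its tangents.\<close>

locale decay_equation =
  fixes K K' u :: "real \<Rightarrow> real" and \<mu> \<gamma> :: real and L :: "real \<Rightarrow> real"
  assumes mu: "0 < \<mu>" and gamma: "0 < \<gamma>"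
    and slow: "slowly_varying L"
    and K_form: "0 < x \<Longrightarrow> x \<le> 1 \<Longrightarrow> K x = x powr (\<gamma> + 1) * L (1 / x)"
    and K_0: "K 0 = 0"
    and K_deriv: "0 < x \<Longrightarrow> x \<le> 1 \<Longrightarrow> (K has_real_derivative K' x) (at x)"
    and K_tangent: "0 < x \<Longrightarrow> x \<le> 1 \<Longrightarrow> 0 \<le> y \<Longrightarrow> y \<le> 1 \<Longrightarrow> K x + K' x * (y - x) \<le> K y"
    and u_range: "0 < t \<Longrightarrow> 0 < u t \<and> u t \<le> 1"
    and u_antimono: "0 < s \<Longrightarrow> s \<le> t \<Longrightarrow> u t \<le> u s"
    and u_deriv: "0 < t \<Longrightarrow> (u has_real_derivative - \<mu> * K (u t)) (at t)"
begin

lemma K_pos_near_0: "\<forall>\<^sub>F x in at_right 0. 0 < K x"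
proof -
  have "\<forall>\<^sub>F x in at_right 0. 0 < L (inverse x)"
    using slowly_varying_eventually_pos[OF slow] filterlim_inverse_at_top_right
    by (rule eventually_compose_filterlim)
  then show ?thesis using eventually_at_right_0_interval[of 1, OF zero_less_one]
    by eventually_elim (auto simp: K_form inverse_eq_divide)
qed

lemma K_ratio:
  assumes "0 < c"
  shows "((\<lambda>x. K (c * x) / K x) \<longlongrightarrow> c powr (\<gamma> + 1)) (at_right 0)"
proof -
  have "((\<lambda>x. L (1 / c * inverse x) / L (inverse x)) \<longlongrightarrow> 1) (at_right 0)"
    using assms by (intro filterlim_compose[OF slowly_varying_scale[OF slow, of "1 / c"]
          filterlim_inverse_at_top_right]) auto
  then have "((\<lambda>x. c powr (\<gamma> + 1) * (L (1 / c * inverse x) / L (inverse x))) \<longlongrightarrow> c powr (\<gamma> + 1) * 1) (at_right 0)"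
    by (intro tendsto_intros)
  then have *: "((\<lambda>x. c powr (\<gamma> + 1) * (L (1 / c * inverse x) / L (inverse x))) \<longlongrightarrow> c powr (\<gamma> + 1)) (at_right 0)"
    by simp
  have "0 < min 1 (1 / c)" using assms by simp
  from eventually_at_right_0_interval[OF this]
  have "\<forall>\<^sub>F x in at_right 0. c powr (\<gamma> + 1) * (L (1 / c * inverse x) / L (inverse x)) = K (c * x) / K x"
  proof eventually_elim
    case (elim x)
    then have "0 < c * x" "c * x \<le> 1" using assms by (auto simp: field_simps)
    then show ?case using elim assms by (simp add: K_form powr_mult inverse_eq_divide)
  qed
  then show ?thesis using * by (rule Lim_transform_eventually[rotated])
qed

text \<open>The slope of the chord from the origin increases, by convexity and \<open>K 0 = 0\<close>. Together with positivity
  near 0 this yields positivity everywhere, and it is what makes \<open>u / K u\<close> invertible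
  later on.\<close>

lemma K_div_mono:
  assumes "0 < y" "y \<le> x" "x \<le> 1"
  shows "K y / y \<le> K x / x"
proof -
  have "K y + K' y * (0 - y) \<le> 0" using K_tangent[of y 0] assms K_0 by simp
  then have "K y / y \<le> K' y" using assms by (simp add: field_simps)
  then have "K y / y * (x - y) \<le> K' y * (x - y)" using assms by (intro mult_right_mono) auto
  moreover have "K y + K' y * (x - y) \<le> K x" using K_tangent[of y x] assms by simp
  moreover have "K y + K y / y * (x - y) = K y / y * x" using assms by (simp add: field_simps)
  ultimately have "K y / y * x \<le> K x" by linarith
  then show ?thesis using assms by (simp add: field_simps)
qed

lemma K_pos:
  assumes "0 < x" "x \<le> 1"
  shows "0 < K x"
proof -
  have "\<forall>\<^sub>F y in at_right 0. 0 < K y \<and> 0 < y \<and> y < x"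
    using eventually_conj[OF K_pos_near_0 eventually_at_right_0_interval[OF assms(1)]] .
  then obtain y where y: "0 < K y" "0 < y" "y < x" using eventually_happens by fastforce
  have "0 < K y / y" using y by simp
  also have "\<dots> \<le> K x / x" using y assms by (intro K_div_mono) auto
  finally show ?thesis using assms by (simp add: zero_less_divide_iff)
qed

lemma K_mono:
  assumes "0 < y" "y \<le> x" "x \<le> 1"
  shows "K y \<le> K x"
proof -
  have "K y = K y / y * y" using assms by simp
  also have "\<dots> \<le> K x / x * x"
    using K_div_mono[of y x] K_pos[of x] assms by (intro mult_mono) auto
  also have "\<dots> = K x" using assms by simp
  finally show ?thesis .
qed

text \<open>The monotone density theorem for a convex function: the slope of the tangent at \<open>x\<close> lies between the
  slopes of the chords to \<open>c * x\<close> with \<open>c < 1\<close> and with \<open>c > 1\<close>. Divided by \<open>K x / x\<close>, these chord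
  slopes converge to the difference quotients \<open>\<phi> c\<close> of \<open>c powr (\<gamma> + 1)\<close>, which tend to \<open>\<gamma> + 1\<close> as
  \<open>c\<close> tends to 1.\<close>

lemma elasticity: "((\<lambda>x. x * K' x / K x) \<longlongrightarrow> \<gamma> + 1) (at_right 0)"
proof -
  define \<phi> where "\<phi> c = (c powr (\<gamma> + 1) - 1) / (c - 1)" for c :: real
  have "((\<lambda>c. c powr (\<gamma> + 1)) has_real_derivative (\<gamma> + 1) * 1 powr (\<gamma> + 1 - 1)) (at 1)"
    by (rule has_real_derivative_powr) simp
  then have phi: "(\<phi> \<longlongrightarrow> \<gamma> + 1) (at 1)"
    by (simp add: has_field_derivative_iff \<phi>_def[abs_def])
  have ratio: "((\<lambda>x. (K (c * x) / K x - 1) / (c - 1)) \<longlongrightarrow> \<phi> c) (at_right 0)" if "0 < c" "c \<noteq> 1" for c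
    unfolding \<phi>_def using that by (intro tendsto_intros K_ratio) auto
  have tangent: "\<forall>\<^sub>F x in at_right 0. x * K' x / K x * (c - 1) \<le> K (c * x) / K x - 1" if "0 < c" for c
  proof -
    have "0 < min 1 (1 / c)" using that by simp
    from eventually_at_right_0_interval[OF this] show ?thesis
    proof eventually_elim
      case (elim x)
      then have "0 \<le> c * x" "c * x \<le> 1" using that by (auto simp: field_simps)
      then have "K x + K' x * (c * x - x) \<le> K (c * x)" using K_tangent[of x "c * x"] elim by simp
      then have "(x * K' x * (c - 1)) / K x \<le> (K (c * x) - K x) / K x"
        using K_pos[of x] elim by (intro divide_right_mono) (auto simp: algebra_simps)
      then show ?case using K_pos[of x] elim by (simp add: diff_divide_distrib)
    qed
  qed
  show ?thesis
  proof (rule order_tendstoI)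
    fix y assume "y < \<gamma> + 1"
    have "\<forall>\<^sub>F c in at_left 1. y < \<phi> c"
      using order_tendstoD(1)[OF phi \<open>y < \<gamma> + 1\<close>] by (simp add: eventually_at_split)
    moreover have "\<forall>\<^sub>F c in at_left 1. 0 < c \<and> c < (1::real)"
      unfolding eventually_at_left_field by (intro exI[of _ 0]) auto
    ultimately have ex: "\<forall>\<^sub>F c in at_left 1. y < \<phi> c \<and> 0 < c \<and> c < 1" by (rule eventually_conj)
    obtain c where c: "y < \<phi> c" "0 < c" "c < 1" using eventually_happens[OF ex] by auto
    have "\<forall>\<^sub>F x in at_right 0. y < (K (c * x) / K x - 1) / (c - 1)"
      using c by (intro order_tendstoD(1)[OF ratio]) auto
    then show "\<forall>\<^sub>F x in at_right 0. y < x * K' x / K x"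
      using tangent[OF c(2)]
    proof eventually_elim
      case (elim x)
      have "(K (c * x) / K x - 1) / (c - 1) \<le> x * K' x / K x"
        using elim c by (subst divide_le_eq) auto
      then show ?case using elim by simp
    qed
  next
    fix y assume "\<gamma> + 1 < y"
    have "\<forall>\<^sub>F c in at_right 1. \<phi> c < y"
      using order_tendstoD(2)[OF phi \<open>\<gamma> + 1 < y\<close>] by (simp add: eventually_at_split)
    moreover have "\<forall>\<^sub>F c in at_right 1. (1::real) < c"
      by (rule eventually_at_right_less)
    ultimately have ex: "\<forall>\<^sub>F c in at_right 1. \<phi> c < y \<and> 1 < c" by (rule eventually_conj)
    obtain c where c: "\<phi> c < y" "1 < c" using eventually_happens[OF ex] by auto
    have "\<forall>\<^sub>F x in at_right 0. (K (c * x) / K x - 1) / (c - 1) < y"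
      using c by (intro order_tendstoD(2)[OF ratio]) auto
    moreover have "\<forall>\<^sub>F x in at_right 0. x * K' x / K x * (c - 1) \<le> K (c * x) / K x - 1"
      using tangent[of c] c by simp
    ultimately show "\<forall>\<^sub>F x in at_right 0. x * K' x / K x < y"
    proof eventually_elim
      case (elim x)
      have "x * K' x / K x \<le> (K (c * x) / K x - 1) / (c - 1)"
        using elim c by (subst le_divide_eq) auto
      then show ?case using elim by simp
    qed
  qed
qed

text \<open>As long as \<open>u\<close> stays above \<open>y > 0\<close> it decreases at a rate of at least \<open>\<mu> * K y\<close>.\<close>

lemma u_tendsto_0: "(u \<longlongrightarrow> 0) at_top"
proof (rule order_tendstoI)
  fix y :: real assume "y < 0"
  show "\<forall>\<^sub>F t in at_top. y < u t"
    using eventually_gt_at_top[of 0] by eventually_elim (use u_range \<open>y < 0\<close> in \<open>force intro: less_trans\<close>)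
next
  fix y :: real assume "0 < y"
  have "\<exists>t0>0. u t0 < y"
  proof (rule ccontr)
    assume "\<not> ?thesis"
    then have ge: "y \<le> u t" if "0 < t" for t using that by force
    have "y \<le> 1" using ge[of 1] u_range[of 1] by simp
    have "0 < K y" using K_pos \<open>0 < y\<close> \<open>y \<le> 1\<close> by simp
    \<comment> \<open>By this time the decrease since time 1 would amount to 1.\<close>
    define t where "t = 1 + 1 / (\<mu> * K y)"
    have "1 < t" using \<open>0 < K y\<close> mu by (simp add: t_def)
    then obtain z where z: "1 < z" "z < t" "u t - u 1 = (t - 1) * (- \<mu> * K (u z))"
      using MVT2[of 1 t u "\<lambda>t. - \<mu> * K (u t)"] u_deriv by (metis less_le_trans zero_less_one)
    have "K y \<le> K (u z)" using K_mono[of y "u z"] ge[of z] u_range[of z] z \<open>0 < y\<close> by simp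
    then have "(t - 1) * (\<mu> * K y) \<le> (t - 1) * (\<mu> * K (u z))"
      using \<open>1 < t\<close> mu by (intro mult_left_mono) auto
    moreover have "(t - 1) * (\<mu> * K y) = 1" using \<open>0 < K y\<close> mu by (simp add: t_def)
    ultimately have "u t \<le> u 1 - 1" using z(3) by (simp add: algebra_simps)
    then show False using u_range[of 1] u_range[of t] \<open>1 < t\<close> by simp
  qed
  then obtain t0 where t0: "0 < t0" "u t0 < y" by blast
  show "\<forall>\<^sub>F t in at_top. u t < y"
    using eventually_ge_at_top[of t0]
    by eventually_elim (use u_antimono t0 in \<open>force intro: le_less_trans\<close>)
qed

lemma u_at_right: "filterlim u (at_right 0) at_top"
  unfolding filterlim_at
proof
  show "\<forall>\<^sub>F t in at_top. u t \<in> {0<..} \<and> u t \<noteq> 0"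
    using eventually_gt_at_top[of 0] by eventually_elim (use u_range in force)
qed (rule u_tendsto_0)

text \<open>The derivative of \<open>u / K u\<close> is \<open>\<mu> * (u * K' u / K u - 1)\<close>, so \<open>elasticity\<close> gives its limit.\<close>

lemma reciprocal_rate: "((\<lambda>t. u t / K (u t) / t) \<longlongrightarrow> \<mu> * \<gamma>) at_top"
proof (rule tendsto_div_of_derivative)
  fix t :: real assume t: "0 < t"
  have K: "0 < K (u t)" using K_pos u_range[OF t] by simp
  have "((\<lambda>t. K (u t)) has_real_derivative K' (u t) * (- \<mu> * K (u t))) (at t)"
    using u_range[OF t] by (intro DERIV_chain2[OF K_deriv u_deriv[OF t]]) auto
  then have "((\<lambda>t. u t / K (u t)) has_real_derivative
      ((- \<mu> * K (u t)) * K (u t) - u t * (K' (u t) * (- \<mu> * K (u t)))) / (K (u t) * K (u t))) (at t)"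
    using K by (intro DERIV_divide u_deriv[OF t]) auto
  also have "((- \<mu> * K (u t)) * K (u t) - u t * (K' (u t) * (- \<mu> * K (u t)))) / (K (u t) * K (u t))
      = \<mu> * (u t * K' (u t) / K (u t) - 1)"
    using K by (simp add: field_simps)
  finally show "((\<lambda>t. u t / K (u t)) has_real_derivative \<mu> * (u t * K' (u t) / K (u t) - 1)) (at t)" .
next
  have "((\<lambda>t. \<mu> * (u t * K' (u t) / K (u t) - 1)) \<longlongrightarrow> \<mu> * (\<gamma> + 1 - 1)) at_top"
    by (intro tendsto_intros filterlim_compose[OF elasticity u_at_right])
  then show "((\<lambda>t. \<mu> * (u t * K' (u t) / K (u t) - 1)) \<longlongrightarrow> \<mu> * \<gamma>) at_top" by simp
qed

text \<open>With \<open>W x = x / K x\<close> the previous lemma says that \<open>W (u t)\<close> grows linearly, so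
  \<open>W (u (c * t)) / W (u t)\<close> tends to \<open>c\<close>. As \<open>W\<close> is decreasing and varies regularly at 0 with index
  \<open>- \<gamma>\<close>, a ratio \<open>u (c * t) / u t\<close> that stayed away from \<open>c powr - (1 / \<gamma>)\<close> would force a different
  limit.\<close>

lemma u_ratio:
  assumes "0 < c"
  shows "((\<lambda>t. u (c * t) / u t) \<longlongrightarrow> c powr (- (1 / \<gamma>))) at_top"
proof -
  define W where "W x = x / K x" for x
  define d where "d = c powr (- (1 / \<gamma>))"
  have "0 < d" using assms by (simp add: d_def)
  have "d powr (- \<gamma>) = c" using assms gamma by (simp add: d_def powr_powr)
  have ct: "filterlim (\<lambda>t. c * t) at_top at_top"
    using assms filterlim_tendsto_pos_mult_at_top[OF tendsto_const _ filterlim_ident, of c] by simp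
  have "((\<lambda>t. c * ((W (u (c * t)) / (c * t)) / (W (u t) / t))) \<longlongrightarrow> c * (\<mu> * \<gamma> / (\<mu> * \<gamma>))) at_top"
    unfolding W_def using mu gamma
    by (intro tendsto_mult tendsto_const tendsto_divide reciprocal_rate
        filterlim_compose[OF reciprocal_rate ct]) auto
  moreover have "\<forall>\<^sub>F t in at_top. c * ((W (u (c * t)) / (c * t)) / (W (u t) / t)) = W (u (c * t)) / W (u t)"
    using eventually_gt_at_top[of 0] by eventually_elim (use assms in \<open>simp add: field_simps\<close>)
  ultimately have W_lim: "((\<lambda>t. W (u (c * t)) / W (u t)) \<longlongrightarrow> c) at_top"
    using mu gamma Lim_transform_eventually by force
  have W_ratio: "((\<lambda>t. W (y * u t) / W (u t)) \<longlongrightarrow> y powr (- \<gamma>)) at_top" if "0 < y" for y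
  proof -
    have "((\<lambda>t. y / (K (y * u t) / K (u t))) \<longlongrightarrow> y / y powr (\<gamma> + 1)) at_top"
      using that by (intro tendsto_intros filterlim_compose[OF K_ratio u_at_right]) auto
    also have "y / y powr (\<gamma> + 1) = y powr (- \<gamma>)" using that by (simp add: powr_add powr_minus field_simps)
    finally have *: "((\<lambda>t. y / (K (y * u t) / K (u t))) \<longlongrightarrow> y powr (- \<gamma>)) at_top" .
    show ?thesis
      by (rule Lim_transform_eventually[OF *], rule eventually_mono[OF eventually_gt_at_top[of 0]])
         (use u_range in \<open>force simp: W_def\<close>)
  qed
  have W_antimono: "W x \<le> W y" if "0 < y" "y \<le> x" "x \<le> 1" for x y
  proof -
    have "K y / y \<le> K x / x" "0 < K y / y" using K_div_mono[of y x] K_pos[of y] that by auto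
    then have "inverse (K x / x) \<le> inverse (K y / y)" by (rule le_imp_inverse_le)
    then show ?thesis by (simp add: W_def)
  qed
  have W_pos: "0 < W (u t)" if "0 < t" for t
    using K_pos[of "u t"] u_range[OF that] by (simp add: W_def)
  have small: "\<forall>\<^sub>F t in at_top. y * u t < 1" for y
    by (rule order_tendstoD(2)[of _ "y * 0"]) (intro tendsto_intros u_tendsto_0, simp)
  show ?thesis unfolding d_def[symmetric]
  proof (rule order_tendstoI)
    fix y assume "d < y"
    then have "0 < y" using \<open>0 < d\<close> by simp
    have "y powr (- \<gamma>) < c" using powr_less_mono2_neg[of "- \<gamma>" d y] \<open>d < y\<close> \<open>0 < d\<close> gamma \<open>d powr (- \<gamma>) = c\<close> by simp
    then obtain z where z: "y powr (- \<gamma>) < z" "z < c" using dense by blast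
    show "\<forall>\<^sub>F t in at_top. u (c * t) / u t < y"
      using order_tendstoD(2)[OF W_ratio[OF \<open>0 < y\<close>] z(1)] order_tendstoD(1)[OF W_lim z(2)]
        eventually_gt_at_top[of 0]
    proof eventually_elim
      case (elim t)
      have ut: "0 < u t" "0 < u (c * t)" "u (c * t) \<le> 1" using u_range[of t] u_range[of "c * t"] elim assms by auto
      have "W (y * u t) / W (u t) < W (u (c * t)) / W (u t)" using elim by simp
      then have lt: "W (y * u t) < W (u (c * t))" using W_pos[of t] elim by (simp add: divide_less_cancel)
      have "u (c * t) < y * u t"
      proof (rule ccontr)
        assume "\<not> u (c * t) < y * u t"
        then have "W (u (c * t)) \<le> W (y * u t)" using ut \<open>0 < y\<close> by (intro W_antimono) auto
        then show False using lt by simp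
      qed
      then show ?case using ut by (simp add: field_simps)
    qed
  next
    fix y assume "y < d"
    show "\<forall>\<^sub>F t in at_top. y < u (c * t) / u t"
    proof (cases "0 < y")
      case False
      show ?thesis using eventually_gt_at_top[of 0]
      proof eventually_elim
        case (elim t)
        then have "0 < u (c * t) / u t" using u_range[of t] u_range[of "c * t"] assms by simp
        then show ?case using False by simp
      qed
    next
      case True
      have "c < y powr (- \<gamma>)" using powr_less_mono2_neg[of "- \<gamma>" y d] \<open>y < d\<close> True gamma \<open>d powr (- \<gamma>) = c\<close> by simp
      then obtain z where z: "c < z" "z < y powr (- \<gamma>)" using dense by blast
      show ?thesis
        using order_tendstoD(1)[OF W_ratio[OF True] z(2)] order_tendstoD(2)[OF W_lim z(1)]
          eventually_gt_at_top[of 0] small[of y]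
      proof eventually_elim
        case (elim t)
        have ut: "0 < u t" "0 < u (c * t)" using u_range[of t] u_range[of "c * t"] elim assms by auto
        have "W (u (c * t)) / W (u t) < W (y * u t) / W (u t)" using elim by simp
        then have lt: "W (u (c * t)) < W (y * u t)" using W_pos[of t] elim by (simp add: divide_less_cancel)
        have "y * u t < u (c * t)"
        proof (rule ccontr)
          assume "\<not> y * u t < u (c * t)"
          then have "W (y * u t) \<le> W (u (c * t))" using ut elim by (intro W_antimono) auto
          then show False using lt by simp
        qed
        then show ?case using ut by (simp add: field_simps)
      qed
    qed
  qed
qed

text \<open>Pointwise convergence of the ratios suffices here; measurability comes from monotonicity.\<close>

lemma power_of_u_regularly_varying:
  assumes slow_l: "slowly_varying l"
    and q: "\<And>t. 0 < t \<Longrightarrow> q t = u t powr \<alpha> * l (1 / u t)" and q_anti: "\<And>s t. 0 < s \<Longrightarrow> s \<le> t \<Longrightarrow> q t \<le> q s"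
  shows "regularly_varying (- (\<alpha> / \<gamma>)) q"
proof -
  have inv_top: "filterlim (\<lambda>t. 1 / u t) at_top at_top"
    using filterlim_compose[OF filterlim_inverse_at_top_right u_at_right] by (simp add: inverse_eq_divide)
  have q_pos: "\<forall>\<^sub>F t in at_top. 0 < q t"
    using eventually_compose_filterlim[OF slowly_varying_eventually_pos[OF slow_l] inv_top] eventually_gt_at_top[of 0]
    by eventually_elim (use u_range in \<open>force simp: q\<close>)
  then obtain X where X: "0 < X" "\<And>t. X \<le> t \<Longrightarrow> 0 < q t"
    using eventually_conj[OF q_pos eventually_gt_at_top[of 0]] unfolding eventually_at_top_linorder by blast
  have "mono (\<lambda>t. - q (max X t))"
    using X(1) by (intro monoI) (auto intro!: q_anti)
  then have "(\<lambda>t. - q (max X t)) \<in> borel_measurable borel" by (rule borel_measurable_mono)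
  then have "(\<lambda>t. - (- q (max X t))) \<in> borel_measurable borel" by (rule borel_measurable_uminus)
  then have [measurable]: "(\<lambda>t. q (max X t)) \<in> borel_measurable borel" by simp
  have "(\<lambda>t. indicat_real {X..} t *\<^sub>R (t powr - (- (\<alpha> / \<gamma>)) * q t)) =
      (\<lambda>t. indicat_real {X..} t *\<^sub>R (t powr (\<alpha> / \<gamma>) * q (max X t)))"
    by (auto simp: indicator_def max_def)
  then have meas: "set_borel_measurable borel {X..} (\<lambda>t. t powr - (- (\<alpha> / \<gamma>)) * q t)"
    unfolding set_borel_measurable_def by simp
  have ratio: "((\<lambda>t. ((c * t) powr - (- (\<alpha> / \<gamma>)) * q (c * t)) / (t powr - (- (\<alpha> / \<gamma>)) * q t)) \<longlongrightarrow> 1) at_top"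
    if "0 < c" for c
  proof -
    define d where "d = c powr (- (1 / \<gamma>))"
    have d: "0 < d" using that by (simp add: d_def)
    have ur: "((\<lambda>t. u (c * t) / u t) \<longlongrightarrow> d) at_top" unfolding d_def by (rule u_ratio[OF that])
    have "((\<lambda>t. c powr (\<alpha> / \<gamma>) * ((u (c * t) / u t) powr \<alpha> *
        (l (inverse (u (c * t) / u t) * (1 / u t)) / l (1 / u t)))) \<longlongrightarrow> c powr (\<alpha> / \<gamma>) * (d powr \<alpha> * 1)) at_top"
      using d by (intro tendsto_intros ur slowly_varying_compose[OF slow_l inv_top, of _ "inverse d"]) auto
    also have "c powr (\<alpha> / \<gamma>) * (d powr \<alpha> * 1) = 1"
      using that by (simp add: d_def powr_powr powr_add[symmetric])
    finally have *: "((\<lambda>t. c powr (\<alpha> / \<gamma>) * ((u (c * t) / u t) powr \<alpha> *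
        (l (inverse (u (c * t) / u t) * (1 / u t)) / l (1 / u t)))) \<longlongrightarrow> 1) at_top" .
    show ?thesis
    proof (rule Lim_transform_eventually[OF *], rule eventually_mono[OF eventually_gt_at_top[of 0]])
      fix t :: real assume t: "0 < t"
      have ut: "0 < u t" "0 < u (c * t)" using u_range[of t] u_range[of "c * t"] t that by auto
      then show "c powr (\<alpha> / \<gamma>) * ((u (c * t) / u t) powr \<alpha> *
        (l (inverse (u (c * t) / u t) * (1 / u t)) / l (1 / u t))) =
        ((c * t) powr - (- (\<alpha> / \<gamma>)) * q (c * t)) / (t powr - (- (\<alpha> / \<gamma>)) * q t)"
        using t that by (simp add: q powr_mult powr_divide)
    qed
  qed
  show ?thesis
    unfolding regularly_varying_def slowly_varying_def
    using X meas ratio by (intro conjI exI[of _ X]) auto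
qed

end

section \<open>Extinction of the branching process\<close>

lemma alive_Nil_iff: "[] \<in> alive w t \<longleftrightarrow> 0 \<le> t \<and> t < fst (w [])"
  by (simp add: alive_def born_def birth_time_def)

lemma alive_Cons_iff:
  "i # v \<in> alive w t \<longleftrightarrow> i < snd (w []) \<and> v \<in> alive (\<lambda>u. w (i # u)) (t - fst (w []))"
proof -
  have "born w (i # v) \<longleftrightarrow> i < snd (w []) \<and> born (\<lambda>u. w (i # u)) v"
    by (auto simp: born_def All_less_Suc2)
  moreover have "birth_time w (i # v) = fst (w []) + birth_time (\<lambda>u. w (i # u)) v"
    by (simp add: birth_time_def sum.lessThan_Suc_shift del: sum.lessThan_Suc)
  ultimately show ?thesis by (auto simp: alive_def)
qed

lemma alive_empty_iff:
  assumes "0 \<le> t"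
  shows "alive w t = {} \<longleftrightarrow>
    fst (w []) \<le> t \<and> (\<forall>i<snd (w []). alive (\<lambda>u. w (i # u)) (t - fst (w [])) = {})"
proof -
  have "alive w t = {} \<longleftrightarrow> (\<forall>u. u \<notin> alive w t)" by auto
  also have "\<dots> \<longleftrightarrow> [] \<notin> alive w t \<and> (\<forall>i v. i # v \<notin> alive w t)"
    by (metis neq_Nil_conv)
  also have "(\<forall>i v. i # v \<notin> alive w t) \<longleftrightarrow> (\<forall>i<snd (w []). alive (\<lambda>u. w (i # u)) (t - fst (w [])) = {})"
    unfolding alive_Cons_iff by blast
  also have "[] \<notin> alive w t \<longleftrightarrow> fst (w []) \<le> t"
    using assms by (auto simp: alive_Nil_iff)
  finally show ?thesis .
qed

text \<open>An individual alive at time \<open>t\<close> has a line of ancestors whose lives cover the time from 0 to \<open>t\<close>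
  without gaps, so one of them was alive at time \<open>s\<close>. This holds for every tree, including those with
  negative life lengths, which have probability 0.\<close>

lemma extinction_persists:
  assumes "alive w s = {}" "0 \<le> s" "s \<le> t"
  shows "alive w t = {}"
proof (rule ccontr)
  assume "alive w t \<noteq> {}"
  then obtain u where u: "born w u" "t < birth_time w u + fst (w u)"
    by (auto simp: alive_def)
  have born_take: "born w (take n u)" for n
    using u(1) by (auto simp: born_def min_def)
  have birth_take: "birth_time w (take n u) = (\<Sum>k<n. fst (w (take k u)))" if "n \<le> length u" for n
    using that by (auto simp: birth_time_def min_def intro!: sum.cong)
  \<comment> \<open>Going from \<open>u\<close> back to the root, every ancestor dies after time \<open>s\<close>: its child on the line dies
    after time \<open>s\<close> without being alive at time \<open>s\<close>, so it is born, and its parent dies, after time \<open>s\<close>.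
    The sum is the time of death.\<close>
  have "s < (\<Sum>k<Suc n. fst (w (take k u)))" if "n \<le> length u" for n
    using that
  proof (induction "length u - n" arbitrary: n)
    case 0
    then have "n = length u" by simp
    then show ?case using u(2) \<open>s \<le> t\<close> by (simp add: birth_time_def)
  next
    case (Suc m)
    then have "m = length u - Suc n" "Suc n \<le> length u" by auto
    then have "s < (\<Sum>k<Suc (Suc n). fst (w (take k u)))" by (rule Suc.hyps(1))
    then have next_birth: "s < birth_time w (take (Suc n) u) + fst (w (take (Suc n) u))"
      using Suc by (subst birth_take) auto
    have "take (Suc n) u \<notin> alive w s" using assms(1) by simp
    then have "s < birth_time w (take (Suc n) u)"
      using next_birth born_take by (auto simp: alive_def not_le)
    then show ?case using Suc by (simp add: birth_take)
  qed
  from this[of 0] have "[] \<in> alive w s" using \<open>0 \<le> s\<close> by (simp add: alive_Nil_iff)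
  then show False using assms(1) by simp
qed

lemma population_eq_0_iff: "population w t = 0 \<longleftrightarrow> alive w t = {}"
  by (auto simp: population_def zero_enat_def)

definition extinction_prob :: "real \<Rightarrow> nat pmf \<Rightarrow> real \<Rightarrow> real" where
  "extinction_prob \<mu> p t = measure (tree_law \<mu> p) {w. alive w t = {}}"

lemma space_tree_law: "space (tree_law \<mu> p) = UNIV"
  by (simp add: tree_law_def particle_law_def space_PiM space_pair_measure)

lemma sets_particle_law[measurable_cong]: "sets (particle_law \<mu> p) = sets (borel \<Otimes>\<^sub>M count_space UNIV)"
  unfolding particle_law_def by (intro sets_pair_measure_cong) auto

lemma measurable_particle[measurable]: "(\<lambda>w. w u) \<in> tree_law \<mu> p \<rightarrow>\<^sub>M particle_law \<mu> p"
  unfolding tree_law_def by measurable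

lemma measurable_particle_parts[measurable]:
  "fst \<in> particle_law \<mu> p \<rightarrow>\<^sub>M borel" "snd \<in> particle_law \<mu> p \<rightarrow>\<^sub>M count_space UNIV"
  by (simp_all cong: measurable_cong_sets[OF sets_particle_law refl])

lemma measurable_alive:
  "Measurable.pred (tree_law \<mu> p \<Otimes>\<^sub>M borel) (\<lambda>x. u \<in> alive (fst x) (snd x))"
  unfolding alive_def born_def birth_time_def mem_Collect_eq by measurable

lemma measurable_extinct[measurable]:
  "Measurable.pred (tree_law \<mu> p \<Otimes>\<^sub>M borel) (\<lambda>x. alive (fst x) (snd x) = {})"
proof -
  have eq: "(\<lambda>x. alive (fst x) (snd x) = {}) = (\<lambda>x. \<forall>u. u \<notin> alive (fst x) (snd x))" by auto
  show ?thesis unfolding eq by (intro pred_intros_countable pred_intros_logic measurable_alive)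
qed

lemma extinct_event[measurable]: "{w. alive w t = {}} \<in> sets (tree_law \<mu> p)"
proof -
  have "Measurable.pred (tree_law \<mu> p) (\<lambda>w. alive (fst (w, t)) (snd (w, t)) = {})"
    by (rule measurable_compose[OF _ measurable_extinct]) measurable
  then show ?thesis by (simp add: pred_def space_tree_law)
qed

locale branching =
  fixes \<mu> :: real and p :: "nat pmf"
  assumes rate: "0 < \<mu>"
begin

lemma prob_particle_law: "prob_space (particle_law \<mu> p)"
  unfolding particle_law_def
  by (intro prob_space_pair prob_space_exponential_density rate measure_pmf.prob_space_axioms)

sublocale tree: prob_space "tree_law \<mu> p"
  unfolding tree_law_def by (intro prob_space_PiM prob_particle_law)

abbreviation "e \<equiv> extinction_prob \<mu> p"

lemma population_pgf_0: "population_pgf \<mu> p t 0 = e t"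
proof -
  have "enat_power 0 (population w t) = indicator {w. alive w t = {}} w" for w
    using population_eq_0_iff[of w t]
    by (cases "population w t") (auto simp: enat_power_def indicator_def power_0_left zero_enat_def)
  then show ?thesis by (simp add: population_pgf_def extinction_prob_def)
qed

lemma e_range: "0 \<le> e t" "e t \<le> 1"
  by (simp_all add: extinction_prob_def)

lemma e_mono: "0 \<le> s \<Longrightarrow> s \<le> t \<Longrightarrow> e s \<le> e t"
  unfolding extinction_prob_def by (intro tree.finite_measure_mono) (auto dest: extinction_persists)

lemma indep_particles: "tree.indep_vars (\<lambda>_. particle_law \<mu> p) (\<lambda>u w. w u) UNIV"
proof -
  have "distr (tree_law \<mu> p) (particle_law \<mu> p) (\<lambda>w. w u) = particle_law \<mu> p" for u
    unfolding tree_law_def by (rule distr_PiM_component) (auto intro: prob_particle_law)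
  then show ?thesis
    by (subst tree.indep_vars_iff_distr_eq_PiM) (auto simp: tree_law_def[symmetric] restrict_def distr_id)
qed

lemma subtree_measurable: "(\<lambda>w v. w (i # v)) \<in> tree_law \<mu> p \<rightarrow>\<^sub>M tree_law \<mu> p"
  unfolding tree_law_def
  by (rule measurable_PiM_single') (auto simp: space_PiM particle_law_def space_pair_measure)

lemma subtree_measurable':
  assumes "range ((#) i) \<subseteq> J"
  shows "(\<lambda>w v. w (i # v)) \<in> PiM J (\<lambda>_. particle_law \<mu> p) \<rightarrow>\<^sub>M tree_law \<mu> p"
  unfolding tree_law_def
proof (rule measurable_PiM_single')
  fix v
  show "(\<lambda>w. w (i # v)) \<in> PiM J (\<lambda>_. particle_law \<mu> p) \<rightarrow>\<^sub>M particle_law \<mu> p"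
    using assms by (intro measurable_component_singleton) auto
qed (simp add: particle_law_def space_pair_measure)

lemma subtree_law: "distr (tree_law \<mu> p) (tree_law \<mu> p) (\<lambda>w v. w (i # v)) = tree_law \<mu> p"
  using distr_PiM_reindex[of UNIV "\<lambda>_. particle_law \<mu> p" "(#) i" UNIV] prob_particle_law
  by (simp add: tree_law_def restrict_def)

text \<open>The subtrees of the children live on disjoint sets of labels, hence are independent copies of the
  whole tree.\<close>

lemma subtrees_extinct:
  "tree.prob {w. \<forall>i<n. alive (\<lambda>v. w (i # v)) t = {}} = e t ^ n"
proof (cases "n = 0")
  case True
  then show ?thesis using tree.prob_space by (simp add: space_tree_law)
next
  case False
  have "tree.indep_vars (\<lambda>i. PiM (range ((#) i)) (\<lambda>_. particle_law \<mu> p))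
      (\<lambda>i w. restrict w (range ((#) i))) (UNIV :: nat set)"
    using tree.indep_vars_restrict[OF indep_particles, of UNIV "\<lambda>i. range ((#) i)"]
    by (auto simp: disjoint_family_on_def)
  then have "tree.indep_vars (\<lambda>_. tree_law \<mu> p)
      (\<lambda>i w. (\<lambda>w v. w (i # v)) (restrict w (range ((#) i)))) (UNIV :: nat set)"
    by (rule tree.indep_vars_compose2) (rule subtree_measurable', simp)
  then have ind: "tree.indep_vars (\<lambda>_. tree_law \<mu> p) (\<lambda>i w v. w (i # v)) (UNIV :: nat set)"
    by simp
  have "tree.prob (\<Inter>i\<in>{..<n}. (\<lambda>w v. w (i # v)) -` {w. alive w t = {}} \<inter> space (tree_law \<mu> p)) =
      (\<Prod>i\<in>{..<n}. tree.prob ((\<lambda>w v. w (i # v)) -` {w. alive w t = {}} \<inter> space (tree_law \<mu> p)))"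
    by (rule tree.indep_varsD[OF ind]) (use False in auto)
  moreover have "tree.prob ((\<lambda>w v. w (i # v)) -` {w. alive w t = {}} \<inter> space (tree_law \<mu> p)) = e t" for i
    by (subst measure_distr[symmetric, OF subtree_measurable extinct_event])
       (simp add: subtree_law extinction_prob_def)
  moreover have "(\<Inter>i\<in>{..<n}. (\<lambda>w v. w (i # v)) -` {w. alive w t = {}} \<inter> space (tree_law \<mu> p)) =
      {w. \<forall>i<n. alive (\<lambda>v. w (i # v)) t = {}}"
    using False by (auto simp: space_tree_law)
  ultimately show ?thesis by simp
qed

text \<open>The ancestor must die at some time \<open>y \<le> t\<close>, and the subtrees of its children must be extinct after the
  remaining time \<open>t - y\<close>. The life length and the offspring number of the ancestor are
  independent of the other labels, so Fubini's theorem averages \<open>e (t - y) ^ n\<close> over them, and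
  the average over \<open>n\<close> is the generating function.\<close>

lemma extinction_equation:
  assumes t: "0 \<le> t"
  shows "set_integrable lborel {0..t} (\<lambda>y. \<mu> * exp (- y * \<mu>) * pgf p (e (t - y)))"
    and "e t = (LINT y:{0..t}|lborel. \<mu> * exp (- y * \<mu>) * pgf p (e (t - y)))"
proof -
  let ?P = "tree_law \<mu> p" and ?N = "particle_law \<mu> p"
  let ?S = "PiM {[]} (\<lambda>_. ?N)" and ?R = "PiM (- {[]}) (\<lambda>_. ?N)"
  let ?root = "\<lambda>w :: tree. restrict w {[]}" and ?rest = "\<lambda>w :: tree. restrict w (- {[]})"
  define \<phi> where "\<phi> x = (fst (fst x []) \<le> t \<and>
      (\<forall>i<snd (fst x []). alive (\<lambda>v. snd x (i # v)) (t - fst (fst x [])) = {}))"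
    for x :: "tree \<times> tree"
  define g where "g x = indicat_real {..t} (fst x) * e (t - fst x) ^ snd x" for x :: "real \<times> nat"
  have "mono (\<lambda>y. e (max 0 y))" by (intro monoI e_mono) auto
  then have e_meas: "(\<lambda>y. e (max 0 y)) \<in> borel_measurable borel" by (rule borel_measurable_mono)
  have [measurable]: "(\<lambda>y. e (max 0 (t - y))) \<in> borel_measurable borel"
    by (rule measurable_compose[OF _ e_meas]) simp
  have "g = (\<lambda>x. indicator {..t} (fst x) * e (max 0 (t - fst x)) ^ snd x)"
    by (auto simp: indicator_def max_def g_def)
  also have "\<dots> \<in> borel_measurable (borel \<Otimes>\<^sub>M count_space (UNIV :: nat set))" by measurable
  finally have g_meas: "g \<in> borel_measurable ?N"
    by (simp cong: measurable_cong_sets[OF sets_particle_law refl])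
  have ind: "tree.indep_var ?S ?root ?R ?rest"
    using tree.indep_var_restrict[OF indep_particles, of "{[]}" "- {[]}"] by simp
  have root_rv: "?root \<in> ?P \<rightarrow>\<^sub>M ?S" using tree.indep_var_rv1[OF ind] .
  have rest_rv: "?rest \<in> ?P \<rightarrow>\<^sub>M ?R" using tree.indep_var_rv2[OF ind] .
  have root_law: "distr ?P ?N (\<lambda>w. w []) = ?N"
    unfolding tree_law_def by (rule distr_PiM_component) (auto intro: prob_particle_law)
  let ?D = "distr ?P ?S ?root" and ?E = "distr ?P ?R ?rest"
  have joint: "?D \<Otimes>\<^sub>M ?E = distr ?P (?S \<Otimes>\<^sub>M ?R) (\<lambda>w. (?root w, ?rest w))"
    using ind[unfolded tree.indep_var_distribution_eq] by simp
  interpret D: prob_space ?D by (rule tree.prob_space_distr[OF root_rv])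
  interpret E: prob_space ?E by (rule tree.prob_space_distr[OF rest_rv])
  interpret DE: pair_prob_space ?D ?E ..
  have root_comp[measurable]: "(\<lambda>x. fst x []) \<in> ?S \<Otimes>\<^sub>M ?R \<rightarrow>\<^sub>M ?N"
    by (rule measurable_compose[OF measurable_fst measurable_component_singleton]) simp
  have sub: "(\<lambda>x. \<lambda>v. snd x (i # v)) \<in> ?S \<Otimes>\<^sub>M ?R \<rightarrow>\<^sub>M ?P" for i
    by (rule measurable_compose[OF measurable_snd subtree_measurable']) auto
  have pred_i: "Measurable.pred (?S \<Otimes>\<^sub>M ?R) (\<lambda>x. alive (\<lambda>v. snd x (i # v)) (t - fst (fst x [])) = {})" for i
  proof -
    have "(\<lambda>x. (\<lambda>v. snd x (i # v), t - fst (fst x []))) \<in> ?S \<Otimes>\<^sub>M ?R \<rightarrow>\<^sub>M ?P \<Otimes>\<^sub>M borel"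
      by (intro measurable_Pair sub) measurable
    from measurable_compose[OF this measurable_extinct] show ?thesis by simp
  qed
  have phi[measurable]: "Measurable.pred (?S \<Otimes>\<^sub>M ?R) \<phi>"
  proof -
    have eq: "\<phi> = (\<lambda>x. fst (fst x []) \<le> t \<and>
        (\<forall>i. i < snd (fst x []) \<longrightarrow> alive (\<lambda>v. snd x (i # v)) (t - fst (fst x [])) = {}))"
      by (auto simp: \<phi>_def)
    show ?thesis unfolding eq
      by (intro pred_intros_countable pred_intros_logic pred_i) measurable
  qed
  have sets_DE: "sets (?D \<Otimes>\<^sub>M ?E) = sets (?S \<Otimes>\<^sub>M ?R)"
    by (intro sets_pair_measure_cong) auto
  let ?A = "{x \<in> space (?S \<Otimes>\<^sub>M ?R). \<phi> x}"
  have A: "?A \<in> sets (?S \<Otimes>\<^sub>M ?R)" by measurable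
  have A_iff: "(?root w, ?rest w) \<in> ?A \<longleftrightarrow> \<phi> (?root w, ?rest w)" for w
    using measurable_space[OF root_rv, of w] measurable_space[OF rest_rv, of w]
    by (auto simp: space_pair_measure space_tree_law)
  have "{w. alive w t = {}} = (\<lambda>w. (?root w, ?rest w)) -` ?A \<inter> space ?P"
    unfolding vimage_def A_iff using alive_empty_iff[OF t]
    by (auto simp: \<phi>_def space_tree_law)
  then have "e t = measure (distr ?P (?S \<Otimes>\<^sub>M ?R) (\<lambda>w. (?root w, ?rest w))) ?A"
    unfolding extinction_prob_def
    by (subst measure_distr[OF measurable_Pair[OF root_rv rest_rv] A]) simp
  also have "\<dots> = measure (?D \<Otimes>\<^sub>M ?E) ?A" by (simp add: joint)
  also have "\<dots> = (\<integral>x. indicator ?A x \<partial>(?D \<Otimes>\<^sub>M ?E))"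
    using A by (simp add: sets_DE Int_absorb2 space_pair_measure subset_eq)
  also have "\<dots> = (\<integral>x. (\<integral>y. indicator ?A (x, y) \<partial>?E) \<partial>?D)"
    using A by (intro DE.integral_fst'[symmetric] DE.integrable_const_bound[of _ 1])
      (auto simp: sets_DE cong: measurable_cong_sets)
  also have "\<dots> = (\<integral>x. g (x []) \<partial>?D)"
  proof (rule Bochner_Integration.integral_cong[OF refl])
    fix x assume "x \<in> space ?D"
    then have x: "x \<in> space ?S" by simp
    have "(\<lambda>y. (x, y)) \<in> ?R \<rightarrow>\<^sub>M ?S \<Otimes>\<^sub>M ?R" using x by simp
    then have "(\<lambda>y. indicat_real ?A (x, y)) \<in> borel_measurable ?R"
      by (rule measurable_compose) (use A in simp)
    then have "(\<integral>y. indicat_real ?A (x, y) \<partial>?E) = (\<integral>w. indicat_real ?A (x, ?rest w) \<partial>?P)"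
      by (rule integral_distr[OF rest_rv])
    also have "\<dots> = (\<integral>w. indicator {..t} (fst (x [])) *
        indicator {w. \<forall>i<snd (x []). alive (\<lambda>v. w (i # v)) (t - fst (x [])) = {}} w \<partial>?P)"
      using x measurable_space[OF rest_rv]
      by (intro Bochner_Integration.integral_cong) (auto simp: indicator_def \<phi>_def space_pair_measure)
    also have "\<dots> = indicator {..t} (fst (x [])) *
        tree.prob {w. \<forall>i<snd (x []). alive (\<lambda>v. w (i # v)) (t - fst (x [])) = {}}"
      by (simp add: space_tree_law)
    finally show "(\<integral>y. indicat_real ?A (x, y) \<partial>?E) = g (x [])"
      by (simp add: subtrees_extinct g_def)
  qed
  also have "\<dots> = (\<integral>w. g (w []) \<partial>?P)"
    by (subst integral_distr[OF root_rv]) (auto intro!: measurable_compose[OF _ g_meas])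
  also have "\<dots> = (\<integral>x. g x \<partial>distr ?P ?N (\<lambda>w. w []))"
    by (rule integral_distr[symmetric]) (use g_meas in auto)
  also have "\<dots> = (\<integral>x. g x \<partial>?N)" by (simp only: root_law)
  also have "\<dots> = (\<integral>y. (\<integral>n. indicator {..t} y * e (t - y) ^ n \<partial>measure_pmf p) \<partial>density lborel (exponential_density \<mu>))"
  proof -
    interpret X: prob_space "density lborel (exponential_density \<mu>)"
      by (rule prob_space_exponential_density[OF rate])
    interpret XM: pair_prob_space "density lborel (exponential_density \<mu>)" "measure_pmf p" ..
    have "integrable (density lborel (exponential_density \<mu>) \<Otimes>\<^sub>M measure_pmf p) g"
      using g_meas unfolding particle_law_def
      by (intro XM.integrable_const_bound[of _ 1])
         (use e_range in \<open>auto simp: g_def indicator_def power_le_one\<close>)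
    from XM.integral_fst'[OF this] show ?thesis by (simp add: particle_law_def g_def[abs_def])
  qed
  also have "\<dots> = (\<integral>y. indicator {..t} y * pgf p (e (t - y)) \<partial>density lborel (exponential_density \<mu>))"
    by (simp add: pgf_def)
  finally have e_eq: "e t = (\<integral>y. indicator {..t} y * pgf p (e (t - y)) \<partial>density lborel (exponential_density \<mu>))" .
  have "mono (\<lambda>y. pgf p (e (max 0 y)))" by (intro monoI pgf_mono e_mono e_range) auto
  then have pe_meas: "(\<lambda>y. pgf p (e (max 0 y))) \<in> borel_measurable borel" by (rule borel_measurable_mono)
  have [measurable]: "(\<lambda>y. pgf p (e (max 0 (t - y)))) \<in> borel_measurable borel"
    by (rule measurable_compose[OF _ pe_meas]) simp
  have "(\<lambda>y. indicat_real {..t} y * pgf p (e (t - y))) = (\<lambda>y. indicat_real {..t} y * pgf p (e (max 0 (t - y))))"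
    by (auto simp: indicator_def max_def)
  then have ipe: "(\<lambda>y. indicat_real {..t} y * pgf p (e (t - y))) \<in> borel_measurable borel" by simp
  have eqf: "(\<lambda>y. exponential_density \<mu> y *\<^sub>R (indicat_real {..t} y * pgf p (e (t - y)))) =
      (\<lambda>y. indicat_real {0..t} y *\<^sub>R (\<mu> * exp (- y * \<mu>) * pgf p (e (t - y))))"
    by (auto simp: exponential_density_def indicator_def)
  show "e t = (LINT y:{0..t}|lborel. \<mu> * exp (- y * \<mu>) * pgf p (e (t - y)))"
  proof -
    have "e t = (\<integral>y. exponential_density \<mu> y *\<^sub>R (indicat_real {..t} y * pgf p (e (t - y))) \<partial>lborel)"
      unfolding e_eq using ipe rate by (intro integral_density) (auto simp: exponential_density_nonneg)
    then show ?thesis by (simp only: eqf set_lebesgue_integral_def)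
  qed
  have "set_integrable lborel {0..t} (\<lambda>y. \<mu>)" by (intro borel_integrable_atLeastAtMost' continuous_intros)
  then show "set_integrable lborel {0..t} (\<lambda>y. \<mu> * exp (- y * \<mu>) * pgf p (e (t - y)))"
  proof (rule set_integrable_bound)
    have "(\<lambda>y. exponential_density \<mu> y *\<^sub>R (indicat_real {..t} y * pgf p (e (t - y)))) \<in> borel_measurable lborel"
      using ipe by simp
    then show "set_borel_measurable lborel {0..t} (\<lambda>y. \<mu> * exp (- y * \<mu>) * pgf p (e (t - y)))"
      by (simp only: eqf set_borel_measurable_def)
    have "norm (\<mu> * exp (- y * \<mu>) * pgf p (e (t - y))) \<le> norm \<mu>" if "y \<in> {0..t}" for y
    proof -
      have "exp (- y * \<mu>) * pgf p (e (t - y)) \<le> 1 * 1"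
        using that rate pgf_range[of "e (t - y)" p] e_range by (intro mult_mono) auto
      then show ?thesis using rate pgf_range[of "e (t - y)" p] e_range by (simp add: abs_mult mult.assoc)
    qed
    then show "AE y in lborel. y \<in> {0..t} \<longrightarrow> norm (\<mu> * exp (- y * \<mu>) * pgf p (e (t - y))) \<le> norm \<mu>"
      by auto
  qed
qed

end

context branching
begin

text \<open>After the substitution of \<open>t - y\<close> for \<open>y\<close> the variable \<open>t\<close> is only left in the limits of the integral and
  in a factor \<open>exp (- t * \<mu>)\<close>: the function \<open>\<Phi> t\<close> is \<open>exp (t * \<mu>) * e t\<close>. This makes \<open>e\<close> first continuous
  and then differentiable.\<close>

definition \<Phi> :: "real \<Rightarrow> real" where
  "\<Phi> t = (LINT y:{0..t}|lborel. \<mu> * exp (y * \<mu>) * pgf p (e y))"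

lemma e_eq_integral:
  assumes "0 \<le> t"
  shows "set_integrable lborel {0..t} (\<lambda>y. \<mu> * exp (y * \<mu>) * pgf p (e y))"
    and "e t = exp (- t * \<mu>) * \<Phi> t"
proof -
  have *: "\<mu> * exp (- (t - y) * \<mu>) * pgf p (e (t - (t - y))) =
      exp (- t * \<mu>) * (\<mu> * exp (y * \<mu>) * pgf p (e y))" for y
    by (simp add: algebra_simps exp_diff exp_minus field_simps)
  have "set_integrable lborel {0..t} (\<lambda>y. exp (- t * \<mu>) * (\<mu> * exp (y * \<mu>) * pgf p (e y)))"
    using extinction_equation(1)[OF assms]
    by (subst (asm) set_integral_reflect(2)[of _ _ _ t]) (simp only: * diff_self diff_zero)
  then show "set_integrable lborel {0..t} (\<lambda>y. \<mu> * exp (y * \<mu>) * pgf p (e y))" by simp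
  have "e t = (LINT y:{0..t}|lborel. exp (- t * \<mu>) * (\<mu> * exp (y * \<mu>) * pgf p (e y)))"
    using extinction_equation(2)[OF assms]
    by (subst (asm) set_integral_reflect(1)[of _ _ _ t]) (simp only: * diff_self diff_zero)
  then show "e t = exp (- t * \<mu>) * \<Phi> t" by (simp add: \<Phi>_def)
qed

lemma Phi_eq_HK: "0 \<le> t \<Longrightarrow> \<Phi> t = integral {0..t} (\<lambda>y. \<mu> * exp (y * \<mu>) * pgf p (e y))"
  unfolding \<Phi>_def by (intro set_borel_integral_eq_integral e_eq_integral)

lemma exp_integral:
  assumes "0 \<le> t"
  shows "set_integrable lborel {0..t} (\<lambda>y. \<mu> * exp (y * \<mu>))"
    and "(LINT y:{0..t}|lborel. \<mu> * exp (y * \<mu>)) = exp (t * \<mu>) - 1"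
proof -
  have "has_bochner_integral lborel (\<lambda>y. \<mu> * exp (y * \<mu>) * indicator {0..t} y) (exp (t * \<mu>) - exp (0 * \<mu>))"
    using assms by (intro has_bochner_integral_FTC_Icc_real) (auto intro!: derivative_eq_intros continuous_intros)
  moreover have "(\<lambda>y. \<mu> * exp (y * \<mu>) * indicator {0..t} y) = (\<lambda>y. indicat_real {0..t} y *\<^sub>R (\<mu> * exp (y * \<mu>)))"
    by (simp add: fun_eq_iff)
  ultimately have "has_bochner_integral lborel (\<lambda>y. indicat_real {0..t} y *\<^sub>R (\<mu> * exp (y * \<mu>))) (exp (t * \<mu>) - 1)"
    by simp
  then show "set_integrable lborel {0..t} (\<lambda>y. \<mu> * exp (y * \<mu>))"
    "(LINT y:{0..t}|lborel. \<mu> * exp (y * \<mu>)) = exp (t * \<mu>) - 1"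
    unfolding has_bochner_integral_iff set_integrable_def set_lebesgue_integral_def by auto
qed

text \<open>Strict inequality keeps \<open>e\<close> inside the disc of convergence, where generating functions are
  differentiable.\<close>

lemma e_less_1:
  assumes "0 \<le> t"
  shows "e t < 1"
proof -
  have "\<Phi> t \<le> (LINT y:{0..t}|lborel. \<mu> * exp (y * \<mu>))"
    unfolding \<Phi>_def
  proof (rule set_integral_mono)
    fix y
    show "\<mu> * exp (y * \<mu>) * pgf p (e y) \<le> \<mu> * exp (y * \<mu>)"
      using rate pgf_range[of "e y" p] e_range by simp
  qed (use assms in \<open>auto intro: e_eq_integral exp_integral\<close>)
  then have "e t \<le> exp (- t * \<mu>) * (exp (t * \<mu>) - 1)"
    using exp_integral[OF assms] e_eq_integral(2)[OF assms] by simp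
  also have "\<dots> < 1" by (simp add: right_diff_distrib exp_minus)
  finally show ?thesis .
qed

lemma e_continuous: "continuous_on {0..t} e"
proof (cases "0 \<le> t")
  case True
  have "continuous_on {0..t} (\<lambda>t. exp (- t * \<mu>) * integral {0..t} (\<lambda>y. \<mu> * exp (y * \<mu>) * pgf p (e y)))"
    using set_borel_integral_eq_integral(1)[OF e_eq_integral(1)[OF True]]
    by (intro continuous_intros indefinite_integral_continuous_1)
  then show ?thesis
    by (rule continuous_on_eq) (auto simp: e_eq_integral Phi_eq_HK)
qed simp

lemma pgf_isCont: "0 \<le> s \<Longrightarrow> s < 1 \<Longrightarrow> isCont (pgf h) s"
  using DERIV_isCont[OF pgf_has_derivative[of s h]] by simp

lemma pgf_e_continuous: "continuous_on {0..t} (\<lambda>s. pgf h (e s))"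
proof -
  have "continuous_on {0..<1} (pgf h)"
    by (intro continuous_at_imp_continuous_on ballI pgf_isCont) auto
  then show ?thesis
    by (rule continuous_on_compose2[OF _ e_continuous]) (auto simp: e_range e_less_1)
qed

text \<open>The backward equation for \<open>s = 0\<close>.\<close>

lemma e_deriv:
  assumes t: "0 < t"
  shows "(e has_real_derivative \<mu> * (pgf p (e t) - e t)) (at t)"
proof -
  have "((\<lambda>t. integral {0..t} (\<lambda>y. \<mu> * exp (y * \<mu>) * pgf p (e y))) has_real_derivative
      \<mu> * exp (t * \<mu>) * pgf p (e t)) (at t within {0..t + 1})"
    using t by (intro integral_has_real_derivative continuous_intros pgf_e_continuous) auto
  then have I: "((\<lambda>t. integral {0..t} (\<lambda>y. \<mu> * exp (y * \<mu>) * pgf p (e y))) has_real_derivative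
      \<mu> * exp (t * \<mu>) * pgf p (e t)) (at t)"
    using t by (simp add: at_within_Icc_at)
  have e_t: "e t = exp (- t * \<mu>) * integral {0..t} (\<lambda>y. \<mu> * exp (y * \<mu>) * pgf p (e y))"
    using t by (simp add: e_eq_integral Phi_eq_HK)
  have "((\<lambda>t. exp (- t * \<mu>) * integral {0..t} (\<lambda>y. \<mu> * exp (y * \<mu>) * pgf p (e y))) has_real_derivative
      exp (- t * \<mu>) * (\<mu> * exp (t * \<mu>) * pgf p (e t)) +
      (- \<mu> * exp (- t * \<mu>)) * integral {0..t} (\<lambda>y. \<mu> * exp (y * \<mu>) * pgf p (e y))) (at t)"
    by (rule DERIV_cong[OF DERIV_mult[OF _ I]]) (auto intro!: derivative_eq_intros)
  also have "exp (- t * \<mu>) * (\<mu> * exp (t * \<mu>) * pgf p (e t)) +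
      (- \<mu> * exp (- t * \<mu>)) * integral {0..t} (\<lambda>y. \<mu> * exp (y * \<mu>) * pgf p (e y)) = \<mu> * (pgf p (e t) - e t)"
    unfolding right_diff_distrib e_t[symmetric]
    by (subst (3) e_t) (simp add: exp_minus field_simps)
  finally have D: "((\<lambda>t. exp (- t * \<mu>) * integral {0..t} (\<lambda>y. \<mu> * exp (y * \<mu>) * pgf p (e y))) has_real_derivative
      \<mu> * (pgf p (e t) - e t)) (at t)" .
  have "\<forall>\<^sub>F x in nhds t. exp (- x * \<mu>) * integral {0..x} (\<lambda>y. \<mu> * exp (y * \<mu>) * pgf p (e y)) = e x"
    using eventually_nhds_in_open[of "{0<..}" t] t
    by (auto elim!: eventually_mono simp: e_eq_integral Phi_eq_HK)
  then show ?thesis using D by (subst (asm) DERIV_cong_ev[OF refl _ refl])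
qed

lemma decay_equation_survival:
  assumes "slowly_varying L" "0 < \<gamma>"
    and f: "\<And>s. 0 \<le> s \<Longrightarrow> s < 1 \<Longrightarrow> pgf p s = s + (1 - s) powr (\<gamma> + 1) * L (1 / (1 - s))"
  shows "decay_equation (\<lambda>x. pgf p (1 - x) - (1 - x)) (\<lambda>x. 1 - pgf_deriv p (1 - x)) (\<lambda>t. 1 - e t) \<mu> \<gamma> L"
proof
  show "0 < \<mu>" "0 < \<gamma>" "slowly_varying L" by (fact rate assms)+
  show "pgf p (1 - x) - (1 - x) = x powr (\<gamma> + 1) * L (1 / x)" if "0 < x" "x \<le> 1" for x
    using f[of "1 - x"] that by simp
  show "pgf p (1 - 0) - (1 - 0) = 0" by (simp add: pgf_1)
  show "((\<lambda>x. pgf p (1 - x) - (1 - x)) has_real_derivative 1 - pgf_deriv p (1 - x)) (at x)"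
    if "0 < x" "x \<le> 1" for x
  proof -
    have "((\<lambda>x. pgf p (1 - x)) has_real_derivative pgf_deriv p (1 - x) * (- 1)) (at x)"
      using that by (intro DERIV_chain2[OF pgf_has_derivative]) (auto intro!: derivative_eq_intros)
    then show ?thesis by (auto intro!: derivative_eq_intros)
  qed
  show "pgf p (1 - x) - (1 - x) + (1 - pgf_deriv p (1 - x)) * (y - x) \<le> pgf p (1 - y) - (1 - y)"
    if "0 < x" "x \<le> 1" "0 \<le> y" "y \<le> 1" for x y
    using pgf_above_tangent[of "1 - x" "1 - y" p] that by (simp add: algebra_simps)
  show "0 < 1 - e t \<and> 1 - e t \<le> 1" if "0 < t" for t
    using e_less_1[of t] e_range[of t] that by simp
  show "1 - e t \<le> 1 - e s" if "0 < s" "s \<le> t" for s t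
    using e_mono[of s t] that by simp
  show "((\<lambda>t. 1 - e t) has_real_derivative - \<mu> * (pgf p (1 - (1 - e t)) - (1 - (1 - e t)))) (at t)"
    if "0 < t" for t
    by (rule DERIV_cong[OF DERIV_diff[OF DERIV_const e_deriv[OF that]]]) simp
qed

end

lemma regular_kernel_q:
  assumes mu: "0 < \<mu>" and slow: "slowly_varying L" "slowly_varying l"
    and "0 < \<gamma>" "1 \<le> \<alpha> / \<gamma>"
    and f: "\<And>s. 0 \<le> s \<Longrightarrow> s < 1 \<Longrightarrow> pgf p s = s + (1 - s) powr (\<gamma> + 1) * L (1 / (1 - s))"
    and g: "\<And>s. 0 \<le> s \<Longrightarrow> s < 1 \<Longrightarrow> pgf h s = 1 - (1 - s) powr \<alpha> * l (1 / (1 - s))"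
  shows "regular_kernel (\<lambda>t. q_fun \<mu> p h t 0) (\<alpha> / \<gamma>)"
proof -
  interpret branching \<mu> p by standard (rule mu)
  interpret D: decay_equation "\<lambda>x. pgf p (1 - x) - (1 - x)" "\<lambda>x. 1 - pgf_deriv p (1 - x)" "\<lambda>t. 1 - e t" \<mu> \<gamma> L
    by (rule decay_equation_survival) fact+
  have q: "q_fun \<mu> p h t 0 = 1 - pgf h (e t)" for t by (simp add: q_fun_def population_pgf_0)
  show ?thesis
  proof
    show "0 \<le> q_fun \<mu> p h t 0" for t using pgf_range[of "e t" h] e_range[of t] by (simp add: q)
    have "continuous_on {0..t} (\<lambda>t. q_fun \<mu> p h t 0)" for t
      unfolding q by (intro continuous_intros pgf_e_continuous)
    then show "set_integrable lborel {0..t} (\<lambda>t. q_fun \<mu> p h t 0)" for t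
      unfolding set_integrable_def by (intro borel_integrable_compact) auto
    show "regularly_varying (- (\<alpha> / \<gamma>)) (\<lambda>t. q_fun \<mu> p h t 0)"
    proof (rule D.power_of_u_regularly_varying[OF slow(2)])
      show "q_fun \<mu> p h t 0 = (1 - e t) powr \<alpha> * l (1 / (1 - e t))" if "0 < t" for t
        using g[of "e t"] e_range[of t] e_less_1[of t] that by (simp add: q)
      show "q_fun \<mu> p h t 0 \<le> q_fun \<mu> p h s 0" if "0 < s" "s \<le> t" for s t
        using pgf_mono[OF e_range(1) e_mono e_range(2), of s t h] that by (simp add: q)
    qed
    show "1 \<le> \<alpha> / \<gamma>" by fact
  qed
qed

section \<open>Poisson arrivals\<close>

context prob_space
begin

lemma emeasure_eq_sum_over_values:
  fixes X :: "'a \<Rightarrow> 'x :: countable"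
  assumes X[measurable]: "X \<in> M \<rightarrow>\<^sub>M count_space UNIV" and E[measurable]: "E \<in> sets M"
  shows "emeasure M E = (\<integral>\<^sup>+x. emeasure M (E \<inter> {\<omega> \<in> space M. X \<omega> = x}) \<partial>count_space UNIV)"
proof -
  have "E = (\<Union>x\<in>UNIV. E \<inter> {\<omega> \<in> space M. X \<omega> = x})" using sets.sets_into_space[OF E] by auto
  then show ?thesis
    by (subst (1) \<open>E = _\<close>, intro emeasure_UN_countable) (auto simp: disjoint_family_on_def)
qed

lemma nn_integral_eq_sum_over_values:
  fixes X :: "'a \<Rightarrow> 'x :: countable"
  assumes X[measurable]: "X \<in> M \<rightarrow>\<^sub>M count_space UNIV"
  shows "(\<integral>\<^sup>+\<omega>. c (X \<omega>) \<partial>M) = (\<integral>\<^sup>+x. c x * emeasure M {\<omega> \<in> space M. X \<omega> = x} \<partial>count_space UNIV)"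
proof -
  let ?D = "density M (\<lambda>\<omega>. c (X \<omega>))"
  have [measurable]: "(\<lambda>\<omega>. c (X \<omega>)) \<in> borel_measurable M"
    by (rule measurable_compose[OF X]) simp
  have "(\<integral>\<^sup>+\<omega>. c (X \<omega>) \<partial>M) = emeasure ?D (space M)"
    by (subst emeasure_density) (auto intro!: nn_integral_cong)
  also have "space M = (\<Union>x. {\<omega> \<in> space M. X \<omega> = x})" by auto
  also have "emeasure ?D \<dots> = (\<integral>\<^sup>+x. emeasure ?D {\<omega> \<in> space M. X \<omega> = x} \<partial>count_space UNIV)"
    by (intro emeasure_UN_countable) (auto simp: disjoint_family_on_def)
  also have "\<dots> = (\<integral>\<^sup>+x. c x * emeasure M {\<omega> \<in> space M. X \<omega> = x} \<partial>count_space UNIV)"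
  proof (rule nn_integral_cong)
    fix x
    have "emeasure ?D {\<omega> \<in> space M. X \<omega> = x} = (\<integral>\<^sup>+\<omega>. c x * indicator {\<omega> \<in> space M. X \<omega> = x} \<omega> \<partial>M)"
      by (subst emeasure_density) (auto intro!: nn_integral_cong simp: indicator_def)
    then show "emeasure ?D {\<omega> \<in> space M. X \<omega> = x} = c x * emeasure M {\<omega> \<in> space M. X \<omega> = x}"
      by (simp add: nn_integral_cmult_indicator)
  qed
  finally show ?thesis .
qed

end

context poisson_process
begin

lemma jump_le_Suc:
  assumes "\<omega> \<in> space M"
  shows "S k \<omega> \<le> S (Suc k) \<omega>"
proof (cases "S k \<omega> = \<infinity>")
  case True
  then show ?thesis using jump_infinity[OF assms, of k] by simp
next
  case False
  then have "S k \<omega> < \<infinity>" by simp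
  then show ?thesis by (rule less_imp_le[OF jump_less[OF assms]])
qed

lemma jump_mono: "\<omega> \<in> space M \<Longrightarrow> j \<le> k \<Longrightarrow> S j \<omega> \<le> S k \<omega>"
  by (rule lift_Suc_mono_le[of "\<lambda>k. S k \<omega>"]) (rule jump_le_Suc)

lemma jump_pos:
  assumes "\<omega> \<in> space M" "1 \<le> k"
  shows "0 < S k \<omega>"
proof -
  have "0 < S (Suc 0) \<omega>" using jump_less[OF assms(1), of 0] jump_0[OF assms(1)] by simp
  also have "\<dots> \<le> S k \<omega>" using jump_mono[OF assms(1), of "Suc 0" k] assms(2) by simp
  finally show ?thesis .
qed

text \<open>The jump times are strictly increasing as long as they are finite, so the indices of the jumps up to
  time \<open>t\<close> form an initial segment. This translates statements about jump times into statements
  about the counting process, whose law is the one that is given.\<close>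

lemma jump_le_iff:
  assumes "\<omega> \<in> space M" "1 \<le> k"
  shows "S k \<omega> \<le> ereal t \<longleftrightarrow> k \<le> arrivals S t \<omega>"
proof -
  let ?D = "{k. 1 \<le> k \<and> S k \<omega> \<le> ereal t}"
  have fin: "finite ?D" using finite_jumps assms by blast
  have "\<exists>m. ?D = {1..m}"
  proof (cases "?D = {}")
    case False
    have "?D = {1..Max ?D}"
    proof (intro equalityI subsetI)
      fix j assume "j \<in> ?D"
      then show "j \<in> {1..Max ?D}" using Max_ge[OF fin] by auto
    next
      fix j assume j: "j \<in> {1..Max ?D}"
      have "Max ?D \<in> ?D" using Max_in[OF fin False] .
      then have "S (Max ?D) \<omega> \<le> ereal t" by simp
      moreover have "S j \<omega> \<le> S (Max ?D) \<omega>" using j by (intro jump_mono[OF assms(1)]) simp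
      ultimately show "j \<in> ?D" using j by (simp add: order_trans)
    qed
    then show ?thesis by (rule exI)
  next
    case True
    then have "?D = {1..0}" by simp
    then show ?thesis by (rule exI)
  qed
  then obtain m where m: "?D = {1..m}" by (rule exE)
  have "arrivals S t \<omega> = m" unfolding arrivals_def m by simp
  moreover have "k \<in> ?D \<longleftrightarrow> k \<in> {1..m}" by (simp only: m)
  ultimately show ?thesis using assms(2) by simp
qed

lemma arrivals_mono:
  assumes "\<omega> \<in> space M" "s \<le> t"
  shows "arrivals S s \<omega> \<le> arrivals S t \<omega>"
  unfolding arrivals_def using assms finite_jumps[OF assms(1), of t]
proof (intro card_mono subsetI)
  fix k assume "k \<in> {k. 1 \<le> k \<and> S k \<omega> \<le> ereal s}"
  then show "k \<in> {k. 1 \<le> k \<and> S k \<omega> \<le> ereal t}"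
    using order_trans[of "S k \<omega>" "ereal s" "ereal t"] assms(2) by simp
qed

lemma arrivals_0:
  assumes "\<omega> \<in> space M"
  shows "arrivals S 0 \<omega> = 0"
proof -
  have "{k. 1 \<le> k \<and> S k \<omega> \<le> ereal 0} = {}"
    using jump_pos[OF assms] by (simp add: zero_ereal_def[symmetric] not_le[symmetric])
  then show ?thesis by (simp only: arrivals_def card.empty)
qed

lemma jump_measurable:
  assumes k: "1 \<le> k"
  shows "S k \<in> borel_measurable M"
proof (rule borel_measurableI_le)
  fix y :: ereal
  show "{\<omega> \<in> space M. S k \<omega> \<le> y} \<in> sets M"
  proof (cases "0 \<le> y")
    case False
    then have "{\<omega> \<in> space M. S k \<omega> \<le> y} = {}"
      using less_le_trans[OF jump_pos[OF _ k]] by (blast intro: less_imp_le)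
    then show ?thesis by (simp only: sets.empty_sets)
  next
    case True
    show ?thesis
    proof (cases y)
      case (real c)
      then have "0 \<le> c" using True by simp
      have "{\<omega> \<in> space M. S k \<omega> \<le> y} = {\<omega> \<in> space M. k \<le> arrivals S c \<omega>}"
        using jump_le_iff[OF _ k] real by auto
      also have "\<dots> \<in> sets M" using arrivals_measurable[OF \<open>0 \<le> c\<close>] by measurable
      finally show ?thesis .
    qed (use True in auto)
  qed
qed

text \<open>The generating function of a Poisson variable.\<close>

lemma nn_integral_power_increment:
  assumes "0 \<le> s" "s \<le> t" "0 \<le> z"
  shows "(\<integral>\<^sup>+\<omega>. ennreal (z ^ (arrivals S t \<omega> - arrivals S s \<omega>)) \<partial>M) =
    ennreal (exp (- (mean_measure r t - mean_measure r s) * (1 - z)))"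
proof -
  define \<Lambda> where "\<Lambda> = mean_measure r t - mean_measure r s"
  have [measurable]: "(\<lambda>\<omega>. arrivals S t \<omega> - arrivals S s \<omega>) \<in> M \<rightarrow>\<^sub>M count_space UNIV"
    using arrivals_measurable[OF assms(1)] arrivals_measurable[OF order_trans[OF assms(1,2)]]
    by measurable
  have "(\<integral>\<^sup>+\<omega>. ennreal (z ^ (arrivals S t \<omega> - arrivals S s \<omega>)) \<partial>M) =
      (\<integral>\<^sup>+n. ennreal (z ^ n) * emeasure M {\<omega> \<in> space M. arrivals S t \<omega> - arrivals S s \<omega> = n} \<partial>count_space UNIV)"
    by (rule nn_integral_eq_sum_over_values) simp
  also have "\<dots> = (\<integral>\<^sup>+n. ennreal (z ^ n * (\<Lambda> ^ n / fact n * exp (- \<Lambda>))) \<partial>count_space UNIV)"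
    unfolding emeasure_eq_measure increments_poisson[OF assms(1,2)] \<Lambda>_def
    using assms(3) by (intro nn_integral_cong ennreal_mult'[symmetric]) simp
  also have "\<dots> = (\<Sum>n. ennreal (z ^ n * (\<Lambda> ^ n / fact n * exp (- \<Lambda>))))"
    by (rule nn_integral_count_space_nat)
  also have "\<dots> = ennreal (exp (- \<Lambda> * (1 - z)))"
  proof (rule suminf_ennreal_eq)
    fix n
    have "0 \<le> prob {\<omega> \<in> space M. arrivals S t \<omega> - arrivals S s \<omega> = n}" by simp
    then have "0 \<le> \<Lambda> ^ n / fact n * exp (- \<Lambda>)"
      unfolding increments_poisson[OF assms(1,2)] \<Lambda>_def .
    then show "0 \<le> z ^ n * (\<Lambda> ^ n / fact n * exp (- \<Lambda>))"
      by (rule mult_nonneg_nonneg[OF zero_le_power[OF assms(3)]])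
  next
    have "(\<lambda>n. exp (- \<Lambda>) * ((z * \<Lambda>) ^ n /\<^sub>R fact n)) sums (exp (- \<Lambda>) * exp (z * \<Lambda>))"
      by (intro sums_mult exp_converges)
    also have "(\<lambda>n. exp (- \<Lambda>) * ((z * \<Lambda>) ^ n /\<^sub>R fact n)) = (\<lambda>n. z ^ n * (\<Lambda> ^ n / fact n * exp (- \<Lambda>)))"
      by (simp add: power_mult_distrib divide_inverse mult_ac)
    also have "exp (- \<Lambda>) * exp (z * \<Lambda>) = exp (- \<Lambda> * (1 - z))"
      by (simp add: mult_exp_exp algebra_simps)
    finally show "(\<lambda>n. z ^ n * (\<Lambda> ^ n / fact n * exp (- \<Lambda>))) sums exp (- \<Lambda> * (1 - z))" .
  qed
  finally show ?thesis by (simp add: \<Lambda>_def)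
qed

lemma nn_integral_prod_increments:
  assumes "0 \<le> \<tau> 0" "mono \<tau>" and z: "\<And>i. 0 \<le> z i"
  shows "(\<integral>\<^sup>+\<omega>. ennreal (\<Prod>i<n. z i ^ (arrivals S (\<tau> (Suc i)) \<omega> - arrivals S (\<tau> i) \<omega>)) \<partial>M) =
    ennreal (exp (- (\<Sum>i<n. (mean_measure r (\<tau> (Suc i)) - mean_measure r (\<tau> i)) * (1 - z i))))"
proof -
  have tau: "0 \<le> \<tau> i" "\<tau> i \<le> \<tau> (Suc i)" for i
    using assms(1) monoD[OF assms(2), of 0 i] monoD[OF assms(2), of i "Suc i"] by auto
  have "indep_vars (\<lambda>_. borel)
      (\<lambda>i \<omega>. ennreal (z i ^ (arrivals S (\<tau> (Suc i)) \<omega> - arrivals S (\<tau> i) \<omega>))) {..<n}"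
    by (rule indep_vars_compose2[OF increments_indep[OF assms(1,2)]]) simp
  then have "(\<integral>\<^sup>+\<omega>. (\<Prod>i<n. ennreal (z i ^ (arrivals S (\<tau> (Suc i)) \<omega> - arrivals S (\<tau> i) \<omega>))) \<partial>M) =
      (\<Prod>i<n. \<integral>\<^sup>+\<omega>. ennreal (z i ^ (arrivals S (\<tau> (Suc i)) \<omega> - arrivals S (\<tau> i) \<omega>)) \<partial>M)"
    by (intro indep_vars_nn_integral) auto
  also have "\<dots> = (\<Prod>i<n. ennreal (exp (- (mean_measure r (\<tau> (Suc i)) - mean_measure r (\<tau> i)) * (1 - z i))))"
    using tau z by (intro prod.cong refl nn_integral_power_increment)
  also have "\<dots> = ennreal (\<Prod>i<n. exp (- (mean_measure r (\<tau> (Suc i)) - mean_measure r (\<tau> i)) * (1 - z i)))"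
    by (rule prod_ennreal) simp
  also have "(\<Prod>i<n. exp (- (mean_measure r (\<tau> (Suc i)) - mean_measure r (\<tau> i)) * (1 - z i))) =
      exp (\<Sum>i<n. - (mean_measure r (\<tau> (Suc i)) - mean_measure r (\<tau> i)) * (1 - z i))"
    by (rule exp_sum[symmetric]) simp
  also have "(\<Sum>i<n. - (mean_measure r (\<tau> (Suc i)) - mean_measure r (\<tau> i)) * (1 - z i)) =
      - (\<Sum>i<n. (mean_measure r (\<tau> (Suc i)) - mean_measure r (\<tau> i)) * (1 - z i))"
    by (simp only: mult_minus_left sum_negf)
  finally show ?thesis using z by (simp add: prod_ennreal)
qed

end

section \<open>The probability that no individual is present\<close>

context branching_poisson_immigration
begin

interpretation branching \<mu> p by standard (rule rate_pos)

text \<open>The argument \<open>s\<close> is the age of the group, that is, the time since its arrival.\<close>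

definition group_extinct :: "nat \<Rightarrow> real \<Rightarrow> 'a set" where
  "group_extinct k s = {\<omega> \<in> space M. \<forall>j\<in>{1..I k \<omega>}. alive (T k j \<omega>) s = {}}"

text \<open>The sources of randomness in independent blocks: block 0 is the arrival process, block \<open>k\<close> is
  everything that concerns the \<open>k\<close>-th group.\<close>

definition sources_of :: "nat \<Rightarrow> source set" where
  "sources_of k = (if k = 0 then {Arrivals} else insert (Group k) {Tree k j | j. 1 \<le> j})"

abbreviation "source_algebra k \<equiv>
  sigma_sets (space M) (\<Union>i\<in>sources_of k. source_events M S I T \<mu> p i)"

lemma tree_event: "{\<omega> \<in> space M. alive (T k j \<omega>) s = {}} \<in> source_events M S I T \<mu> p (Tree k j)"
proof -
  have "{\<omega> \<in> space M. alive (T k j \<omega>) s = {}} = T k j -` {w. alive w s = {}} \<inter> space M" by auto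
  moreover have "{w. alive w s = {}} \<in> sets (tree_law \<mu> p)" by (rule extinct_event)
  ultimately show ?thesis unfolding source_events.simps by blast
qed

lemma group_event: "{\<omega> \<in> space M. I k \<omega> = n} \<in> source_events M S I T \<mu> p (Group k)"
proof -
  have "{\<omega> \<in> space M. I k \<omega> = n} = I k -` {n} \<inter> space M" by auto
  then show ?thesis unfolding source_events.simps by blast
qed

lemma source_events_subset: "source_events M S I T \<mu> p i \<subseteq> Pow (space M)"
proof (cases i)
  case Arrivals
  have "sigma_sets (space M) {arrivals S t -` A \<inter> space M | t A. 0 \<le> t} \<subseteq> Pow (space M)"
    by (rule subsetI, rule PowI, erule sigma_sets_into_sp[rotated]) auto
  then show ?thesis unfolding Arrivals source_events.simps .
qed auto

lemma source_events_Int_stable: "Int_stable (source_events M S I T \<mu> p i)"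
proof (cases i)
  case (Tree k j)
  show ?thesis unfolding Tree source_events.simps
  proof (rule Int_stableI, safe)
    fix A B assume "A \<in> sets (tree_law \<mu> p)" "B \<in> sets (tree_law \<mu> p)"
    then show "\<exists>C. (T k j -` A \<inter> space M) \<inter> (T k j -` B \<inter> space M) = T k j -` C \<inter> space M \<and> C \<in> sets (tree_law \<mu> p)"
      by (intro exI[of _ "A \<inter> B"]) auto
  qed
next
  case (Group k)
  show ?thesis unfolding Group source_events.simps
  proof (rule Int_stableI, safe)
    fix A B
    show "\<exists>C. (I k -` A \<inter> space M) \<inter> (I k -` B \<inter> space M) = I k -` C \<inter> space M \<and> True"
      by (intro exI[of _ "A \<inter> B"]) auto
  qed
next
  case Arrivals
  interpret sigma_algebra "space M" "sigma_sets (space M) {arrivals S t -` A \<inter> space M | t A. 0 \<le> t}"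
    by (rule sigma_algebra_sigma_sets) auto
  show ?thesis unfolding Arrivals source_events.simps by (rule Int_stableI) (rule Int)
qed

lemma source_algebras_indep: "indep_sets source_algebra UNIV"
proof (rule indep_sets_collect_sigma)
  have "(\<Union>k. sources_of k) \<subseteq> {Tree k j | k j. 1 \<le> k \<and> 1 \<le> j} \<union> {Group k | k. 1 \<le> k} \<union> {Arrivals}"
    by (auto simp: sources_of_def split: if_splits)
  then show "indep_sets (source_events M S I T \<mu> p) (\<Union>k. sources_of k)"
    using sources_indep by (rule indep_sets_mono_index)
  show "disjoint_family sources_of"
    by (auto simp: disjoint_family_on_def sources_of_def)
qed (rule source_events_Int_stable)

text \<open>The group is decomposed according to its size \<open>n\<close>.\<close>

lemma group_extinct_split:
  fixes s :: real
  assumes k: "1 \<le> k"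
  defines "E \<equiv> \<lambda>n. {\<omega> \<in> space M. I k \<omega> = n} \<inter> (\<Inter>j\<in>{1..n}. {\<omega> \<in> space M. alive (T k j \<omega>) s = {}})"
  shows "group_extinct k s = (\<Union>n. E n)" and "E n \<in> source_algebra k"
    and "prob (E n) = pmf h n * e s ^ n" and "disjoint_family E"
proof -
  let ?Tr = "\<lambda>j. {\<omega> \<in> space M. alive (T k j \<omega>) s = {}}" and ?Gr = "\<lambda>n. {\<omega> \<in> space M. I k \<omega> = n}"
  show "group_extinct k s = (\<Union>n. E n)" by (auto simp: E_def group_extinct_def)
  show "disjoint_family E" by (auto simp: disjoint_family_on_def E_def)
  have sub: "(\<Union>i\<in>sources_of k. source_events M S I T \<mu> p i) \<subseteq> Pow (space M)"
    using source_events_subset by blast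
  interpret A: sigma_algebra "space M" "source_algebra k"
    by (rule sigma_algebra_sigma_sets[OF sub])
  have tr: "?Tr j \<in> source_algebra k" if "1 \<le> j" for j
    by (rule sigma_sets.Basic, rule UN_I[of "Tree k j"])
       (use that k in \<open>simp_all only: tree_event\<close>, simp add: sources_of_def)
  have gr: "?Gr n \<in> source_algebra k" for n
    by (rule sigma_sets.Basic, rule UN_I[of "Group k"])
       (use k in \<open>simp_all only: group_event\<close>, simp add: sources_of_def)
  have eq: "E n = (if n = 0 then ?Gr n else ?Gr n \<inter> (\<Inter>j\<in>{1..n}. ?Tr j))" by (auto simp: E_def)
  show "E n \<in> source_algebra k"
  proof (cases "n = 0")
    case False
    have "(\<Inter>j\<in>{1..n}. ?Tr j) \<in> source_algebra k"
      using False tr by (intro A.finite_INT) auto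
    with gr[of n] have "?Gr n \<inter> (\<Inter>j\<in>{1..n}. ?Tr j) \<in> source_algebra k" by (rule A.Int)
    then show ?thesis unfolding E_def .
  next
    case True
    then have "E n = ?Gr n" by (subst eq) simp
    then show ?thesis using gr[of n] by (simp only:)
  qed
  have "prob (E n) = prob (\<Inter>i\<in>insert (Group k) (Tree k ` {1..n}). case i of Group _ \<Rightarrow> ?Gr n | Tree _ j \<Rightarrow> ?Tr j)"
    by (rule arg_cong[where f = prob]) (auto simp: E_def)
  also have "\<dots> = (\<Prod>i\<in>insert (Group k) (Tree k ` {1..n}). prob (case i of Group _ \<Rightarrow> ?Gr n | Tree _ j \<Rightarrow> ?Tr j))"
  proof (intro indep_setsD[OF sources_indep] ballI)
    fix i assume "i \<in> insert (Group k) (Tree k ` {1..n})"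
    then consider "i = Group k" | j where "i = Tree k j" by blast
    then show "(case i of Group _ \<Rightarrow> ?Gr n | Tree _ j \<Rightarrow> ?Tr j) \<in> source_events M S I T \<mu> p i"
      by cases (simp_all only: source.case group_event tree_event)
  qed (use k in auto)
  also have "\<dots> = prob (?Gr n) * (\<Prod>j\<in>{1..n}. prob (?Tr j))"
    by (subst prod.insert) (auto simp: prod.reindex inj_on_def)
  also have "prob (?Gr n) = pmf h n"
  proof -
    have "prob (?Gr n) = measure (distr M (count_space UNIV) (I k)) {n}"
      by (subst measure_distr[OF group_measurable[OF k]]) (auto simp: vimage_def Int_def conj_commute)
    then show ?thesis by (simp add: group_law[OF k] pmf.rep_eq)
  qed
  also have "(\<Prod>j\<in>{1..n}. prob (?Tr j)) = (\<Prod>j\<in>{1..n}. e s)"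
  proof (rule prod.cong[OF refl])
    fix j assume "j \<in> {1..n}"
    then have j: "1 \<le> j" by simp
    have "prob (?Tr j) = measure (distr M (tree_law \<mu> p) (T k j)) {w. alive w s = {}}"
      by (subst measure_distr[OF tree_measurable[OF k j]]) (auto simp: vimage_def Int_def conj_commute)
    then show "prob (?Tr j) = e s" by (simp add: tree_distr[OF k j] extinction_prob_def)
  qed
  finally show "prob (E n) = pmf h n * e s ^ n" by simp
qed

lemma group_extinct_algebra:
  assumes k: "1 \<le> k"
  shows "group_extinct k s \<in> source_algebra k"
  unfolding group_extinct_split(1)[OF k]
  by (rule sigma_sets.Union) (rule group_extinct_split(2)[OF k])

lemma source_algebra_events: "source_algebra k \<subseteq> events"
  using source_algebras_indep unfolding indep_sets_def by blast

lemma prob_group_extinct: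
  assumes k: "1 \<le> k"
  shows "prob (group_extinct k s) = pgf h (e s)"
proof -
  let ?E = "\<lambda>n. {\<omega> \<in> space M. I k \<omega> = n} \<inter> (\<Inter>j\<in>{1..n}. {\<omega> \<in> space M. alive (T k j \<omega>) s = {}})"
  have "(\<lambda>n. prob (?E n)) sums prob (\<Union>n. ?E n)"
    using source_algebra_events[of k] group_extinct_split(2,4)[OF k, where s = s]
    by (intro finite_measure_UNION) auto
  then have "(\<lambda>n. pmf h n * e s ^ n) sums prob (group_extinct k s)"
    by (simp only: group_extinct_split(1,3)[OF k])
  then show ?thesis using pgf_eq_powser(2)[of "e s" h] e_range[of s] by (simp add: sums_iff)
qed

text \<open>The ages \<open>\<sigma> k\<close> are deterministic. This is enough because the arrival times only enter through the cell of a
  grid in which they lie.\<close>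

lemma prob_arrivals_and_groups:
  assumes A: "A \<in> source_algebra 0" and K: "finite K" "K \<subseteq> {1..}"
  shows "prob (A \<inter> {\<omega> \<in> space M. \<forall>k\<in>K. \<omega> \<in> group_extinct k (\<sigma> k)}) = prob A * (\<Prod>k\<in>K. pgf h (e (\<sigma> k)))"
proof -
  have "A \<subseteq> space M" using A source_algebra_events[of 0] sets.sets_into_space by blast
  have "prob (\<Inter>k\<in>insert 0 K. if k = 0 then A else group_extinct k (\<sigma> k)) =
      (\<Prod>k\<in>insert 0 K. prob (if k = 0 then A else group_extinct k (\<sigma> k)))"
    using A K group_extinct_algebra by (intro indep_setsD[OF source_algebras_indep]) auto
  moreover have "(\<Inter>k\<in>insert 0 K. if k = 0 then A else group_extinct k (\<sigma> k)) =
      A \<inter> {\<omega> \<in> space M. \<forall>k\<in>K. \<omega> \<in> group_extinct k (\<sigma> k)}"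
    using K(2) \<open>A \<subseteq> space M\<close> by auto
  moreover have "(\<Prod>k\<in>insert 0 K. prob (if k = 0 then A else group_extinct k (\<sigma> k))) =
      prob A * (\<Prod>k\<in>K. pgf h (e (\<sigma> k)))"
    using K by (subst prod.insert) (auto intro!: prod.cong prob_group_extinct)
  ultimately show ?thesis by simp
qed

lemma arrivals_event:
  assumes "0 \<le> t"
  shows "{\<omega> \<in> space M. arrivals S t \<omega> = n} \<in> source_algebra 0"
proof -
  have "{\<omega> \<in> space M. arrivals S t \<omega> = n} = arrivals S t -` {n} \<inter> space M" by auto
  also have "\<dots> \<in> source_events M S I T \<mu> p Arrivals"
    unfolding source_events.simps by (rule sigma_sets.Basic) (use assms in blast)
  finally show ?thesis by (intro sigma_sets.Basic) (simp add: sources_of_def)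
qed

lemma group_extinct_mono: "0 \<le> s \<Longrightarrow> s \<le> t \<Longrightarrow> group_extinct k s \<subseteq> group_extinct k t"
  unfolding group_extinct_def using extinction_persists by blast

text \<open>Every group that arrives in the \<open>i\<close>-th cell \<open>{\<tau> i<..\<tau> (Suc i)}\<close> is extinct at age \<open>s i\<close>. The groups
  of a cell are identified by the numbers of arrivals, so that no jump time occurs.\<close>

definition extinct_on_grid :: "(nat \<Rightarrow> real) \<Rightarrow> nat \<Rightarrow> (nat \<Rightarrow> real) \<Rightarrow> 'a set" where
  "extinct_on_grid \<tau> n s = {\<omega> \<in> space M. \<forall>i<n. \<forall>k\<in>{arrivals S (\<tau> i) \<omega><..arrivals S (\<tau> (Suc i)) \<omega>}.
     \<omega> \<in> group_extinct k (s i)}"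

lemma extinct_on_grid_event:
  assumes "0 \<le> \<tau> 0" "mono \<tau>"
  shows "extinct_on_grid \<tau> n s \<in> events"
proof -
  have tau: "0 \<le> \<tau> i" for i using assms(1) monoD[OF assms(2), of 0 i] by auto
  note [measurable] = arrivals_measurable[OF tau]
  define B where "B k t = (if 1 \<le> k then group_extinct k t else space M)" for k t
  have [measurable]: "B k t \<in> events" for k t
    using group_extinct_algebra[of k t] source_algebra_events[of k] by (simp add: B_def subset_eq)
  have "extinct_on_grid \<tau> n s = {\<omega> \<in> space M. \<forall>i. i < n \<longrightarrow> (\<forall>k. arrivals S (\<tau> i) \<omega> < k \<longrightarrow>
     k \<le> arrivals S (\<tau> (Suc i)) \<omega> \<longrightarrow> \<omega> \<in> B k (s i))}"
    by (auto simp: extinct_on_grid_def B_def)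
  also have "\<dots> \<in> events" by measurable
  finally show ?thesis .
qed

text \<open>Given the numbers of arrivals at the grid points, the groups and their ages are determined, and the
  conditional probability is a product of powers of \<open>pgf h (e (s i))\<close>. Its mean is the joint generating
  function of the independent Poisson increments.\<close>

lemma prob_extinct_on_grid:
  assumes "0 \<le> \<tau> 0" "mono \<tau>"
  shows "prob (extinct_on_grid \<tau> n s) =
    exp (- (\<Sum>i<n. (mean_measure r (\<tau> (Suc i)) - mean_measure r (\<tau> i)) * (1 - pgf h (e (s i)))))"
proof -
  have tau: "0 \<le> \<tau> i" "i \<le> j \<Longrightarrow> \<tau> i \<le> \<tau> j" for i j
    using assms(1) monoD[OF assms(2), of 0 i] monoD[OF assms(2), of i j] by auto
  note [measurable] = arrivals_measurable[OF tau(1)]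
  \<comment> \<open>The counts form a list, hence a variable with countably many values, over which one can sum.\<close>
  define X where "X \<omega> = map (\<lambda>i. arrivals S (\<tau> i) \<omega>) [0..<Suc n]" for \<omega>
  define c where "c x = (\<Prod>i<n. pgf h (e (s i)) ^ (x ! Suc i - x ! i))" for x :: "nat list"
  have X_nth: "X \<omega> ! i = arrivals S (\<tau> i) \<omega>" if "i \<le> n" for i \<omega>
    using that unfolding X_def by (subst nth_map) (auto simp del: upt_Suc)
  have X_eq: "X \<omega> = x \<longleftrightarrow> length x = Suc n \<and> (\<forall>i\<le>n. arrivals S (\<tau> i) \<omega> = x ! i)" for x \<omega>
  proof -
    have "length (X \<omega>) = Suc n" by (simp add: X_def)
    then show ?thesis using X_nth by (auto simp: list_eq_iff_nth_eq less_Suc_eq_le)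
  qed
  have X_ev: "{\<omega> \<in> space M. X \<omega> = x} \<in> source_algebra 0" for x
  proof (cases "length x = Suc n")
    case False
    then show ?thesis by (auto simp: X_eq intro: sigma_sets.Empty)
  next
    case True
    have sub: "(\<Union>i\<in>sources_of 0. source_events M S I T \<mu> p i) \<subseteq> Pow (space M)"
      using source_events_subset by blast
    interpret A: sigma_algebra "space M" "source_algebra 0" by (rule sigma_algebra_sigma_sets[OF sub])
    have "{\<omega> \<in> space M. X \<omega> = x} = (\<Inter>i\<in>{..n}. {\<omega> \<in> space M. arrivals S (\<tau> i) \<omega> = x ! i})"
      using True by (auto simp: X_eq)
    also have "\<dots> \<in> source_algebra 0" using tau by (intro A.finite_INT arrivals_event) auto
    finally show ?thesis .
  qed
  have X_meas: "X \<in> M \<rightarrow>\<^sub>M count_space UNIV"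
  proof (rule measurable_count_space_eq2_countable[THEN iffD2], intro conjI ballI)
    show "X \<in> space M \<rightarrow> UNIV" by simp
    fix x
    have "X -` {x} \<inter> space M = {\<omega> \<in> space M. X \<omega> = x}" by auto
    then show "X -` {x} \<inter> space M \<in> sets M" using X_ev[of x] source_algebra_events[of 0] by auto
  qed
  have grid: "extinct_on_grid \<tau> n s \<in> events" by (rule extinct_on_grid_event[OF assms])
  have cell: "emeasure M (extinct_on_grid \<tau> n s \<inter> {\<omega> \<in> space M. X \<omega> = x}) =
      ennreal (c x) * emeasure M {\<omega> \<in> space M. X \<omega> = x}" for x
  proof (cases "{\<omega> \<in> space M. X \<omega> = x} = {}")
    case True
    then show ?thesis by (simp only: Int_empty_right emeasure_empty mult_zero_right)
  next
    case False
    then obtain \<omega>0 where w0: "\<omega>0 \<in> space M" "X \<omega>0 = x" by auto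
    have x_mono: "x ! i \<le> x ! j" if "i \<le> j" "j \<le> n" for i j
      using w0 X_nth[of i \<omega>0] X_nth[of j \<omega>0] arrivals_mono[OF w0(1) tau(2)[OF that(1)]] that by auto
    \<comment> \<open>The ages of \<open>prob_arrivals_and_groups\<close> are indexed by groups, so the cell of a group has to be
      recovered from its index.\<close>
    define cell_of where "cell_of k = (LEAST i. k \<le> x ! Suc i)" for k
    have cell_of: "cell_of k = i" if "i < n" "k \<in> {x ! i<..x ! Suc i}" for i k
      unfolding cell_of_def
    proof (rule Least_equality)
      show "k \<le> x ! Suc i" using that by simp
      fix i' assume i': "k \<le> x ! Suc i'"
      show "i \<le> i'"
      proof (rule ccontr)
        assume "\<not> i \<le> i'"
        then have "x ! Suc i' \<le> x ! i" using that by (intro x_mono) auto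
        then show False using i' that by simp
      qed
    qed
    let ?K = "\<Union>i\<in>{..<n}. {x ! i<..x ! Suc i}"
    have "extinct_on_grid \<tau> n s \<inter> {\<omega> \<in> space M. X \<omega> = x} =
        {\<omega> \<in> space M. X \<omega> = x} \<inter> {\<omega> \<in> space M. \<forall>k\<in>?K. \<omega> \<in> group_extinct k (s (cell_of k))}"
    proof -
      have "\<omega> \<in> extinct_on_grid \<tau> n s \<longleftrightarrow> (\<forall>k\<in>?K. \<omega> \<in> group_extinct k (s (cell_of k)))"
        if "\<omega> \<in> space M" "X \<omega> = x" for \<omega>
      proof -
        have "\<omega> \<in> extinct_on_grid \<tau> n s \<longleftrightarrow> (\<forall>i<n. \<forall>k\<in>{x ! i<..x ! Suc i}. \<omega> \<in> group_extinct k (s i))"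
          using that X_nth[of _ \<omega>] by (simp add: extinct_on_grid_def)
        also have "\<dots> \<longleftrightarrow> (\<forall>i<n. \<forall>k\<in>{x ! i<..x ! Suc i}. \<omega> \<in> group_extinct k (s (cell_of k)))"
          using cell_of by (metis (no_types, lifting))
        also have "\<dots> \<longleftrightarrow> (\<forall>k\<in>?K. \<omega> \<in> group_extinct k (s (cell_of k)))" by blast
        finally show ?thesis .
      qed
      then show ?thesis by (auto simp: extinct_on_grid_def)
    qed
    moreover have "finite ?K" by simp
    moreover have "?K \<subseteq> {1..}" by (auto simp: Suc_le_eq intro: le_less_trans[OF le0])
    ultimately have "prob (extinct_on_grid \<tau> n s \<inter> {\<omega> \<in> space M. X \<omega> = x}) =
        prob {\<omega> \<in> space M. X \<omega> = x} * (\<Prod>k\<in>?K. pgf h (e (s (cell_of k))))"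
      by (simp only: prob_arrivals_and_groups[OF X_ev, where K = ?K and \<sigma> = "\<lambda>k. s (cell_of k)"])
    also have "(\<Prod>k\<in>?K. pgf h (e (s (cell_of k)))) = (\<Prod>i<n. \<Prod>k\<in>{x ! i<..x ! Suc i}. pgf h (e (s (cell_of k))))"
    proof (rule prod.UNION_disjoint)
      show "\<forall>i\<in>{..<n}. \<forall>j\<in>{..<n}. i \<noteq> j \<longrightarrow> {x ! i<..x ! Suc i} \<inter> {x ! j<..x ! Suc j} = {}"
        using cell_of by (metis (no_types, lifting) disjoint_iff lessThan_iff)
    qed auto
    also have "\<dots> = (\<Prod>i<n. \<Prod>k\<in>{x ! i<..x ! Suc i}. pgf h (e (s i)))"
      by (intro prod.cong refl) (auto simp: cell_of)
    also have "\<dots> = c x" by (simp add: c_def)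
    finally show ?thesis
      using pgf_range[OF e_range] by (simp add: emeasure_eq_measure mult.commute ennreal_mult c_def prod_nonneg)
  qed
  have "emeasure M (extinct_on_grid \<tau> n s) = (\<integral>\<^sup>+\<omega>. ennreal (c (X \<omega>)) \<partial>M)"
    unfolding emeasure_eq_sum_over_values[OF X_meas grid] cell
    by (rule nn_integral_eq_sum_over_values[OF X_meas, where c = "\<lambda>x. ennreal (c x)", symmetric])
  also have "\<dots> = (\<integral>\<^sup>+\<omega>. ennreal (\<Prod>i<n. pgf h (e (s i)) ^ (arrivals S (\<tau> (Suc i)) \<omega> - arrivals S (\<tau> i) \<omega>)) \<partial>M)"
    by (intro nn_integral_cong) (simp add: c_def X_nth)
  also have "\<dots> = ennreal (exp (- (\<Sum>i<n. (mean_measure r (\<tau> (Suc i)) - mean_measure r (\<tau> i)) * (1 - pgf h (e (s i))))))"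
    by (rule nn_integral_prod_increments[OF assms]) (use pgf_range[OF e_range] in blast)
  finally show ?thesis by (simp add: emeasure_eq_measure)
qed

lemma no_individuals_iff:
  assumes \<omega>: "\<omega> \<in> space M"
  shows "immigration_process S I T t \<omega> = 0 \<longleftrightarrow>
    (\<forall>k\<in>{1..arrivals S t \<omega>}. \<omega> \<in> group_extinct k (t - real_of_ereal (S k \<omega>)))"
  using \<omega> by (auto simp: immigration_process_def population_eq_0_iff group_extinct_def)

lemma jump_time:
  assumes "\<omega> \<in> space M" "1 \<le> k" "arrivals S s \<omega> < k" "k \<le> arrivals S t \<omega>"
  shows "s < real_of_ereal (S k \<omega>)" "real_of_ereal (S k \<omega>) \<le> t"
proof -
  have "S k \<omega> \<le> ereal t" "\<not> S k \<omega> \<le> ereal s" "0 < S k \<omega>"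
    using assms jump_le_iff[OF assms(1,2)] jump_pos[OF assms(1,2)] by auto
  then show "s < real_of_ereal (S k \<omega>)" "real_of_ereal (S k \<omega>) \<le> t"
    by (cases "S k \<omega>"; simp)+
qed

lemma arrival_cell:
  assumes \<omega>: "\<omega> \<in> space M" and k: "1 \<le> k" "k \<le> arrivals S (\<tau> n) \<omega>" and "\<tau> 0 = 0"
  shows "\<exists>i<n. k \<in> {arrivals S (\<tau> i) \<omega><..arrivals S (\<tau> (Suc i)) \<omega>}"
  using k(2)
proof (induction n)
  case 0
  then show ?case using k(1) arrivals_0[OF \<omega>] \<open>\<tau> 0 = 0\<close> by simp
next
  case (Suc n)
  show ?case
  proof (cases "k \<le> arrivals S (\<tau> n) \<omega>")
    case True
    then show ?thesis using Suc.IH less_SucI by blast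
  next
    case False
    then show ?thesis using Suc.prems by (intro exI[of _ n]) auto
  qed
qed

text \<open>A group that arrives in the cell \<open>{\<tau> i<..\<tau> (Suc i)}\<close> has an age between \<open>t - \<tau> (Suc i)\<close> and \<open>t - \<tau> i\<close> at
  time \<open>t\<close>. Extinction is permanent: demanding it at the lower bound is more, and demanding it at the upper
  bound is less, than being extinct at time \<open>t\<close>.\<close>

lemma no_individuals_grid:
  assumes tau: "\<tau> 0 = 0" "mono \<tau>" and n: "\<tau> n = t"
  shows "extinct_on_grid \<tau> n (\<lambda>i. t - \<tau> (Suc i)) \<subseteq> {\<omega> \<in> space M. immigration_process S I T t \<omega> = 0}"
    and "{\<omega> \<in> space M. immigration_process S I T t \<omega> = 0} \<subseteq> extinct_on_grid \<tau> n (\<lambda>i. t - \<tau> i)"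
proof -
  have le: "\<tau> i \<le> t" if "i \<le> n" for i using monoD[OF tau(2) that] n by simp
  show "extinct_on_grid \<tau> n (\<lambda>i. t - \<tau> (Suc i)) \<subseteq> {\<omega> \<in> space M. immigration_process S I T t \<omega> = 0}"
  proof
    fix \<omega> assume w: "\<omega> \<in> extinct_on_grid \<tau> n (\<lambda>i. t - \<tau> (Suc i))"
    then have \<omega>: "\<omega> \<in> space M" by (simp add: extinct_on_grid_def)
    have "\<omega> \<in> group_extinct k (t - real_of_ereal (S k \<omega>))" if k: "k \<in> {1..arrivals S t \<omega>}" for k
    proof -
      obtain i where i: "i < n" "k \<in> {arrivals S (\<tau> i) \<omega><..arrivals S (\<tau> (Suc i)) \<omega>}"
        using arrival_cell[OF \<omega>, of k \<tau> n] k tau n by auto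
      have "real_of_ereal (S k \<omega>) \<le> \<tau> (Suc i)"
        using jump_time(2)[OF \<omega>, of k "\<tau> i" "\<tau> (Suc i)"] i k by auto
      then have "group_extinct k (t - \<tau> (Suc i)) \<subseteq> group_extinct k (t - real_of_ereal (S k \<omega>))"
        using le[of "Suc i"] i by (intro group_extinct_mono) auto
      then show ?thesis using w i by (auto simp: extinct_on_grid_def)
    qed
    then show "\<omega> \<in> {\<omega> \<in> space M. immigration_process S I T t \<omega> = 0}"
      using \<omega> by (simp add: no_individuals_iff)
  qed
  show "{\<omega> \<in> space M. immigration_process S I T t \<omega> = 0} \<subseteq> extinct_on_grid \<tau> n (\<lambda>i. t - \<tau> i)"
  proof
    fix \<omega> assume "\<omega> \<in> {\<omega> \<in> space M. immigration_process S I T t \<omega> = 0}"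
    then have \<omega>: "\<omega> \<in> space M"
      and ext: "\<And>k. k \<in> {1..arrivals S t \<omega>} \<Longrightarrow> \<omega> \<in> group_extinct k (t - real_of_ereal (S k \<omega>))"
      using no_individuals_iff by auto
    have "\<omega> \<in> group_extinct k (t - \<tau> i)"
      if i: "i < n" and k: "k \<in> {arrivals S (\<tau> i) \<omega><..arrivals S (\<tau> (Suc i)) \<omega>}" for i k
    proof -
      have "arrivals S (\<tau> (Suc i)) \<omega> \<le> arrivals S t \<omega>" using i by (intro arrivals_mono[OF \<omega>] le) auto
      then have k': "k \<in> {1..arrivals S t \<omega>}" using k by auto
      have "\<tau> i < real_of_ereal (S k \<omega>)" "real_of_ereal (S k \<omega>) \<le> t"
        using jump_time[OF \<omega>, of k "\<tau> i" t] k k' by auto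
      then have "group_extinct k (t - real_of_ereal (S k \<omega>)) \<subseteq> group_extinct k (t - \<tau> i)"
        by (intro group_extinct_mono) auto
      then show ?thesis using ext[OF k'] by blast
    qed
    then show "\<omega> \<in> extinct_on_grid \<tau> n (\<lambda>i. t - \<tau> i)" using \<omega> by (simp add: extinct_on_grid_def)
  qed
qed

lemma no_individuals_event:
  assumes t: "0 \<le> t"
  shows "{\<omega> \<in> space M. immigration_process S I T t \<omega> = 0} \<in> events"
proof -
  note [measurable] = arrivals_measurable[OF t]
  \<comment> \<open>The sets \<open>C k j\<close> and the sizes \<open>D k\<close> are given trivial values for the index 0, for which the group
    data are arbitrary functions; the quantifiers can then range over all natural numbers.\<close>
  define B where "B k j = {\<omega> \<in> space M. alive (T k j \<omega>) (t - real_of_ereal (S k \<omega>)) = {}}" for k j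
  define C where "C k j = (if 1 \<le> k \<and> 1 \<le> j then B k j else space M)" for k j
  define D where "D k = (if 1 \<le> k then I k else (\<lambda>_. 0))" for k
  have B: "B k j \<in> events" if "1 \<le> k" "1 \<le> j" for k j
  proof -
    have "(\<lambda>\<omega>. (T k j \<omega>, t - real_of_ereal (S k \<omega>))) \<in> M \<rightarrow>\<^sub>M tree_law \<mu> p \<Otimes>\<^sub>M borel"
      using jump_measurable[OF that(1)] by (intro measurable_Pair tree_measurable that) measurable
    from measurable_compose[OF this measurable_extinct] show ?thesis by (simp add: B_def pred_def)
  qed
  have [measurable]: "C k j \<in> events" for k j using B by (simp add: C_def)
  have [measurable]: "D k \<in> M \<rightarrow>\<^sub>M count_space UNIV" for k using group_measurable by (simp add: D_def)
  have "{\<omega> \<in> space M. immigration_process S I T t \<omega> = 0} =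
      {\<omega> \<in> space M. \<forall>k. k \<le> arrivals S t \<omega> \<longrightarrow> (\<forall>j. j \<le> D k \<omega> \<longrightarrow> \<omega> \<in> C k j)}"
    by (rule Collect_cong) (auto simp: no_individuals_iff group_extinct_def B_def C_def D_def)
  also have "\<dots> \<in> events" by measurable
  finally show ?thesis .
qed

lemma mean_measure_diff:
  assumes "0 \<le> s" "s \<le> t"
  shows "mean_measure r t - mean_measure r s = (LINT u:{s<..t}|lborel. r u)"
  using set_integral_ivl_split[of 0 t r s] intensity_integrable[of t] assms by (simp add: mean_measure_def)

lemma integral_cells:
  fixes f :: "real \<Rightarrow> real"
  assumes tau: "\<tau> 0 = 0" "mono \<tau>" and f: "set_integrable lborel {0..\<tau> n} f"
  shows "(LINT u:{0..\<tau> n}|lborel. f u) = (\<Sum>i<n. LINT u:{\<tau> i<..\<tau> (Suc i)}|lborel. f u)"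
  using f
proof (induction n)
  case 0
  then show ?case using tau by (simp add: set_integral_point)
next
  case (Suc n)
  have le: "0 \<le> \<tau> n" "\<tau> n \<le> \<tau> (Suc n)" using monoD[OF tau(2), of 0 n] monoD[OF tau(2), of n "Suc n"] tau by auto
  have "set_integrable lborel {0..\<tau> n} f" using le by (intro set_integrable_subset[OF Suc.prems]) auto
  then show ?case using Suc.IH set_integral_ivl_split[OF Suc.prems le] by simp
qed

text \<open>On a fine grid the exponents of the two enclosing probabilities are Riemann-Stieltjes sums for the
  integral \<open>J\<close>. They differ from \<open>J\<close> by at most the oscillation \<open>\<eta>\<close> of \<open>q\<close> on a cell, times the total
  mass \<open>mean_measure r t\<close>.\<close>

lemma prob_no_individuals:
  assumes t: "0 \<le> t"
  shows "prob {\<omega> \<in> space M. immigration_process S I T t \<omega> = 0} =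
    exp (- (LINT u:{0..t}|lborel. r u * q_fun \<mu> p h (t - u) 0))"
proof -
  define q where "q s = q_fun \<mu> p h s 0" for s
  have q_eq: "q s = 1 - pgf h (e s)" for s by (simp add: q_def q_fun_def population_pgf_0)
  have q_cont: "continuous_on {0..t} q" unfolding q_eq by (intro continuous_intros pgf_e_continuous)
  have q_range: "0 \<le> q s" "q s \<le> 1" for s using pgf_range[of "e s" h] e_range[of s] by (auto simp: q_eq)
  define J where "J = (LINT u:{0..t}|lborel. r u * q (t - u))"
  define P where "P = prob {\<omega> \<in> space M. immigration_process S I T t \<omega> = 0}"
  have r_int: "set_integrable lborel {0..t} r" using intensity_integrable[OF t] .
  have J_int: "set_integrable lborel {0..t} (\<lambda>u. r u * q (t - u))"
  proof (rule convolution_integrable[OF r_int])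
    show "set_borel_measurable borel {0..t} q"
      unfolding set_borel_measurable_def using q_cont by (intro borel_measurable_continuous_on_indicator) auto
    show "\<bar>q (t - u)\<bar> \<le> 1" for u using q_range[of "t - u"] by simp
  qed simp
  have R_nonneg: "0 \<le> mean_measure r t"
    unfolding mean_measure_def by (intro set_integral_nonneg_real) (auto intro: intensity_nonneg)
  have bounds: "exp (- J - \<eta> * mean_measure r t) \<le> P \<and> P \<le> exp (- J + \<eta> * mean_measure r t)"
    if \<eta>: "0 < \<eta>" for \<eta>
  proof -
    have "uniformly_continuous_on {0..t} q" by (intro compact_uniformly_continuous q_cont) simp
    then obtain d where d: "0 < d"
      and q_close: "\<And>x y. x \<in> {0..t} \<Longrightarrow> y \<in> {0..t} \<Longrightarrow> \<bar>y - x\<bar> < d \<Longrightarrow> \<bar>q y - q x\<bar> < \<eta>"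
      using \<eta> unfolding uniformly_continuous_on_def dist_real_def by blast
    obtain n0 where "t / d < real n0" using reals_Archimedean2 by blast
    define n where "n = Suc n0"
    have n: "0 < n" "t / real n < d"
    proof -
      have "t < d * real n0" using \<open>t / d < real n0\<close> d by (simp add: field_simps)
      also have "\<dots> \<le> d * real n" using d by (simp add: n_def)
      finally show "t / real n < d" by (simp add: n_def field_simps)
    qed (simp add: n_def)
    define \<tau> where "\<tau> i = t * real i / real n" for i
    have tau: "\<tau> 0 = 0" "mono \<tau>" "\<tau> n = t"
      using t n by (auto simp: \<tau>_def intro!: monoI divide_right_mono mult_left_mono)
    have tau_le: "0 \<le> \<tau> i" "i \<le> n \<Longrightarrow> \<tau> i \<le> t" "\<tau> i \<le> \<tau> (Suc i)" for i
      using monoD[OF tau(2), of 0 i] monoD[OF tau(2), of i n] monoD[OF tau(2), of i "Suc i"] tau by auto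
    have step: "\<tau> (Suc i) - \<tau> i < d" for i
      using n by (simp add: \<tau>_def add_divide_distrib distrib_left)
    have R_sum: "mean_measure r t = (\<Sum>i<n. mean_measure r (\<tau> (Suc i)) - mean_measure r (\<tau> i))"
      using sum_lessThan_telescope[of "\<lambda>i. mean_measure r (\<tau> i)" n] tau
      by (simp add: mean_measure_def set_integral_point)
    have close: "\<bar>(\<Sum>i<n. (mean_measure r (\<tau> (Suc i)) - mean_measure r (\<tau> i)) * q (s i)) - J\<bar> \<le> \<eta> * mean_measure r t"
      if s: "\<And>i. i < n \<Longrightarrow> s i \<in> {t - \<tau> (Suc i)..t - \<tau> i}" for s
    proof -
      have cell: "\<bar>(mean_measure r (\<tau> (Suc i)) - mean_measure r (\<tau> i)) * q (s i) -
          (LINT u:{\<tau> i<..\<tau> (Suc i)}|lborel. r u * q (t - u))\<bar> \<le> \<eta> * (mean_measure r (\<tau> (Suc i)) - mean_measure r (\<tau> i))"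
        if i: "i < n" for i
      proof -
        let ?C = "{\<tau> i<..\<tau> (Suc i)}"
        have C: "?C \<subseteq> {0..t}" using tau_le[of i] tau_le(2)[of "Suc i"] i by auto
        have int: "set_integrable lborel ?C r" "set_integrable lborel ?C (\<lambda>u. r u * q (t - u))"
          using C by (auto intro!: set_integrable_subset[OF r_int] set_integrable_subset[OF J_int])
        have near: "\<bar>q (t - u) - q (s i)\<bar> \<le> \<eta>" if "u \<in> ?C" for u
          using q_close[of "s i" "t - u"] that C s[OF i] step[of i] tau_le[of i] tau_le(2)[of "Suc i"] i
          by (auto intro!: less_imp_le)
        have up: "(LINT u:?C|lborel. r u * q (t - u)) \<le> (LINT u:?C|lborel. r u * (q (s i) + \<eta>))"
        proof (intro set_integral_mono set_integrable_mult_left int)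
          fix u assume u: "u \<in> ?C"
          then show "r u * q (t - u) \<le> r u * (q (s i) + \<eta>)"
            using near[OF u] C by (intro mult_left_mono intensity_nonneg) (auto simp: abs_le_iff)
        qed
        have low: "(LINT u:?C|lborel. r u * (q (s i) - \<eta>)) \<le> (LINT u:?C|lborel. r u * q (t - u))"
        proof (intro set_integral_mono set_integrable_mult_left int)
          fix u assume u: "u \<in> ?C"
          then show "r u * (q (s i) - \<eta>) \<le> r u * q (t - u)"
            using near[OF u] C by (intro mult_left_mono intensity_nonneg) (auto simp: abs_le_iff)
        qed
        have "mean_measure r (\<tau> (Suc i)) - mean_measure r (\<tau> i) = (LINT u:?C|lborel. r u)"
          using tau_le by (intro mean_measure_diff)
        then show ?thesis
          using up low unfolding set_integral_mult_left by (simp add: abs_le_iff algebra_simps)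
      qed
      have "J = (\<Sum>i<n. LINT u:{\<tau> i<..\<tau> (Suc i)}|lborel. r u * q (t - u))"
        unfolding J_def using integral_cells[OF tau(1,2), of n "\<lambda>u. r u * q (t - u)"] J_int by (simp add: tau(3))
      then have "\<bar>(\<Sum>i<n. (mean_measure r (\<tau> (Suc i)) - mean_measure r (\<tau> i)) * q (s i)) - J\<bar> =
          \<bar>\<Sum>i<n. (mean_measure r (\<tau> (Suc i)) - mean_measure r (\<tau> i)) * q (s i) -
            (LINT u:{\<tau> i<..\<tau> (Suc i)}|lborel. r u * q (t - u))\<bar>"
        by (simp add: sum_subtractf)
      also have "\<dots> \<le> (\<Sum>i<n. \<eta> * (mean_measure r (\<tau> (Suc i)) - mean_measure r (\<tau> i)))"
        by (rule order_trans[OF sum_abs sum_mono]) (use cell in simp)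
      also have "\<dots> = \<eta> * mean_measure r t" unfolding R_sum by (simp only: sum_distrib_left)
      finally show ?thesis .
    qed
    have grid: "prob (extinct_on_grid \<tau> n s) =
        exp (- (\<Sum>i<n. (mean_measure r (\<tau> (Suc i)) - mean_measure r (\<tau> i)) * q (s i)))" for s
      unfolding q_eq using tau by (intro prob_extinct_on_grid) auto
    have "prob (extinct_on_grid \<tau> n (\<lambda>i. t - \<tau> (Suc i))) \<le> P"
      unfolding P_def by (intro finite_measure_mono no_individuals_grid tau no_individuals_event t)
    moreover have "P \<le> prob (extinct_on_grid \<tau> n (\<lambda>i. t - \<tau> i))"
      unfolding P_def by (intro finite_measure_mono no_individuals_grid tau extinct_on_grid_event) (simp add: tau)
    moreover have "exp (- J - \<eta> * mean_measure r t) \<le> prob (extinct_on_grid \<tau> n (\<lambda>i. t - \<tau> (Suc i)))"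
      unfolding grid using close[of "\<lambda>i. t - \<tau> (Suc i)"] tau_le by (simp add: abs_le_iff)
    moreover have "prob (extinct_on_grid \<tau> n (\<lambda>i. t - \<tau> i)) \<le> exp (- J + \<eta> * mean_measure r t)"
      unfolding grid using close[of "\<lambda>i. t - \<tau> i"] tau_le by (simp add: abs_le_iff)
    ultimately show ?thesis by linarith
  qed
  have "exp (- J) \<le> P"
  proof (rule tendsto_le[of "at_right 0" "\<lambda>_. P" P "\<lambda>\<eta>. exp (- J - \<eta> * mean_measure r t)"])
    show "((\<lambda>\<eta>. exp (- J - \<eta> * mean_measure r t)) \<longlongrightarrow> exp (- J)) (at_right 0)"
      by (auto intro!: tendsto_eq_intros)
    show "\<forall>\<^sub>F \<eta> in at_right 0. exp (- J - \<eta> * mean_measure r t) \<le> P"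
      using eventually_at_right_less[of "0::real"] by eventually_elim (use bounds in blast)
  qed auto
  moreover have "P \<le> exp (- J)"
  proof (rule tendsto_le[of "at_right 0" "\<lambda>\<eta>. exp (- J + \<eta> * mean_measure r t)" _ "\<lambda>_. P"])
    show "((\<lambda>\<eta>. exp (- J + \<eta> * mean_measure r t)) \<longlongrightarrow> exp (- J)) (at_right 0)"
      by (auto intro!: tendsto_eq_intros)
    show "\<forall>\<^sub>F \<eta> in at_right 0. P \<le> exp (- J + \<eta> * mean_measure r t)"
      using eventually_at_right_less[of "0::real"] by eventually_elim (use bounds in blast)
  qed auto
  ultimately show ?thesis by (simp add: P_def J_def q_def)
qed

end

section \<open>Asymptotics of the survival probability\<close>

theorem theorem4p1:
  fixes M :: "'a measure"
    and r :: "real \<Rightarrow> real" and S :: "nat \<Rightarrow> 'a \<Rightarrow> ereal"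
    and \<mu> :: real and p h :: "nat pmf"
    and I :: "nat \<Rightarrow> 'a \<Rightarrow> nat" and T :: "nat \<Rightarrow> nat \<Rightarrow> 'a \<Rightarrow> tree"
    and \<alpha> \<gamma> \<theta> :: real and L l L\<^sub>R :: "real \<Rightarrow> real"
  assumes "branching_poisson_immigration M r S \<mu> p h I T"
    and "measure_pmf.expectation p real = 1"
    and "slowly_varying L" and "slowly_varying l" and "slowly_varying L\<^sub>R"
    and "0 < \<gamma>" and "\<gamma> \<le> 1" and "0 < \<alpha>" and "\<alpha> \<le> 1"
    and "\<And>s. 0 \<le> s \<Longrightarrow> s < 1 \<Longrightarrow> pgf p s = s + (1 - s) powr (\<gamma> + 1) * L (1 / (1 - s))"
    and "\<And>s. 0 \<le> s \<Longrightarrow> s < 1 \<Longrightarrow> pgf h s = 1 - (1 - s) powr \<alpha> * l (1 / (1 - s))"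
    and "\<And>t. 0 < t \<Longrightarrow> r t = t powr (- \<theta>) * L\<^sub>R t"
    and "1 \<le> \<theta>" and "1 \<le> \<alpha> / \<gamma>"
  shows "((\<lambda>t. measure M {\<omega> \<in> space M. immigration_process S I T t \<omega> > 0}
             / (mean_measure r t * q_fun \<mu> p h t 0 + Q_fun \<mu> p h t * r t)) \<longlongrightarrow> 1) at_top"
proof -
  interpret branching_poisson_immigration M r S \<mu> p h I T by fact
  define q where "q t = q_fun \<mu> p h t 0" for t
  define J where "J t = (LINT u:{0..t}|lborel. r u * q (t - u))" for t
  define D where "D t = mean_measure r t * q t + Q_fun \<mu> p h t * r t" for t
  have q_kernel: "regular_kernel q (\<alpha> / \<gamma>)"
    unfolding q_def by (rule regular_kernel_q) (fact rate_pos assms)+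
  have r_kernel: "regular_kernel r \<theta>"
  proof
    have "slowly_varying (\<lambda>t. t powr (- (- \<theta>)) * r t)"
      by (rule slowly_varying_cong[OF assms(5)])
         (simp add: assms(12) mult.assoc[symmetric] powr_add[symmetric])
    then show "regularly_varying (- \<theta>) r" unfolding regularly_varying_def .
  qed (fact intensity_nonneg intensity_integrable assms)+
  have D_eq: "D t = (LINT u:{0..t}|lborel. r u) * q t + (LINT u:{0..t}|lborel. q u) * r t" for t
    by (simp add: D_def mean_measure_def Q_fun_def q_def)
  have J_D: "((\<lambda>t. J t / D t) \<longlongrightarrow> 1) at_top" and J_0: "(J \<longlongrightarrow> 0) at_top"
    using convolution_asymptotics[OF r_kernel q_kernel] unfolding J_def[abs_def] D_eq by auto
  have "\<forall>\<^sub>F t in at_top. J t / D t > 0" using order_tendstoD(1)[OF J_D, of 0] by simp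
  then have J_ne: "\<forall>\<^sub>F t in at_top. J t \<noteq> 0" by eventually_elim auto
  have "((\<lambda>x::real. (1 - exp (- x)) / x) \<longlongrightarrow> 1) (at 0)" by real_asymp
  moreover have "filterlim J (at 0) at_top" using J_0 J_ne by (simp add: filterlim_at)
  ultimately have "((\<lambda>t. (1 - exp (- J t)) / J t) \<longlongrightarrow> 1) at_top" by (rule filterlim_compose)
  from tendsto_mult[OF this J_D]
  have lim: "((\<lambda>t. (1 - exp (- J t)) / J t * (J t / D t)) \<longlongrightarrow> 1) at_top" by simp
  have "\<forall>\<^sub>F t in at_top. (1 - exp (- J t)) / J t * (J t / D t) =
      measure M {\<omega> \<in> space M. immigration_process S I T t \<omega> > 0} / D t"
    using J_ne eventually_ge_at_top[of 0]
  proof eventually_elim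
    case (elim t)
    have "{\<omega> \<in> space M. immigration_process S I T t \<omega> > 0} =
        space M - {\<omega> \<in> space M. immigration_process S I T t \<omega> = 0}"
      by (auto simp: zero_less_iff_neq_zero)
    then have "measure M {\<omega> \<in> space M. immigration_process S I T t \<omega> > 0} = 1 - exp (- J t)"
      using prob_compl[OF no_individuals_event[OF elim(2)]] prob_no_individuals[OF elim(2)]
      by (simp add: J_def q_def)
    then show ?case using elim by simp
  qed
  from Lim_transform_eventually[OF lim this] show ?thesis by (simp add: D_def q_def)
qed

end
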